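(* Let $n\ge2$, and let $\mathcal{E}=\mathcal{G}\times_{Z(\mathcal{G})}\mathcal{H}\mathcal{R}/\mathcal{H}$ be the central extension of $\mathcal{G}=\widetilde{\mathrm{Sp}(2n,\mathbb{R})}$ and $\mathcal{X}=\mathcal{G}/\mathcal{H}=\widetilde{\mathrm{Sp}(2n,\mathbb{R})}/\mathrm{SU}(n)$. The extended action $$\mathcal{G}\times_{Z(\mathcal{G})}\mathcal{H}\mathcal{R}/\mathcal{H}\to\mathrm{Diff}(\mathcal{X}),\qquad (g,r\mathcal{H})\cdot(x\mathcal{H})=(gxr)\mathcal{H},$$ is transitive and has compact stabilizer isomorphic to $\mathrm{U}(n)/\{\pm\mathrm{id}\}$.
   Context: $\mathrm{Sp}(2n,\mathbb{R})=\{M\in M_{2n}(\mathbb{R}): M^T\Omega M=\Omega\}$, $\Omega=\begin{pmatrix} 0 & I_n \\ -I_n & 0 \end{pmatrix}$. $\mathrm{U}(n)$ is embedded in $\mathrm{Sp}(2n,\mathbb{R})$ by $A+iB\mapsto\begin{pmatrix} A & -B \\ B & A \end{pmatrix}$ ($A,B$ real). Let $\pi:\widetilde{\mathrm{Sp}(2n,\mathbb{R})}\to\mathrm{Sp}(2n,\mathbb{R})$ be the universal covering and $\widetilde{\mathrm{U}(n)}=\pi^{-1}(\mathrm{U}(n))$. Put $\mathcal{G}=\widetilde{\mathrm{Sp}(2n,\mathbb{R})}$; $\mathcal{H}=\mathrm{SU}(n)\subset\mathcal{G}$, the identity component of $\pi^{-1}(\mathrm{SU}(n))$; $\mathcal{R}\cong\mathbb{R}$,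 the identity component of $\pi^{-1}(\{e^{ia}\mathrm{id}:a\in\mathbb{R}\})$. Then $\mathcal{H}\mathcal{R}=\widetilde{\mathrm{U}(n)}$ is a direct product and contains the center $Z(\mathcal{G})=\pi^{-1}(\{\pm\mathrm{id}\})$. Let $i:Z(\mathcal{G})\to\mathcal{G}$ be the inclusion and $\iota:Z(\mathcal{G})\to\mathcal{H}\mathcal{R}/\mathcal{H}\cong\mathbb{R}$ the restriction of the quotient map $\mathcal{H}\mathcal{R}\to\mathcal{H}\mathcal{R}/\mathcal{H}$. Elements of $\mathcal{H}\mathcal{R}/\mathcal{H}$ are written $r\mathcal{H}$, $r\in\mathcal{R}$. Define $$\mathcal{E}=\mathcal{G}\times_{Z(\mathcal{G})}\mathcal{H}\mathcal{R}/\mathcal{H}:=\frac{\mathcal{G}\times\mathcal{H}\mathcal{R}/\mathcal{H}}{\{(i(z),\iota(z)^{-1}):z\in Z(\mathcal{G})\}}.$$ The displayed formula in the claim gives a well-defined action of $\mathcal{E}$ on $\mathcal{X}$. *)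

theory Defs
  imports "HOL-Analysis.Analysis" "HOL-Algebra.Algebra"
begin

section \<open>Real symplectic and complex unitary matrices\<close>

text \<open>Matrices of size \<open>2n\<close> are indexed by the sum type \<open>'n + 'n\<close>, where \<open>n = CARD('n)\<close>;
  \<open>Inl\<close> is the first block of indices and \<open>Inr\<close> the second.\<close>

definition block_matrix ::
  "'a^'n^'n \<Rightarrow> 'a^'n^'n \<Rightarrow> 'a^'n^'n \<Rightarrow> 'a^'n^'n \<Rightarrow> 'a^('n + 'n)^('n + 'n)"
  where "block_matrix A B C D =
    (\<chi> i j. case i of
        Inl k \<Rightarrow> (case j of Inl l \<Rightarrow> A $ k $ l | Inr l \<Rightarrow> B $ k $ l)
      | Inr k \<Rightarrow> (case j of Inl l \<Rightarrow> C $ k $ l | Inr l \<Rightarrow> D $ k $ l))"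

definition symplectic_form :: "real^('n::finite + 'n)^('n + 'n)"
  where "symplectic_form = block_matrix 0 (mat 1) (- mat 1) 0"

definition Sp :: "(real^('n::finite + 'n)^('n + 'n)) monoid"
  where "Sp = \<lparr>carrier = {M. transpose M ** symplectic_form ** M = symplectic_form},
               mult = (**), one = mat 1\<rparr>"

definition conj_transpose :: "complex^'n^'n \<Rightarrow> complex^'n^'n"
  where "conj_transpose A = (\<chi> i j. cnj (A $ j $ i))"

definition U :: "(complex^'n::finite^'n) monoid"
  where "U = \<lparr>carrier = {A. conj_transpose A ** A = mat 1}, mult = (**), one = mat 1\<rparr>"

definition SU :: "(complex^'n::finite^'n) set"
  where "SU = {A \<in> carrier U. det A = 1}"

definition unit_scalars :: "(complex^'n::finite^'n) set"
  where "unit_scalars = {mat (cis a) | a. True}"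

definition realification :: "complex^'n^'n \<Rightarrow> real^('n::finite + 'n)^('n + 'n)"
  where "realification M =
    (let A = (\<chi> i j. Re (M $ i $ j)); B = (\<chi> i j. Im (M $ i $ j))
     in block_matrix A (- B) B A)"


section \<open>Quotient topologies and topological groups\<close>

definition quotient_topology :: "'a topology \<Rightarrow> ('a \<Rightarrow> 'b) \<Rightarrow> 'b topology"
  where "quotient_topology T q =
    topology (\<lambda>W. W \<subseteq> q ` topspace T \<and> openin T {x \<in> topspace T. q x \<in> W})"

lemma openin_quotient_topology:
  "openin (quotient_topology T q) W \<longleftrightarrow>
    W \<subseteq> q ` topspace T \<and> openin T {x \<in> topspace T. q x \<in> W}"
proof -
  let ?L = "\<lambda>W. W \<subseteq> q ` topspace T \<and> openin T {x \<in> topspace T. q x \<in> W}"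
  have "?L (S \<inter> S')" if "?L S" "?L S'" for S S'
  proof -
    have "{x \<in> topspace T. q x \<in> S \<inter> S'} =
        {x \<in> topspace T. q x \<in> S} \<inter> {x \<in> topspace T. q x \<in> S'}" by auto
    with that show ?thesis by (auto simp: openin_Int)
  qed
  moreover have "?L (\<Union>K)" if "\<forall>S\<in>K. ?L S" for K
  proof -
    have "{x \<in> topspace T. q x \<in> \<Union>K} = (\<Union>S\<in>K. {x \<in> topspace T. q x \<in> S})" by auto
    with that show ?thesis by (auto intro!: openin_Union)
  qed
  ultimately have "istopology ?L"
    unfolding istopology_def by blast
  then show ?thesis
    by (simp add: quotient_topology_def topology_inverse')
qed

lemma quotient_map_quotient_topology: "quotient_map T (quotient_topology T q) q"
proof -
  have "{x \<in> topspace T. q x \<in> q ` topspace T} = topspace T"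
    by auto
  then have "openin (quotient_topology T q) (q ` topspace T)"
    by (simp add: openin_quotient_topology)
  then have "topspace (quotient_topology T q) = q ` topspace T"
    by (meson openin_quotient_topology openin_subset openin_topspace subset_antisym)
  then show ?thesis
    by (simp add: quotient_map_def openin_quotient_topology)
qed

definition topological_group :: "('g::topological_space) monoid \<Rightarrow> bool"
  where "topological_group G \<longleftrightarrow>
    group G \<and>
    continuous_on (carrier G \<times> carrier G) (\<lambda>(x, y). x \<otimes>\<^bsub>G\<^esub> y) \<and>
    continuous_on (carrier G) (\<lambda>x. inv\<^bsub>G\<^esub> x)"

definition quotient_group_topology :: "('a, 'b) monoid_scheme \<Rightarrow> 'a topology \<Rightarrow> 'a set \<Rightarrow> 'a set topology"
  where "quotient_group_topology G T N = quotient_topology T (\<lambda>x. N #>\<^bsub>G\<^esub> x)"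

definition center :: "('a, 'b) monoid_scheme \<Rightarrow> 'a set"
  where "center G = {z \<in> carrier G. \<forall>x \<in> carrier G. z \<otimes>\<^bsub>G\<^esub> x = x \<otimes>\<^bsub>G\<^esub> z}"


section \<open>The universal covering group of the symplectic group\<close>

text \<open>The universal covering group is characterised, up to isomorphism over \<open>Sp\<close>, as a simply
  connected topological group with a covering homomorphism onto \<open>Sp\<close>. The predicate
  \<open>simply_connected\<close> includes path connectedness.\<close>

definition universal_covering_Sp ::
  "('g::topological_space) monoid \<Rightarrow> ('g \<Rightarrow> real^('n::finite + 'n)^('n + 'n)) \<Rightarrow> bool"
  where "universal_covering_Sp G \<pi> \<longleftrightarrow>
    topological_group G \<and> simply_connected (carrier G) \<and>
    \<pi> \<in> hom G Sp \<and> covering_space (carrier G) \<pi> (carrier Sp)"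

definition cover_SU ::
  "('g::topological_space) monoid \<Rightarrow> ('g \<Rightarrow> real^('n::finite + 'n)^('n + 'n)) \<Rightarrow> 'g set"
  where "cover_SU G \<pi> =
    connected_component_set {x \<in> carrier G. \<pi> x \<in> realification ` SU} \<one>\<^bsub>G\<^esub>"

definition cover_R ::
  "('g::topological_space) monoid \<Rightarrow> ('g \<Rightarrow> real^('n::finite + 'n)^('n + 'n)) \<Rightarrow> 'g set"
  where "cover_R G \<pi> =
    connected_component_set {x \<in> carrier G. \<pi> x \<in> realification ` unit_scalars} \<one>\<^bsub>G\<^esub>"

definition cover_HR ::
  "('g::topological_space) monoid \<Rightarrow> ('g \<Rightarrow> real^('n::finite + 'n)^('n + 'n)) \<Rightarrow> 'g monoid"
  where "cover_HR G \<pi> = G\<lparr>carrier := cover_SU G \<pi> <#>\<^bsub>G\<^esub> cover_R G \<pi>\<rparr>"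


section \<open>The extended group\<close>

text \<open>\<open>cover_SU G \<pi>\<close> is normal in \<open>carrier (cover_HR G \<pi>)\<close>, so the right cosets that make up the
  factor group are also left cosets; its elements are written \<open>r <# H\<close> below, and
  \<open>\<iota> z = z <# H\<close>. The center of \<open>G\<close> lies in \<open>carrier (cover_HR G \<pi>)\<close>.\<close>

definition HR_mod_H ::
  "('g::topological_space) monoid \<Rightarrow> ('g \<Rightarrow> real^('n::finite + 'n)^('n + 'n)) \<Rightarrow> 'g set monoid"
  where "HR_mod_H G \<pi> = cover_HR G \<pi> Mod cover_SU G \<pi>"

definition HR_mod_H_topology ::
  "('g::topological_space) monoid \<Rightarrow> ('g \<Rightarrow> real^('n::finite + 'n)^('n + 'n)) \<Rightarrow> 'g set topology"
  where "HR_mod_H_topology G \<pi> =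
    quotient_group_topology (cover_HR G \<pi>) (top_of_set (carrier (cover_HR G \<pi>))) (cover_SU G \<pi>)"

definition antidiagonal_center ::
  "('g::topological_space) monoid \<Rightarrow> ('g \<Rightarrow> real^('n::finite + 'n)^('n + 'n)) \<Rightarrow> ('g \<times> 'g set) set"
  where "antidiagonal_center G \<pi> =
    {(z, inv\<^bsub>HR_mod_H G \<pi>\<^esub> (z <#\<^bsub>G\<^esub> cover_SU G \<pi>)) | z. z \<in> center G}"

definition extended_group ::
  "('g::topological_space) monoid \<Rightarrow> ('g \<Rightarrow> real^('n::finite + 'n)^('n + 'n)) \<Rightarrow>
    ('g \<times> 'g set) set monoid"
  where "extended_group G \<pi> = (G \<times>\<times> HR_mod_H G \<pi>) Mod antidiagonal_center G \<pi>"

definition extended_group_topology ::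
  "('g::topological_space) monoid \<Rightarrow> ('g \<Rightarrow> real^('n::finite + 'n)^('n + 'n)) \<Rightarrow>
    ('g \<times> 'g set) set topology"
  where "extended_group_topology G \<pi> =
    quotient_group_topology (G \<times>\<times> HR_mod_H G \<pi>)
      (prod_topology (top_of_set (carrier G)) (HR_mod_H_topology G \<pi>)) (antidiagonal_center G \<pi>)"

text \<open>The element of the extended group represented by the pair \<open>(g, rH)\<close>.\<close>

definition extended_class ::
  "('g::topological_space) monoid \<Rightarrow> ('g \<Rightarrow> real^('n::finite + 'n)^('n + 'n)) \<Rightarrow> 'g \<Rightarrow> 'g \<Rightarrow>
    ('g \<times> 'g set) set"
  where "extended_class G \<pi> g r =
    antidiagonal_center G \<pi> #>\<^bsub>G \<times>\<times> HR_mod_H G \<pi>\<^esub> (g, r <#\<^bsub>G\<^esub> cover_SU G \<pi>)"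


section \<open>The homogeneous space and its diffeomorphisms\<close>

definition homogeneous_space ::
  "('g::topological_space) monoid \<Rightarrow> ('g \<Rightarrow> real^('n::finite + 'n)^('n + 'n)) \<Rightarrow> 'g set set"
  where "homogeneous_space G \<pi> = lcosets\<^bsub>G\<^esub> (cover_SU G \<pi>)"

text \<open>Functions of class \<open>C\<^sup>k\<close>, on open sets: all directional derivatives of order at most \<open>k\<close> exist
  and are continuous.\<close>

fun Ck_on :: "nat \<Rightarrow> 'a::euclidean_space set \<Rightarrow> ('a \<Rightarrow> real) \<Rightarrow> bool"
  where
    "Ck_on 0 W f \<longleftrightarrow> continuous_on W f"
  | "Ck_on (Suc k) W f \<longleftrightarrow>
      f differentiable_on W \<and> (\<forall>v. Ck_on k W (\<lambda>x. frechet_derivative f (at x) v))"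

definition smooth_on :: "'a::euclidean_space set \<Rightarrow> ('a \<Rightarrow> real) \<Rightarrow> bool"
  where "smooth_on W f \<longleftrightarrow> open W \<and> (\<forall>k. Ck_on k W f)"

text \<open>The symplectic group is an embedded submanifold of the space of matrices, so a function on it
  is smooth iff locally it extends to a smooth function of matrices; the smooth structure of the
  covering group is the one for which \<open>\<pi>\<close> is a local diffeomorphism.\<close>

definition smooth_on_cover ::
  "('g::topological_space) monoid \<Rightarrow> ('g \<Rightarrow> real^('n::finite + 'n)^('n + 'n)) \<Rightarrow> ('g \<Rightarrow> real) \<Rightarrow> bool"
  where "smooth_on_cover G \<pi> F \<longleftrightarrow>
    (\<forall>x \<in> carrier G. \<exists>V W f. openin (top_of_set (carrier G)) V \<and> x \<in> V \<and> \<pi> ` V \<subseteq> W \<and>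
       smooth_on W f \<and> (\<forall>y \<in> V. F y = f (\<pi> y)))"

text \<open>The projection of a Lie group onto its quotient by a closed subgroup is a surjective
  submersion, so a function on the quotient is smooth iff its pullback is.\<close>

definition smooth_on_quotient ::
  "('g::topological_space) monoid \<Rightarrow> ('g \<Rightarrow> real^('n::finite + 'n)^('n + 'n)) \<Rightarrow>
    ('g set \<Rightarrow> real) \<Rightarrow> bool"
  where "smooth_on_quotient G \<pi> F \<longleftrightarrow> smooth_on_cover G \<pi> (\<lambda>x. F (x <#\<^bsub>G\<^esub> cover_SU G \<pi>))"

text \<open>A map of manifolds is smooth iff it pulls smooth functions back to smooth functions.
  As in \<open>BijGroup\<close>, the elements are extensional functions.\<close>

definition diffeomorphisms ::
  "('g::topological_space) monoid \<Rightarrow> ('g \<Rightarrow> real^('n::finite + 'n)^('n + 'n)) \<Rightarrow>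
    ('g set \<Rightarrow> 'g set) set"
  where "diffeomorphisms G \<pi> =
    {\<phi> \<in> Bij (homogeneous_space G \<pi>). \<forall>F. smooth_on_quotient G \<pi> F \<longrightarrow>
       smooth_on_quotient G \<pi> (F \<circ> \<phi>) \<and>
       smooth_on_quotient G \<pi> (F \<circ> inv_into (homogeneous_space G \<pi>) \<phi>)}"

definition Diff ::
  "('g::topological_space) monoid \<Rightarrow> ('g \<Rightarrow> real^('n::finite + 'n)^('n + 'n)) \<Rightarrow>
    ('g set \<Rightarrow> 'g set) monoid"
  where "Diff G \<pi> = (BijGroup (homogeneous_space G \<pi>))\<lparr>carrier := diffeomorphisms G \<pi>\<rparr>"


section \<open>The extended action\<close>

definition extended_action ::
  "('g::topological_space) monoid \<Rightarrow> ('g \<Rightarrow> real^('n::finite + 'n)^('n + 'n)) \<Rightarrow>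
    ('g \<times> 'g set) set \<Rightarrow> 'g set \<Rightarrow> 'g set"
  where "extended_action G \<pi> =
    (\<lambda>e \<in> carrier (extended_group G \<pi>). \<lambda>c \<in> homogeneous_space G \<pi>.
       THE d. \<exists>g \<in> carrier G. \<exists>r \<in> cover_R G \<pi>. \<exists>x \<in> carrier G.
         e = extended_class G \<pi> g r \<and> c = x <#\<^bsub>G\<^esub> cover_SU G \<pi> \<and>
         d = (g \<otimes>\<^bsub>G\<^esub> x \<otimes>\<^bsub>G\<^esub> r) <#\<^bsub>G\<^esub> cover_SU G \<pi>)"

definition topological_isomorphism ::
  "('a, 'c) monoid_scheme \<Rightarrow> 'a topology \<Rightarrow> ('b, 'd) monoid_scheme \<Rightarrow> 'b topology \<Rightarrow>
    ('a \<Rightarrow> 'b) \<Rightarrow> bool"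
  where "topological_isomorphism G T G' T' f \<longleftrightarrow> f \<in> iso G G' \<and> homeomorphic_map T T' f"

end

theory Submission
  imports Defs
begin

text \<open>Let \<open>K\<close> be the preimage of \<open>U(n)\<close> in the covering group \<open>G\<close>. The subgroups \<open>H\<close> and \<open>R\<close> commute
  because commutators of \<open>K\<close> with the connected group \<open>R\<close> lie in the discrete kernel of \<open>\<pi>\<close>. The key point is
  \<open>K = H R\<close>, that is, the connectedness of \<open>K\<close>. Every \<open>g\<close> in \<open>Sp\<close> is moved towards \<open>U(n)\<close> by iterating
  \<open>g \<mapsto> g v(g\<^sup>T g)\<close>, where \<open>v\<close> is a rational function whose values on positive symplectic matrices are symplectic
  and uniformly close to \<open>1\<close>. A step so close to \<open>1\<close> lifts to \<open>G\<close>, so that a path in \<open>G\<close> from \<open>1\<close> to a point of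
  \<open>K\<close> can be pushed into a small neighbourhood of \<open>K\<close>. There the coset of \<open>H R\<close> is locally constant, because
  unitary matrices near \<open>1\<close> are joined to \<open>1\<close> by short Cayley paths. It follows that \<open>HR/H\<close> is commutative and
  contains the image of the center \<open>\<pi>\<inverse>{1, -1}\<close>, which makes the action well defined.

  The stabilizer of \<open>xH\<close> is the image of the homomorphism \<open>k \<mapsto> [(x k x\<inverse>, k\<inverse>H)]\<close> on \<open>K\<close>, whose kernel is the
  center, so it is \<open>K / \<pi>\<inverse>{1, -1} = U(n)/{1, -1}\<close>. The resulting continuous bijection from the compact group
  \<open>U(n)/{1, -1}\<close> is a homeomorphism since the stabilizer is Hausdorff.\<close>

section \<open>Matrices\<close>

text \<open>The natural retraction of \<open>Sp\<close> onto \<open>U(n)\<close> is polar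
  decomposition, which would call for square roots of positive matrices; a rational factor replaces
  it, and its continuity is Cramer's rule. The second obstacle is that \<open>Sp\<close> is not
  compact: a deformation lifts to \<open>G\<close> step by step only if each step multiplies by an
  element of one fixed sheet of \<open>\<pi>\<close> around the identity, wherever on
  \<open>Sp\<close> the step starts. Hence the uniform bound on the factor, and a parameter
  \<open>c\<close> chosen from the size of that sheet, at the price of many small steps. No rate of
  convergence is required: the defect \<open>norm (gram g - mat 1)\<close> drops strictly off
  \<open>U(n)\<close> and its sublevel sets are compact, so every orbit comes close to
  \<open>U(n)\<close>, and along a compact path one number of steps serves all points. Each step
  fixes \<open>K\<close> pointwise, so the two ends of the path stay in place. This is how path
  connectedness of \<open>G\<close> yields information about \<open>K\<close>, including the kernel
  of \<open>\<pi>\<close>, which is invisible in \<open>Sp\<close>.\<close>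

lemma continuous_on_matrix_mult [continuous_intros]:
  fixes f :: "'x::topological_space \<Rightarrow> ('a::{real_normed_algebra_1,semiring_1})^'n^'m"
  assumes "continuous_on S f" "continuous_on S g"
  shows "continuous_on S (\<lambda>x. f x ** g x)"
  unfolding matrix_matrix_mult_def
  by (intro continuous_intros assms)

lemma continuous_on_transpose [continuous_intros]:
  assumes "continuous_on S f"
  shows "continuous_on S (\<lambda>x. transpose (f x))"
  unfolding transpose_def by (intro continuous_intros assms)

lemma continuous_on_det [continuous_intros]:
  fixes f :: "'x::topological_space \<Rightarrow> ('a::{real_normed_field})^'n^'n"
  assumes "continuous_on S f"
  shows "continuous_on S (\<lambda>x. det (f x))"
  unfolding det_def by (intro continuous_intros assms)

lemma matrix_inv_mult:
  fixes A :: "('a::field)^'n^'n"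
  assumes "det A \<noteq> 0"
  shows "A ** matrix_inv A = mat 1" "matrix_inv A ** A = mat 1"
proof -
  have "\<exists>B. A ** B = mat 1 \<and> B ** A = mat 1"
    using assms invertible_det_nz invertible_def by metis
  then show "A ** matrix_inv A = mat 1" "matrix_inv A ** A = mat 1"
    unfolding matrix_inv_def by (metis (mono_tags, lifting) someI_ex)+
qed

text \<open>Cramer's rule for the columns of the inverse. It exhibits the entries as quotients of
  determinants, which is how \<open>matrix_inv\<close> is seen to be continuous.\<close>

lemma matrix_inv_nth:
  fixes A :: "('a::field)^'n^'n"
  assumes "det A \<noteq> 0"
  shows "matrix_inv A $ k $ l = det (\<chi> i j. if j = k then axis l 1 $ i else A $ i $ j) / det A"
proof -
  have *: "column l (matrix_inv A) = matrix_inv A *v axis l 1"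
    by (simp add: matrix_vector_mult_def column_def axis_def if_distrib cong: if_cong)
  have "A *v column l (matrix_inv A) = axis l 1"
    by (simp add: * matrix_vector_mul_assoc matrix_inv_mult assms)
  then have "column l (matrix_inv A) = (\<chi> k. det (\<chi> i j. if j = k then axis l 1 $ i else A $ i $ j) / det A)"
    using cramer[OF assms] by blast
  then show ?thesis
    by (simp add: column_def vec_eq_iff)
qed

lemma continuous_on_matrix_inv [continuous_intros]:
  fixes f :: "'x::topological_space \<Rightarrow> ('a::{real_normed_field})^'n^'n"
  assumes f: "continuous_on S f" and nz: "\<And>x. x \<in> S \<Longrightarrow> det (f x) \<noteq> 0"
  shows "continuous_on S (\<lambda>x. matrix_inv (f x))"
proof -
  have if_cont: "continuous_on S (\<lambda>x. if b then g x else h x)"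
    if "continuous_on S g" "continuous_on S h" for b :: bool and g h :: "'x \<Rightarrow> 'a"
    using that by (cases b) auto
  have "continuous_on S (\<lambda>x. \<chi> k l. det (\<chi> i j. if j = k then axis l 1 $ i else f x $ i $ j) / det (f x))"
    by (intro continuous_intros if_cont f) (use nz in auto)
  then show ?thesis
    by (rule continuous_on_eq) (simp add: vec_eq_iff matrix_inv_nth nz)
qed

lemma mat_scalar_mult: "mat a ** A = (\<chi> i j. (a::'a::semiring_1) * A $ i $ j)"
  by (simp add: matrix_matrix_mult_def mat_def if_distrib if_distribR vec_eq_iff cong: if_cong)

lemma scalar_mat_mult: "A ** mat a = (\<chi> i j. A $ i $ j * (a::'a::semiring_1))"
  by (simp add: matrix_matrix_mult_def mat_def if_distrib if_distribR vec_eq_iff cong: if_cong)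

lemma mat_commute: "mat a ** A = A ** mat (a::'a::comm_semiring_1)"
  by (simp add: mat_scalar_mult scalar_mat_mult mult.commute)

lemma det_mat: "det (mat a :: ('a::comm_ring_1)^'n^'n) = a ^ CARD('n)"
  by (subst det_diagonal) (auto simp: mat_def)

lemma transpose_mult_inner:
  fixes A :: "real^'n^'m"
  shows "(transpose A *v x) \<bullet> y = x \<bullet> (A *v y)"
  using dot_lmul_matrix[of x A y] by simp

lemma minus_matrix_mult: "(- A) ** B = - (A ** (B::('a::ring_1)^_^_))"
  by (simp add: matrix_matrix_mult_def vec_eq_iff sum_negf)

lemma matrix_mult_minus: "A ** (- B) = - (A ** (B::('a::ring_1)^_^_))"
  by (simp add: matrix_matrix_mult_def vec_eq_iff sum_negf)

lemma matrix_sub_ldistrib: "A ** (B - C) = A ** B - A ** (C::('a::ring_1)^_^_)"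
  using matrix_add_ldistrib[of A B "- C"] by (simp add: matrix_mult_minus)

lemma matrix_add_rdistrib: "(A + B) ** C = A ** C + B ** (C::('a::semiring_1)^_^_)"
  by (simp add: matrix_matrix_mult_def vec_eq_iff sum.distrib distrib_right)

lemma matrix_sub_rdistrib: "(A - B) ** C = A ** C - B ** (C::('a::ring_1)^_^_)"
  using matrix_add_rdistrib[of A "- B" C] by (simp add: minus_matrix_mult)

lemma transpose_add: "transpose (A + B) = transpose A + transpose B"
  by (simp add: transpose_def vec_eq_iff)

lemma transpose_minus: "transpose (- A) = - transpose A"
  by (simp add: transpose_def vec_eq_iff)

lemma minus_matrix_vector_mult: "(- A) *v x = - (A *v (x::('a::ring_1)^_))"
  by (simp add: matrix_vector_mult_def vec_eq_iff sum_negf)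

lemma transpose_0 [simp]: "transpose 0 = 0"
  by (simp add: transpose_def vec_eq_iff)

lemma mult_eq_mat_1_commute:
  fixes A :: "('a::field)^'n^'n"
  assumes "A ** B = mat 1"
  shows "B ** A = mat 1"
  using assms matrix_left_right_inverse by blast

section \<open>Symplectic matrices\<close>

lemma sum_UNIV_Plus: "(\<Sum>k\<in>(UNIV::('n::finite + 'm::finite) set). f k) = (\<Sum>k\<in>UNIV. f (Inl k)) + (\<Sum>k\<in>UNIV. f (Inr k))"
  by (subst UNIV_Plus_UNIV[symmetric], subst sum.Plus) simp_all

lemma block_matrix_mult:
  fixes A :: "('a::semiring_1)^'n::finite^'n"
  shows "block_matrix A B C D ** block_matrix A' B' C' D' =
    block_matrix (A ** A' + B ** C') (A ** B' + B ** D') (C ** A' + D ** C') (C ** B' + D ** D')"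
  by (simp add: block_matrix_def matrix_matrix_mult_def vec_eq_iff sum_UNIV_Plus split: sum.split)

lemma transpose_block_matrix:
  "transpose (block_matrix A B C D) = block_matrix (transpose A) (transpose C) (transpose B) (transpose D)"
  by (simp add: block_matrix_def transpose_def vec_eq_iff split: sum.split)

lemma mat_eq_block_matrix: "mat a = block_matrix (mat a) 0 0 (mat a)"
  by (simp add: block_matrix_def mat_def vec_eq_iff split: sum.split)

lemma block_matrix_eq_iff:
  fixes A :: "'a^'n::finite^'n"
  shows "block_matrix A B C D = block_matrix A' B' C' D' \<longleftrightarrow> A = A' \<and> B = B' \<and> C = C' \<and> D = D'"
  (is "?L = ?R")
proof
  assume ?L
  then have *: "block_matrix A B C D $ i $ j = block_matrix A' B' C' D' $ i $ j" for i j
    by simp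
  show ?R
    using *[of "Inl _" "Inl _"] *[of "Inl _" "Inr _"] *[of "Inr _" "Inl _"] *[of "Inr _" "Inr _"]
    by (simp add: block_matrix_def vec_eq_iff)
qed simp

lemma uminus_block_matrix: "- block_matrix A B C D = block_matrix (- A) (- B) (- C) (- D)"
  by (simp add: block_matrix_def vec_eq_iff split: sum.split)

lemma block_matrix_exhaust:
  fixes M :: "'a^('n::finite+'n)^('n+'n)"
  obtains A B C D where "M = block_matrix A B C D"
proof
  show "M = block_matrix (\<chi> i j. M $ Inl i $ Inl j) (\<chi> i j. M $ Inl i $ Inr j)
     (\<chi> i j. M $ Inr i $ Inl j) (\<chi> i j. M $ Inr i $ Inr j)"
    by (simp add: block_matrix_def vec_eq_iff split: sum.split)
qed

lemma transpose_symplectic_form: "transpose symplectic_form = - symplectic_form"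
  by (simp add: symplectic_form_def transpose_block_matrix uminus_block_matrix transpose_minus transpose_0)

lemma symplectic_form_square: "symplectic_form ** symplectic_form = - mat 1"
  by (simp add: symplectic_form_def block_matrix_mult mat_eq_block_matrix uminus_block_matrix
     minus_matrix_mult)

lemma carrier_Sp: "g \<in> carrier Sp \<longleftrightarrow> transpose g ** symplectic_form ** g = symplectic_form"
  by (simp add: Sp_def)

lemma mult_Sp [simp]: "g \<otimes>\<^bsub>Sp\<^esub> h = g ** h"
  and one_Sp [simp]: "\<one>\<^bsub>Sp\<^esub> = mat 1"
  by (simp_all add: Sp_def)

lemma Sp_inverse:
  assumes "g \<in> carrier Sp"
  shows "- (symplectic_form ** transpose g ** symplectic_form) ** g = mat 1"
    and "g ** - (symplectic_form ** transpose g ** symplectic_form) = mat 1"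
proof -
  show "- (symplectic_form ** transpose g ** symplectic_form) ** g = mat 1"
    using assms unfolding carrier_Sp
    by (metis matrix_mul_assoc minus_matrix_mult symplectic_form_square add.inverse_inverse)
  then show "g ** - (symplectic_form ** transpose g ** symplectic_form) = mat 1"
    by (rule mult_eq_mat_1_commute)
qed

lemma transpose_in_Sp:
  assumes "g \<in> carrier Sp"
  shows "transpose g \<in> carrier Sp"
proof -
  have "g ** symplectic_form ** transpose g ** symplectic_form = - mat 1"
    using Sp_inverse(2)[OF assms] by (simp add: matrix_mult_minus matrix_mul_assoc) (metis add.inverse_inverse)
  then have "g ** symplectic_form ** transpose g ** (symplectic_form ** symplectic_form) = - symplectic_form"
    by (metis matrix_mul_assoc matrix_mul_lid minus_matrix_mult)
  then show ?thesis
    by (simp add: carrier_Sp symplectic_form_square matrix_mult_minus)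
qed

lemma group_Sp: "group Sp"
proof (rule groupI)
  fix x y :: "real^('n::finite + 'n)^('n + 'n)"
  assume x: "x \<in> carrier Sp" and y: "y \<in> carrier Sp"
  have "transpose (x ** y) ** symplectic_form ** (x ** y) = transpose y ** (transpose x ** symplectic_form ** x) ** y"
    by (simp only: matrix_transpose_mul matrix_mul_assoc)
  with x y show "x \<otimes>\<^bsub>Sp\<^esub> y \<in> carrier Sp"
    unfolding carrier_Sp by simp
next
  fix x :: "real^('n::finite + 'n)^('n + 'n)"
  assume x: "x \<in> carrier Sp"
  obtain y where y: "x ** y = mat 1" "y ** x = mat 1"
    using Sp_inverse[OF x] by blast
  have "transpose (x ** y) ** symplectic_form ** (x ** y) = symplectic_form"
    unfolding y by simp
  then have "transpose y ** (transpose x ** symplectic_form ** x) ** y = symplectic_form"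
    by (simp only: matrix_transpose_mul matrix_mul_assoc)
  then have "y \<in> carrier Sp"
    using x unfolding carrier_Sp by simp
  then show "\<exists>y\<in>carrier Sp. y \<otimes>\<^bsub>Sp\<^esub> x = \<one>\<^bsub>Sp\<^esub>"
    using y by auto
qed (simp_all add: matrix_mul_assoc carrier_Sp)

lemma closed_Sp: "closed (carrier Sp :: (real^('n::finite + 'n)^('n + 'n)) set)"
proof -
  have "closed {g :: real^('n + 'n)^('n + 'n). transpose g ** symplectic_form ** g = symplectic_form}"
    by (intro closed_Collect_eq continuous_intros)
  then show ?thesis
    by (simp add: Sp_def)
qed

definition transvection :: "real^('n::finite + 'n) \<Rightarrow> real^('n + 'n)^('n + 'n)"
  where "transvection v = mat 1 + (\<chi> i j. v $ i * (symplectic_form *v v) $ j)"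

lemma transvection_mult_vec: "transvection v *v x = x + ((symplectic_form *v v) \<bullet> x) *\<^sub>R v"
  by (simp add: transvection_def matrix_vector_mult_add_rdistrib)
    (simp add: matrix_vector_mult_def inner_vec_def vec_eq_iff sum_distrib_left mult_ac)

lemma symplectic_form_inner: "x \<bullet> (symplectic_form *v y) = - ((symplectic_form *v x) \<bullet> y)"
  using transpose_mult_inner[of symplectic_form x y]
  by (simp add: transpose_symplectic_form minus_matrix_vector_mult)

lemma carrier_Sp_inner:
  "g \<in> carrier Sp \<longleftrightarrow> (\<forall>x y. (g *v x) \<bullet> (symplectic_form *v (g *v y)) = x \<bullet> (symplectic_form *v y))"
proof -
  have "(g *v x) \<bullet> (symplectic_form *v (g *v y)) = x \<bullet> ((transpose g ** symplectic_form ** g) *v y)" for x y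
    by (metis matrix_vector_mul_assoc transpose_mult_inner transpose_transpose)
  then show ?thesis
    unfolding carrier_Sp matrix_eq by (metis vector_eq_ldot)
qed

text \<open>The form vanishes on the pair \<open>v\<close>, \<open>v\<close>, and by antisymmetry
  the two remaining cross terms cancel.\<close>

lemma transvection_in_Sp: "transvection v \<in> carrier Sp"
proof -
  let ?W = "\<lambda>x. symplectic_form *v x"
  have 0: "v \<bullet> ?W v = 0"
    using symplectic_form_inner[of v v] by (simp add: inner_commute)
  have "(x + (?W v \<bullet> x) *\<^sub>R v) \<bullet> ?W (y + (?W v \<bullet> y) *\<^sub>R v) = x \<bullet> ?W y" for x y
  proof -
    have "x \<bullet> ?W v = ?W v \<bullet> x" "v \<bullet> ?W y = - (?W v \<bullet> y)"
      by (simp_all only: inner_commute symplectic_form_inner[of v y])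
    then show ?thesis
      by (simp add: 0 inner_add_left inner_add_right matrix_vector_right_distrib matrix_vector_mult_scaleR)
  qed
  then show ?thesis
    by (simp add: carrier_Sp_inner transvection_mult_vec)
qed

text \<open>Testing on \<open>axis i 1 + axis j 1\<close> forces the eigenvalues of any two
  coordinate vectors to agree.\<close>

lemma eigenvector_everywhere_imp_scalar:
  fixes M :: "real^'m^'m"
  assumes "\<And>v. \<exists>c. M *v v = c *\<^sub>R v"
  shows "\<exists>c. M = mat c"
proof -
  obtain c where c: "M *v v = c v *\<^sub>R v" for v
    using assms by metis
  have eq: "c (axis i 1) = c (axis j 1)" for i j
  proof (cases "i = j")
    case False
    let ?v = "axis i 1 + axis j 1 :: real^'m"
    have "c (axis i 1) *\<^sub>R axis i 1 + c (axis j 1) *\<^sub>R axis j 1 = c ?v *\<^sub>R ?v"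
      using c[of ?v] c[of "axis i 1"] c[of "axis j 1"] by (simp add: matrix_vector_right_distrib)
    then have "(c (axis i 1) *\<^sub>R axis i 1 + c (axis j 1) *\<^sub>R axis j 1) $ k = (c ?v *\<^sub>R ?v) $ k" for k
      by simp
    from this[of i] this[of j] False show ?thesis
      by (simp add: axis_def)
  qed simp
  obtain k :: 'm where True by simp
  have "M $ i $ j = (M *v axis j 1) $ i" for i j
    by (simp add: matrix_vector_mult_def axis_def if_distrib cong: if_cong)
  also have "\<dots> i j = mat (c (axis k 1)) $ i $ j" for i j
    using eq[of j k] by (simp add: c mat_def axis_def)
  finally have "M = mat (c (axis k 1))"
    by (simp add: vec_eq_iff)
  then show ?thesis ..
qed

text \<open>A matrix that commutes with the transvection along \<open>v\<close> has \<open>v\<close> as an eigenvector.\<close>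

lemma Sp_central_imp:
  fixes M :: "real^('n::finite + 'n)^('n + 'n)"
  assumes M: "M \<in> carrier Sp" and comm: "\<And>g. g \<in> carrier Sp \<Longrightarrow> M ** g = g ** M"
  shows "M = mat 1 \<or> M = - mat 1"
proof -
  have "\<exists>c. M *v v = c *\<^sub>R v" for v
  proof (cases "v = 0")
    case False
    let ?w = "symplectic_form *v v"
    have "?w \<noteq> 0"
    proof
      assume "?w = 0"
      then have "symplectic_form *v ?w = 0" by simp
      then show False
        using False by (simp add: matrix_vector_mul_assoc symplectic_form_square minus_matrix_vector_mult)
    qed
    \<comment> \<open>At \<open>?w\<close> the transvection adds the nonzero multiple
      \<open>?w \<bullet> ?w\<close> of \<open>v\<close>, so commutation isolates
      \<open>M *v v\<close>.\<close>
    have "M *v (transvection v *v ?w) = transvection v *v (M *v ?w)"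
      using comm[OF transvection_in_Sp, of v] by (metis matrix_vector_mul_assoc)
    then have "(?w \<bullet> ?w) *\<^sub>R (M *v v) = (?w \<bullet> (M *v ?w)) *\<^sub>R v"
      by (simp add: transvection_mult_vec matrix_vector_right_distrib matrix_vector_mult_scaleR)
    then have "(1 / (?w \<bullet> ?w)) *\<^sub>R (?w \<bullet> ?w) *\<^sub>R (M *v v) = (1 / (?w \<bullet> ?w)) *\<^sub>R (?w \<bullet> (M *v ?w)) *\<^sub>R v"
      by simp
    with \<open>?w \<noteq> 0\<close> show ?thesis
      by auto
  qed auto
  then obtain c where c: "M = mat c"
    using eigenvector_everywhere_imp_scalar by blast
  have "mat c ** (symplectic_form :: real^('n + 'n)^('n + 'n)) ** mat c = symplectic_form"
    using M by (simp add: carrier_Sp c)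
  \<comment> \<open>This entry of the form is 1, and the scalars multiply it by
    \<open>c * c\<close>.\<close>
  then have "(mat c ** (symplectic_form :: real^('n + 'n)^('n + 'n)) ** mat c) $ Inl i $ Inr i
      = symplectic_form $ Inl i $ Inr i" for i :: 'n
    by simp
  then have "c * c = 1"
    unfolding mat_scalar_mult scalar_mat_mult
    by (simp add: symplectic_form_def block_matrix_def mat_def)
  then have "c = 1 \<or> c = -1"
    by (simp add: square_eq_1_iff)
  moreover have "(mat (-1) :: real^('n + 'n)^('n + 'n)) = - mat 1"
    by (simp add: mat_def vec_eq_iff)
  ultimately show ?thesis
    using c by auto
qed

section \<open>Contracting the symplectic group onto its orthogonal part\<close>

lemma norm_matrix_le_sum:
  fixes A :: "real^'n^'m"
  shows "norm A \<le> (\<Sum>i\<in>UNIV. \<Sum>j\<in>UNIV. \<bar>A $ i $ j\<bar>)"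
proof -
  have "norm A \<le> (\<Sum>i\<in>UNIV. norm (A $ i))"
    by (simp add: norm_vec_def L2_set_le_sum)
  also have "\<dots> \<le> (\<Sum>i\<in>UNIV. \<Sum>j\<in>UNIV. \<bar>A $ i $ j\<bar>)"
    by (intro sum_mono norm_le_l1_cart)
  finally show ?thesis .
qed

lemma matrix_mult_axis: "(A *v axis j 1) $ i = A $ i $ (j :: 'n::finite)" for A :: "('a::semiring_1)^'n^'m"
  by (simp add: matrix_vector_mult_def axis_def if_distrib cong: if_cong)

text \<open>The norm is the Euclidean norm of all entries, not the operator norm. Bounding it by the
  sum of the entries costs a crude dimension factor, which the later choice of \<open>c\<close>
  absorbs.\<close>

lemma norm_matrix_le_of_vector_bound:
  fixes A :: "real^'n^'m"
  assumes "\<And>y. norm (A *v y) \<le> e * norm y"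
  shows "norm A \<le> real (CARD('m) * CARD('n)) * e"
proof -
  have "\<bar>A $ i $ j\<bar> \<le> e" for i j
  proof -
    have "\<bar>A $ i $ j\<bar> \<le> norm (A *v axis j 1)"
      using component_le_norm_cart[of "A *v axis j 1" i] by (simp add: matrix_mult_axis)
    also have "\<dots> \<le> e"
      using assms[of "axis j 1"] by simp
    finally show ?thesis .
  qed
  then have "(\<Sum>i\<in>UNIV. \<Sum>j\<in>UNIV. \<bar>A $ i $ j\<bar>) \<le> (\<Sum>i\<in>(UNIV::'m set). \<Sum>j\<in>(UNIV::'n set). e)"
    by (intro sum_mono)
  with norm_matrix_le_sum[of A] show ?thesis by simp
qed

text \<open>The rows of a symmetric matrix are its values on coordinate vectors, so a pointwise
  comparison of values compares row norms; a nonzero row of \<open>T\<close> makes the sum of their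
  squares strictly smaller.\<close>

lemma norm_symmetric_less:
  fixes S T :: "real^'n^'n"
  assumes sym: "transpose S = S" "transpose T = T"
    and less: "\<And>z. T *v z \<noteq> 0 \<Longrightarrow> norm (S *v z) < norm (T *v z)"
    and zero: "\<And>z. T *v z = 0 \<Longrightarrow> S *v z = 0"
    and "T \<noteq> 0"
  shows "norm S < norm T"
proof -
  have row: "A $ i = A *v axis i 1" if "transpose A = A" for A :: "real^'n^'n" and i
    using that by (simp add: vec_eq_iff matrix_mult_axis) (simp add: transpose_def)
  have le: "norm (S $ i) \<le> norm (T $ i)" for i
    unfolding row[OF sym(1)] row[OF sym(2)] using less[of "axis i 1"] zero[of "axis i 1"] by fastforce
  obtain i where "T $ i \<noteq> 0"
    using \<open>T \<noteq> 0\<close> by (metis vec_eq_iff zero_index)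
  then have "norm (S $ i) < norm (T $ i)"
    unfolding row[OF sym(1)] row[OF sym(2)] using less by blast
  then have "(\<Sum>i\<in>UNIV. (norm (S $ i))\<^sup>2) < (\<Sum>i\<in>UNIV. (norm (T $ i))\<^sup>2)"
    by (intro sum_strict_mono_ex1) (use le in \<open>auto intro!: power_mono power_strict_mono\<close>)
  then show ?thesis
    by (simp add: norm_vec_def L2_set_def)
qed

locale positive_matrix =
  fixes P :: "real^'n^'n"
  assumes sym: "transpose P = P" and pos: "x \<noteq> 0 \<Longrightarrow> x \<bullet> (P *v x) > 0"
begin

lemma inner_P: "(P *v x) \<bullet> y = x \<bullet> (P *v y)"
  using transpose_mult_inner[of P x y] by (simp add: sym)

lemma pos0: "x \<bullet> (P *v x) \<ge> 0"
  using pos[of x] by (cases "x = 0") auto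

definition shift :: "real \<Rightarrow> real^'n^'n"
  where "shift c = P + c *\<^sub>R mat 1"

text \<open>On an eigenvalue \<open>\<lambda>\<close> of \<open>P\<close> this is \<open>(1 + c \<lambda>) / (\<lambda> + c)\<close>: compatible with \<open>\<lambda> \<mapsto> 1/\<lambda>\<close>, hence symplectic
  if \<open>P\<close> is, uniformly close to \<open>1\<close> for \<open>c\<close> close to \<open>1\<close>, and pushing \<open>\<lambda>\<close> towards \<open>1\<close>.\<close>

definition damp :: "real \<Rightarrow> real^'n^'n"
  where "damp c = (mat 1 + c *\<^sub>R P) ** matrix_inv (shift c)"

lemma shift_mult_vec: "shift c *v x = P *v x + c *\<^sub>R x"
  by (simp add: shift_def matrix_vector_mult_add_rdistrib scaleR_matrix_vector_assoc[symmetric])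

lemma norm_shift: "(norm (shift c *v x))\<^sup>2 = (norm (P *v x))\<^sup>2 + 2 * c * (x \<bullet> (P *v x)) + c\<^sup>2 * (norm x)\<^sup>2"
  unfolding shift_mult_vec power2_norm_eq_inner
  by (simp add: inner_add_left inner_add_right inner_commute power2_eq_square algebra_simps)

context
  fixes c :: real
  assumes c: "1/2 \<le> c" "c < 1"
begin

lemma det_shift: "det (shift c) \<noteq> 0"
proof -
  have "x = 0" if "shift c *v x = 0" for x
  proof -
    have "(norm (shift c *v x))\<^sup>2 \<ge> c\<^sup>2 * (norm x)\<^sup>2"
      unfolding norm_shift using pos0[of x] c by auto
    with that c show ?thesis by (auto simp: mult_le_0_iff)
  qed
  then show ?thesis
    using invertible_det_nz invertible_left_inverse matrix_left_invertible_ker by metis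
qed

lemma damp_shift: "damp c ** shift c = mat 1 + c *\<^sub>R P"
  unfolding damp_def by (metis matrix_inv_mult(2)[OF det_shift] matrix_mul_assoc matrix_mul_rid)

lemma shift_surj: obtains x where "y = shift c *v x"
  using matrix_inv_mult(1)[OF det_shift] by (metis matrix_vector_mul_assoc matrix_vector_mul_lid)

lemma damp_shift_vec: "damp c *v (shift c *v x) = x + c *\<^sub>R (P *v x)"
  unfolding matrix_vector_mul_assoc damp_shift
  by (simp add: matrix_vector_mult_add_rdistrib scaleR_matrix_vector_assoc[symmetric])

text \<open>\<open>damp c\<close> is a quotient of two polynomials in the symmetric
  \<open>P\<close>. Commutation with \<open>shift c\<close> is tested on the image of
  \<open>shift c\<close>, which is everything, so the inverse never has to be computed.\<close>

lemma transpose_damp: "transpose (damp c) = damp c"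
proof -
  have ts: "transpose (shift c) = shift c"
    by (simp add: shift_def transpose_add transpose_scalar sym)
  have "damp c *v (shift c *v (shift c *v x)) = shift c *v (damp c *v (shift c *v x))" for x
    unfolding damp_shift_vec unfolding shift_mult_vec
    by (simp add: matrix_vector_right_distrib matrix_vector_mult_scaleR algebra_simps)
  then have comm: "damp c ** shift c = shift c ** damp c"
    by (metis shift_surj matrix_eq matrix_vector_mul_assoc)
  have "shift c ** transpose (damp c) = transpose (damp c ** shift c)"
    by (simp add: matrix_transpose_mul ts)
  also have "\<dots> = shift c ** damp c"
    by (simp add: comm[symmetric] damp_shift transpose_add transpose_scalar sym)
  finally show ?thesis
    by (metis matrix_inv_mult(2)[OF det_shift] matrix_mul_assoc matrix_mul_lid)
qed

text \<open>For \<open>y = shift c *v x\<close> the difference is \<open>(1 - c)\<close> times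
  \<open>x - P x\<close>, and \<open>x - P x\<close> has norm at most twice that of
  \<open>P x + c x\<close>, because \<open>x \<bullet> P x\<close> is nonnegative and
  \<open>2 c \<ge> 1\<close>. The bound does not involve \<open>P\<close>: this uniformity lets each
  step be lifted.\<close>

lemma norm_damp_minus_1: "norm (damp c - mat 1) \<le> real (CARD('n) * CARD('n)) * (2 * (1 - c))"
proof (rule norm_matrix_le_of_vector_bound)
  fix y
  obtain x where y: "y = shift c *v x"
    by (rule shift_surj)
  have "(damp c - mat 1) *v y = (1 - c) *\<^sub>R (x - P *v x)"
    by (simp add: y matrix_vector_mult_diff_rdistrib damp_shift_vec) (simp add: shift_mult_vec algebra_simps)
  moreover have "norm (x - P *v x) \<le> 2 * norm y"
  proof (rule power2_le_imp_le)
    have "(norm (x - P *v x))\<^sup>2 = (norm x)\<^sup>2 - 2 * (x \<bullet> (P *v x)) + (norm (P *v x))\<^sup>2"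
      unfolding power2_norm_eq_inner by (simp add: inner_diff_left inner_diff_right inner_commute)
    also have "\<dots> \<le> 4 * (c\<^sup>2 * (norm x)\<^sup>2 + 2 * c * (x \<bullet> (P *v x)) + (norm (P *v x))\<^sup>2)"
    proof -
      have "(2 * c)\<^sup>2 \<ge> 1\<^sup>2"
        using c by (intro power_mono) auto
      then have "(norm x)\<^sup>2 \<le> 4 * c\<^sup>2 * (norm x)\<^sup>2"
        using mult_right_mono[of 1 "4 * c\<^sup>2" "(norm x)\<^sup>2"] by (simp add: power2_eq_square)
      moreover have "0 \<le> c * (x \<bullet> (P *v x))"
        using c pos0 by simp
      moreover have "0 \<le> (norm (P *v x))\<^sup>2"
        by simp
      ultimately show ?thesis
        using pos0[of x] unfolding distrib_left by linarith
    qed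
    also have "\<dots> = (2 * norm y)\<^sup>2"
      by (simp add: y power_mult_distrib norm_shift)
    finally show "(norm (x - P *v x))\<^sup>2 \<le> (2 * norm y)\<^sup>2" .
  qed simp
  ultimately have "norm ((damp c - mat 1) *v y) \<le> (1 - c) * (2 * norm y)"
    using c mult_left_mono[of "norm (x - P *v x)" "2 * norm y" "1 - c"] by simp
  then show "norm ((damp c - mat 1) *v y) \<le> 2 * (1 - c) * norm y"
    by (simp only: mult_ac)
qed

text \<open>With \<open>A = shift c\<close> and \<open>B = mat 1 + c *\<^sub>R P\<close>, both
  \<open>A W A\<close> and \<open>B W B\<close> expand to
  \<open>(1 + c\<^sup>2) W + c (P W + W P)\<close>. Since \<open>damp c\<close> is \<open>B\<close>
  divided by \<open>A\<close> on either side, \<open>A\<close> cancels.\<close>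

lemma damp_preserves_form:
  assumes "P ** W ** P = W"
  shows "damp c ** W ** damp c = W"
proof -
  let ?A = "shift c" and ?v = "damp c" and ?B = "mat 1 + c *\<^sub>R P"
  have AWA: "?A ** W ** ?A = ?B ** W ** ?B"
    unfolding shift_def using assms
    by (simp add: matrix_add_ldistrib matrix_add_rdistrib scalar_matrix_assoc[symmetric] matrix_scalar_ac
        algebra_simps)
  have "?A ** ?v = ?B"
    using arg_cong[OF damp_shift, of transpose]
    by (simp add: matrix_transpose_mul transpose_damp transpose_add transpose_scalar sym shift_def)
  then have "?A ** (?v ** W ** ?v) ** ?A = ?B ** W ** ?B"
    by (metis damp_shift matrix_mul_assoc)
  then have "matrix_inv ?A ** (?A ** (?v ** W ** ?v) ** ?A) ** matrix_inv ?A
      = matrix_inv ?A ** (?A ** W ** ?A) ** matrix_inv ?A"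
    by (simp only: AWA)
  moreover have "matrix_inv ?A ** (?A ** M ** ?A) ** matrix_inv ?A = M" for M
  proof -
    have "matrix_inv ?A ** (?A ** M ** ?A) ** matrix_inv ?A = (matrix_inv ?A ** ?A) ** M ** (?A ** matrix_inv ?A)"
      by (simp only: matrix_mul_assoc)
    then show ?thesis
      by (simp add: matrix_inv_mult[OF det_shift])
  qed
  ultimately show ?thesis by simp
qed

text \<open>With \<open>D = (P + c)\<^sup>2\<close> and \<open>N = D - (1 - c\<^sup>2) P (P + 1)\<close> one has \<open>damp c P damp c - 1 = (P - 1) N D\<^sup>-\<^sup>1\<close>, and
  \<open>\<bar>N w\<bar> < \<bar>D w\<bar>\<close> because \<open>(D - N) (D + N)\<close> is a polynomial in \<open>P\<close> with positive coefficients.\<close>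

lemma norm_damped_less:
  assumes "P \<noteq> mat 1"
  shows "norm (damp c ** P ** damp c - mat 1) < norm (P - mat 1)"
proof (rule norm_symmetric_less)
  show "transpose (damp c ** P ** damp c - mat 1) = damp c ** P ** damp c - mat 1"
    by (simp add: diff_conv_add_uminus transpose_add transpose_minus matrix_transpose_mul transpose_damp sym
        matrix_mul_assoc del: add_uminus_conv_diff)
  show "transpose (P - mat 1) = P - mat 1"
    by (simp add: diff_conv_add_uminus transpose_add transpose_minus sym del: add_uminus_conv_diff)
  show "P - mat 1 \<noteq> 0"
    using assms by simp
  \<comment> \<open>\<open>E\<close> is \<open>D - N\<close> in the notation above, so that
    \<open>(D - N) (D + N)\<close> reads \<open>E (2 D - E)\<close>.\<close>
  define E where "E w = (1 - c\<^sup>2) *\<^sub>R (P *v (P *v w) + P *v w)" for w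
  define D where "D w = shift c *v (shift c *v w)" for w
  have D: "D w = P *v (P *v w) + (2 * c) *\<^sub>R (P *v w) + c\<^sup>2 *\<^sub>R w" for w
    unfolding D_def shift_mult_vec
    by (simp only: matrix_vector_right_distrib matrix_vector_mult_scaleR scaleR_right_distrib scaleR_scaleR
        mult_2 scaleR_left_distrib power2_eq_square add_ac)
  have less: "norm (D w - E w) < norm (D w)" if "w \<noteq> 0" for w
  proof -
    let ?p = "P *v w" and ?q = "P *v (P *v w)"
    have ip: "?q \<bullet> ?p = ?p \<bullet> ?q" "?q \<bullet> w = ?p \<bullet> ?p" "?p \<bullet> w = w \<bullet> ?p" "w \<bullet> ?q = ?p \<bullet> ?p"
      by (simp_all add: inner_commute inner_P)
    have c2: "c\<^sup>2 < 1" "c\<^sup>2 > 0"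
      using c by (simp_all add: power_less_one_iff abs_square_less_1)
    have F: "2 *\<^sub>R D w - E w = (1 + c\<^sup>2) *\<^sub>R ?q + (c\<^sup>2 + 4 * c - 1) *\<^sub>R ?p + (2 * c\<^sup>2) *\<^sub>R w"
      unfolding D E_def by (simp add: vec_eq_iff algebra_simps)
    have "E w \<bullet> (2 *\<^sub>R D w - E w) = (1 - c\<^sup>2) * ((1 + c\<^sup>2) * (?q \<bullet> ?q) + (c\<^sup>2 + 4 * c - 1) * (?p \<bullet> ?q)
        + 2 * c\<^sup>2 * (?p \<bullet> ?p) + (1 + c\<^sup>2) * (?p \<bullet> ?q) + (c\<^sup>2 + 4 * c - 1) * (?p \<bullet> ?p) + 2 * c\<^sup>2 * (w \<bullet> ?p))"
      unfolding F unfolding E_def by (simp add: inner_add_left inner_add_right ip algebra_simps)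
    also have "\<dots> > 0"
    proof -
      \<comment> \<open>The only coefficient whose sign is in doubt; \<open>c \<ge> 1/2\<close>
        settles it.\<close>
      have "c\<^sup>2 + 4 * c - 1 \<ge> 0"
        using c c2 by linarith
      moreover have "?p \<bullet> ?q \<ge> 0"
        by (rule pos0)
      moreover have "w \<bullet> ?p > 0"
        using pos[OF that] .
      ultimately show ?thesis
        using c2 by (intro mult_pos_pos add_nonneg_pos add_nonneg_nonneg mult_nonneg_nonneg) auto
    qed
    finally have "E w \<bullet> (2 *\<^sub>R D w - E w) > 0" .
    moreover have "(norm (D w))\<^sup>2 - (norm (D w - E w))\<^sup>2 = E w \<bullet> (2 *\<^sub>R D w - E w)"
      unfolding power2_norm_eq_inner
      by (simp add: inner_diff_left inner_diff_right inner_commute algebra_simps)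
    ultimately have "(norm (D w - E w))\<^sup>2 < (norm (D w))\<^sup>2"
      by simp
    then show ?thesis
      by (rule power2_less_imp_less) simp
  qed
  \<comment> \<open>Writing \<open>z = D x\<close> clears the denominators: everything becomes a
    polynomial in \<open>P\<close> applied to \<open>x\<close>, and \<open>w = P x - x\<close> is
    the common factor.\<close>
  have key: "\<exists>w. (P - mat 1) *v z = D w \<and> (damp c ** P ** damp c - mat 1) *v z = D w - E w" for z
  proof -
    obtain x where z: "z = D x"
      unfolding D_def using shift_surj by metis
    let ?w = "P *v x - x"
    let ?u = "x + c *\<^sub>R (P *v x)"
    have "damp c *v z = shift c *v x + c *\<^sub>R (P *v (shift c *v x))"
      unfolding z D_def by (rule damp_shift_vec)
    also have "\<dots> = shift c *v ?u"
      unfolding shift_mult_vec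
      by (simp only: matrix_vector_right_distrib matrix_vector_mult_scaleR scaleR_right_distrib add_ac)
    finally have "damp c *v z = shift c *v ?u" .
    moreover have "P *v (shift c *v ?u) = shift c *v (P *v ?u)"
      unfolding shift_mult_vec by (simp only: matrix_vector_right_distrib matrix_vector_mult_scaleR)
    ultimately have "damp c *v (P *v (damp c *v z)) = damp c *v (shift c *v (P *v ?u))"
      by simp
    then have "(damp c ** P ** damp c - mat 1) *v z = D ?w - E ?w"
      unfolding damp_shift_vec
      by (simp add: matrix_vector_mult_diff_rdistrib matrix_vector_mul_assoc[symmetric] z D E_def
        matrix_vector_right_distrib matrix_vector_mult_diff_distrib matrix_vector_mult_scaleR)
        (simp add: vec_eq_iff power2_eq_square algebra_simps)
    moreover have "(P - mat 1) *v z = D ?w"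
      by (simp add: matrix_vector_mult_diff_rdistrib z D
        matrix_vector_right_distrib matrix_vector_mult_diff_distrib matrix_vector_mult_scaleR)
    ultimately show ?thesis by blast
  qed
  have D_0: "w = 0" if "D w = 0" for w
    using that less[of w] by auto
  fix z
  obtain w where w: "(P - mat 1) *v z = D w" "(damp c ** P ** damp c - mat 1) *v z = D w - E w"
    using key by blast
  show "norm ((damp c ** P ** damp c - mat 1) *v z) < norm ((P - mat 1) *v z)" if "(P - mat 1) *v z \<noteq> 0"
    using that less[of w] D[of 0] unfolding w by (cases "w = 0") simp_all
  show "(damp c ** P ** damp c - mat 1) *v z = 0" if "(P - mat 1) *v z = 0"
    using that D_0[of w] unfolding w by (auto simp: D E_def)
qed

end

end

lemma norm_matrix_vector_le: "norm (A *v y) \<le> norm A * norm (y :: real^'n)" for A :: "real^'n^'m"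
proof -
  have "norm (A *v y) \<le> L2_set (\<lambda>i. norm (A $ i) * norm y) UNIV"
    unfolding norm_vec_def[of "A *v y"]
    by (intro L2_set_mono) (simp_all add: matrix_vector_mul_component Cauchy_Schwarz_ineq2)
  also have "\<dots> = norm A * norm y"
    by (simp add: norm_vec_def[of A] L2_set_left_distrib)
  finally show ?thesis .
qed

text \<open>The square of the positive part of the polar decomposition. Its distance from
  \<open>mat 1\<close>, the defect, serves as the Lyapunov function of the contraction.\<close>

definition gram :: "real^'m^'m \<Rightarrow> real^'m^'m"
  where "gram g = transpose g ** g"

definition retract_factor :: "real \<Rightarrow> real^'m^'m \<Rightarrow> real^'m^'m"
  where "retract_factor c g = positive_matrix.damp (gram g) c"

definition retract_step :: "real \<Rightarrow> real^'m^'m \<Rightarrow> real^'m^'m"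
  where "retract_step c g = g ** retract_factor c g"

lemma continuous_on_gram [continuous_intros]:
  "continuous_on S f \<Longrightarrow> continuous_on S (\<lambda>x. gram (f x))"
  unfolding gram_def by (intro continuous_intros)

lemma Sp_mult_vec_eq_0:
  assumes "g \<in> carrier Sp" "g *v x = 0"
  shows "x = 0"
  using Sp_inverse(1)[OF assms(1)] assms(2)
  by (metis matrix_vector_mul_assoc matrix_vector_mul_lid matrix_vector_mult_0_right)

lemma gram_inner: "x \<bullet> (gram g *v x) = (norm (g *v x))\<^sup>2"
  unfolding gram_def power2_norm_eq_inner
  by (metis matrix_vector_mul_assoc transpose_mult_inner transpose_transpose)

lemma positive_gram: "g \<in> carrier Sp \<Longrightarrow> positive_matrix (gram g)"
proof
  show "transpose (gram g) = gram g"
    by (simp add: gram_def matrix_transpose_mul)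
qed (use Sp_mult_vec_eq_0 in \<open>auto simp: gram_inner\<close>)

lemma gram_preserves_form:
  assumes "g \<in> carrier Sp"
  shows "gram g ** symplectic_form ** gram g = symplectic_form"
proof -
  have "gram g ** symplectic_form ** gram g = transpose g ** (g ** symplectic_form ** transpose g) ** g"
    by (simp only: gram_def matrix_mul_assoc)
  then show ?thesis
    using assms transpose_in_Sp[OF assms] unfolding carrier_Sp by simp
qed

context
  fixes c :: real
  assumes c: "1/2 \<le> c" "c < 1"
begin

lemma retract_factor_in_Sp:
  assumes "g \<in> carrier Sp"
  shows "retract_factor c g \<in> carrier Sp"
  using positive_matrix.damp_preserves_form[OF positive_gram[OF assms] c gram_preserves_form[OF assms]]
    positive_matrix.transpose_damp[OF positive_gram[OF assms] c]
  by (simp add: carrier_Sp retract_factor_def)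

lemma retract_step_in_Sp: "g \<in> carrier Sp \<Longrightarrow> retract_step c g \<in> carrier Sp"
  using monoid.m_closed[OF group.is_monoid[OF group_Sp]] retract_factor_in_Sp
  by (fastforce simp: retract_step_def)

lemma norm_retract_factor:
  fixes g :: "real^('n::finite + 'n)^('n + 'n)"
  assumes "g \<in> carrier Sp"
  shows "norm (retract_factor c g - mat 1) \<le> real (CARD('n + 'n) * CARD('n + 'n)) * (2 * (1 - c))"
  unfolding retract_factor_def by (rule positive_matrix.norm_damp_minus_1[OF positive_gram[OF assms] c])

lemma continuous_on_retract_factor: "continuous_on (carrier Sp) (retract_factor c)"
proof -
  have "continuous_on (carrier Sp)
      (\<lambda>g. (mat 1 + c *\<^sub>R gram g) ** matrix_inv (gram g + c *\<^sub>R mat 1))"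
    by (intro continuous_intros)
      (metis positive_matrix.det_shift positive_matrix.shift_def positive_gram c)
  then show ?thesis
    by (rule continuous_on_eq)
      (simp add: retract_factor_def positive_matrix.damp_def positive_matrix.shift_def positive_gram)
qed

lemma continuous_on_retract_step: "continuous_on (carrier Sp) (retract_step c)"
  unfolding retract_step_def by (intro continuous_intros continuous_on_retract_factor)

lemma gram_retract_step:
  assumes "g \<in> carrier Sp"
  shows "gram (retract_step c g) = retract_factor c g ** gram g ** retract_factor c g"
  using positive_matrix.transpose_damp[OF positive_gram[OF assms] c]
  by (simp add: gram_def retract_step_def matrix_transpose_mul matrix_mul_assoc)
    (simp add: retract_factor_def gram_def)

lemma defect_retract_step_less:
  assumes "g \<in> carrier Sp" "gram g \<noteq> mat 1"
  shows "norm (gram (retract_step c g) - mat 1) < norm (gram g - mat 1)"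
  unfolding gram_retract_step[OF assms(1)] retract_factor_def
  by (rule positive_matrix.norm_damped_less[OF positive_gram[OF assms(1)] c assms(2)])

lemma retract_step_unitary:
  fixes g :: "real^'m^'m"
  assumes "gram g = mat 1"
  shows "retract_step c g = g"
proof -
  have P: "positive_matrix (mat 1 :: real^'m^'m)"
    by unfold_locales auto
  have "positive_matrix.shift (mat 1 :: real^'m^'m) c = mat 1 + c *\<^sub>R mat 1"
    by (simp add: positive_matrix.shift_def[OF P])
  then have "positive_matrix.damp (mat 1 :: real^'m^'m) c = mat 1"
    using matrix_inv_mult(1)[OF positive_matrix.det_shift[OF P c]]
    by (simp add: positive_matrix.damp_def[OF P])
  then show ?thesis
    by (simp add: retract_step_def retract_factor_def assms)
qed

lemma defect_retract_step_le:
  assumes "g \<in> carrier Sp"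
  shows "norm (gram (retract_step c g) - mat 1) \<le> norm (gram g - mat 1)"
  using defect_retract_step_less[OF assms] retract_step_unitary[of g] by fastforce

end

text \<open>Because \<open>y \<bullet> (gram g *v y)\<close> is the squared norm of
  \<open>g *v y\<close>, a bound on the defect bounds \<open>g\<close> itself. This supplies the
  compactness that \<open>Sp\<close> lacks; \<open>B = 0\<close> gives the compactness of
  \<open>U(n)\<close>.\<close>

lemma compact_bounded_defect:
  "compact {g \<in> carrier (Sp :: (real^('n::finite + 'n)^('n + 'n)) monoid). norm (gram g - mat 1) \<le> B}"
proof -
  let ?S = "{g \<in> carrier (Sp :: (real^('n + 'n)^('n + 'n)) monoid). norm (gram g - mat 1) \<le> B}"
  have "norm g \<le> real (CARD('n + 'n) * CARD('n + 'n)) * sqrt (1 + B)"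
    if g: "norm (gram g - mat 1) \<le> B" for g :: "real^('n + 'n)^('n + 'n)"
  proof (rule norm_matrix_le_of_vector_bound)
    fix y :: "real^('n + 'n)"
    have "(norm (g *v y))\<^sup>2 = y \<bullet> y + y \<bullet> ((gram g - mat 1) *v y)"
      by (simp add: gram_inner[symmetric] matrix_vector_mult_diff_rdistrib inner_diff_right)
    also have "y \<bullet> ((gram g - mat 1) *v y) \<le> norm y * (norm (gram g - mat 1) * norm y)"
      by (meson Cauchy_Schwarz_ineq2 abs_le_D1 mult_left_mono norm_ge_zero order_trans norm_matrix_vector_le)
    also have "\<dots> \<le> norm y * (B * norm y)"
      using g by (intro mult_left_mono mult_right_mono) auto
    finally have "(norm (g *v y))\<^sup>2 \<le> (1 + B) * (norm y)\<^sup>2"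
      by (simp add: power2_eq_square dot_square_norm algebra_simps)
    then show "norm (g *v y) \<le> sqrt (1 + B) * norm y"
      by (metis norm_ge_zero real_le_rsqrt real_sqrt_abs2 real_sqrt_mult real_sqrt_pow2_iff power2_eq_square abs_norm_cancel)
  qed
  then have "bounded ?S"
    unfolding bounded_iff by blast
  moreover have "closed {g :: real^('n + 'n)^('n + 'n). norm (gram g - mat 1) \<le> B}"
    by (intro closed_Collect_le continuous_intros)
  then have "closed ?S"
    using closed_Int[OF closed_Sp] by (simp add: Collect_conj_eq)
  ultimately show ?thesis
    by (simp add: compact_eq_bounded_closed)
qed

text \<open>LaSalle's principle: a limit point of an orbit has the same defect as its successor.\<close>

lemma retract_iterates_defect:
  fixes g :: "real^('n::finite + 'n)^('n + 'n)"
  assumes c: "1/2 \<le> c" "c < 1" and g: "g \<in> carrier Sp" and "0 < e"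
  shows "\<exists>N. norm (gram ((retract_step c ^^ N) g) - mat 1) < e"
proof (rule ccontr)
  assume not: "\<not> ?thesis"
  define d where "d h = norm (gram h - mat 1)" for h :: "real^('n + 'n)^('n + 'n)"
  define x where "x N = (retract_step c ^^ N) g" for N
  have x: "x N \<in> carrier Sp" for N
    by (induction N) (simp_all add: x_def g retract_step_in_Sp[OF c])
  have xS: "x (Suc N) = retract_step c (x N)" for N
    by (simp add: x_def)
  have dec: "d (x (Suc N)) \<le> d (x N)" for N
    unfolding xS d_def by (rule defect_retract_step_le[OF c x])
  then have dec': "decseq (\<lambda>N. d (x N))"
    by (rule decseq_SucI)
  then have "x N \<in> {h \<in> carrier Sp. norm (gram h - mat 1) \<le> d g}" for N
    using x[of N] decseqD[OF dec', of 0 N] by (simp add: d_def x_def)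
  then obtain l r where l: "l \<in> carrier Sp" and r: "strict_mono r" and lim: "(x \<circ> r) \<longlonglongrightarrow> l"
    using compact_bounded_defect[of "d g"] unfolding compact_def by blast
  have cont_d: "continuous_on UNIV d"
    unfolding d_def by (intro continuous_intros)
  then have "isCont d l"
    by (simp add: continuous_on_eq_continuous_at)
  then have 1: "(\<lambda>N. d (x (r N))) \<longlonglongrightarrow> d l"
    using isCont_tendsto_compose[OF _ lim] by (simp add: o_def)
  have "continuous_on (carrier Sp) (\<lambda>h. d (retract_step c h))"
    using continuous_on_compose2[OF cont_d continuous_on_retract_step[OF c]] by simp
  then have 2: "(\<lambda>N. d (x (Suc (r N)))) \<longlonglongrightarrow> d (retract_step c l)"
    using continuous_on_tendsto_compose[OF _ lim l, of "\<lambda>h. d (retract_step c h)"] x by (simp add: xS o_def)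
  have "bdd_below (range (\<lambda>N. d (x N)))"
    by (rule bdd_belowI2[of _ 0]) (simp add: d_def)
  with dec' obtain L where L: "(\<lambda>N. d (x N)) \<longlonglongrightarrow> L"
    using LIMSEQ_decseq_INF by blast
  have "(\<lambda>N. d (x (r N))) \<longlonglongrightarrow> L"
    using LIMSEQ_subseq_LIMSEQ[OF L r] by (simp add: o_def)
  moreover have "strict_mono (\<lambda>N. Suc (r N))"
    using r by (simp add: strict_mono_Suc_iff)
  then have "(\<lambda>N. d (x (Suc (r N)))) \<longlonglongrightarrow> L"
    using LIMSEQ_subseq_LIMSEQ[OF L, of "\<lambda>N. Suc (r N)"] by (simp add: o_def)
  ultimately have "d (retract_step c l) = d l"
    using 1 2 LIMSEQ_unique by metis
  then have "gram l = mat 1"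
    using defect_retract_step_less[OF c l] by (auto simp: d_def)
  then have "d l = 0"
    by (simp add: d_def)
  moreover have "e \<le> d l"
    using not by (intro LIMSEQ_le_const[OF 1]) (auto simp: d_def x_def not_less)
  ultimately show False
    using \<open>0 < e\<close> by simp
qed

text \<open>On the compact set of points outside \<open>W\<close> with defect at most 1, the defect
  attains a positive minimum. The minimum with 1 in the choice of \<open>e\<close> disposes of
  points of larger defect.\<close>

lemma small_defect_near_orthogonal:
  fixes W :: "(real^('n::finite + 'n)^('n + 'n)) set"
  assumes W: "open W" "{g \<in> carrier Sp. gram g = mat 1} \<subseteq> W"
  shows "\<exists>e>0. \<forall>g\<in>carrier Sp. norm (gram g - mat 1) < e \<longrightarrow> g \<in> W"
proof -
  let ?C = "{g \<in> carrier (Sp :: (real^('n + 'n)^('n + 'n)) monoid). norm (gram g - mat 1) \<le> 1} - W"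
  have comp: "compact ?C"
    by (intro compact_diff compact_bounded_defect W)
  show ?thesis
  proof (cases "?C = {}")
    case True
    then show ?thesis
      by (intro exI[of _ 1]) auto
  next
    case False
    have "continuous_on ?C (\<lambda>g. norm (gram g - mat 1))"
      by (intro continuous_intros)
    then obtain m where m: "m \<in> ?C" "\<And>g. g \<in> ?C \<Longrightarrow> norm (gram m - mat 1) \<le> norm (gram g - mat 1)"
      using continuous_attains_inf[OF comp False] by blast
    have "gram m \<noteq> mat 1"
      using m(1) W(2) by auto
    then show ?thesis
      using m(2) by (intro exI[of _ "min 1 (norm (gram m - mat 1))"]) fastforce
  qed
qed

section \<open>Unitary matrices\<close>

lemma realification_mult: "realification (M ** N) = realification M ** realification N"
proof -
  have "(\<chi> i j. Re ((M ** N) $ i $ j)) = (\<chi> i j. Re (M $ i $ j)) ** (\<chi> i j. Re (N $ i $ j)) - (\<chi> i j. Im (M $ i $ j)) ** (\<chi> i j. Im (N $ i $ j))"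
    "(\<chi> i j. Im ((M ** N) $ i $ j)) = (\<chi> i j. Re (M $ i $ j)) ** (\<chi> i j. Im (N $ i $ j)) + (\<chi> i j. Im (M $ i $ j)) ** (\<chi> i j. Re (N $ i $ j))"
    by (simp_all add: matrix_matrix_mult_def vec_eq_iff sum_subtractf sum.distrib)
  then show ?thesis
    by (simp add: realification_def Let_def block_matrix_mult minus_matrix_mult matrix_mult_minus add.commute)
qed

lemma realification_mat_1 [simp]: "realification (mat 1) = mat 1"
  by (simp add: realification_def Let_def mat_eq_block_matrix block_matrix_eq_iff)
    (simp add: mat_def vec_eq_iff)

lemma realification_uminus: "realification (- M) = - realification M"
  by (simp add: realification_def Let_def uminus_block_matrix block_matrix_eq_iff)
    (simp add: vec_eq_iff)

lemma transpose_realification: "transpose (realification M) = realification (conj_transpose M)"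
  by (simp add: realification_def Let_def transpose_block_matrix block_matrix_eq_iff conj_transpose_def)
    (simp add: vec_eq_iff transpose_def)

text \<open>A continuous left inverse of \<open>realification\<close>, read off the first block
  column; on matrices that are not complex linear its value carries no meaning.\<close>

definition unrealify :: "real^('n::finite + 'n)^('n + 'n) \<Rightarrow> complex^'n^'n"
  where "unrealify g = (\<chi> i j. Complex (g $ Inl i $ Inl j) (g $ Inr i $ Inl j))"

lemma unrealify_realification [simp]: "unrealify (realification M) = M"
  by (simp add: unrealify_def realification_def Let_def block_matrix_def vec_eq_iff complex_eq_iff)

lemma realification_inject [simp]: "realification M = realification N \<longleftrightarrow> M = N"
  by (metis unrealify_realification)

lemma continuous_on_unrealify [continuous_intros]:
  "continuous_on S f \<Longrightarrow> continuous_on S (\<lambda>x. unrealify (f x))"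
  unfolding unrealify_def Complex_eq by (intro continuous_intros)

lemma continuous_on_realification [continuous_intros]:
  assumes "continuous_on S f"
  shows "continuous_on S (\<lambda>x. realification (f x))"
proof -
  have "continuous_on S (\<lambda>x. realification (f x) $ i $ j)" for i j
    unfolding realification_def Let_def block_matrix_def
    by (cases i; cases j; simp; intro continuous_intros assms)
  then have "continuous_on S (\<lambda>x. \<chi> i j. realification (f x) $ i $ j)"
    by (intro continuous_on_vec_lambda)
  then show ?thesis by simp
qed

lemma realification_commutes_form: "realification M ** symplectic_form = symplectic_form ** realification M"
  by (simp add: realification_def Let_def symplectic_form_def block_matrix_mult minus_matrix_mult matrix_mult_minus)

lemma commutes_form_imp_realification:
  assumes "g ** symplectic_form = symplectic_form ** g"
  shows "\<exists>M. g = realification M"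
proof -
  obtain A B C D where g: "g = block_matrix A B C D"
    by (rule block_matrix_exhaust)
  from assms have "block_matrix (- B) A (- D) C = block_matrix C D (- A) (- B)"
    by (simp add: g symplectic_form_def block_matrix_mult minus_matrix_mult matrix_mult_minus)
  note eq = this[THEN block_matrix_eq_iff[THEN iffD1]]
  from eq have *: "B = - C"
    by (metis add.inverse_inverse)
  from eq have **: "D = A"
    by metis
  have "g = realification (\<chi> i j. Complex (A $ i $ j) (C $ i $ j))"
    by (simp add: g * ** realification_def Let_def block_matrix_eq_iff vec_eq_iff)
  then show ?thesis ..
qed

lemma carrier_U: "A \<in> carrier U \<longleftrightarrow> conj_transpose A ** A = mat 1"
  and mult_U [simp]: "A \<otimes>\<^bsub>U\<^esub> B = A ** B"
  and one_U [simp]: "\<one>\<^bsub>U\<^esub> = mat 1"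
  by (simp_all add: U_def)

lemma gram_realification: "gram (realification M) = realification (conj_transpose M ** M)"
  by (simp add: gram_def transpose_realification realification_mult)

lemma gram_realification_eq_1: "gram (realification M) = mat 1 \<longleftrightarrow> M \<in> carrier U"
  unfolding gram_realification carrier_U by (metis realification_inject realification_mat_1)

text \<open>\<open>U(n)\<close> is the intersection of \<open>Sp\<close> with the orthogonal group:
  for orthogonal \<open>g\<close>, preserving the form is the same as commuting with it, and
  commuting with it is complex linearity. Hence \<open>K\<close> can be described by
  \<open>gram\<close> alone.\<close>

lemma realification_U:
  "realification ` carrier (U :: (complex^'n::finite^'n) monoid) = {g \<in> carrier Sp. gram g = mat 1}"
proof (intro equalityI subsetI; clarsimp)
  fix M :: "complex^'n^'n" assume M: "M \<in> carrier U"
  let ?g = "realification M"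
  have 1: "gram ?g = mat 1"
    using M by (simp add: gram_realification_eq_1)
  have "transpose ?g ** symplectic_form ** ?g = gram ?g ** symplectic_form"
    unfolding gram_def matrix_mul_assoc[symmetric] by (simp only: realification_commutes_form[symmetric])
  then show "?g \<in> carrier Sp \<and> gram ?g = mat 1"
    by (simp add: 1 carrier_Sp)
next
  fix g :: "real^('n + 'n)^('n + 'n)" assume g: "g \<in> carrier Sp" "gram g = mat 1"
  have "g ** transpose g = mat 1"
    using g(2) by (rule mult_eq_mat_1_commute[OF trans[OF gram_def[symmetric]]])
  moreover have "g ** (transpose g ** symplectic_form ** g) = g ** symplectic_form"
    using g(1) by (simp add: carrier_Sp)
  ultimately have "symplectic_form ** g = g ** symplectic_form"
    by (simp add: matrix_mul_assoc)
  then obtain M where "g = realification M"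
    using commutes_form_imp_realification by metis
  with g show "g \<in> realification ` carrier U"
    using gram_realification_eq_1 by blast
qed

lemma compact_U: "compact (carrier (U :: (complex^'n::finite^'n) monoid))"
proof -
  have "{g \<in> carrier (Sp :: (real^('n + 'n)^('n + 'n)) monoid). norm (gram g - mat 1) \<le> 0} = realification ` carrier U"
    unfolding realification_U by auto
  then have "compact (realification ` carrier (U :: (complex^'n^'n) monoid))"
    using compact_bounded_defect[where 'n='n, of 0] by simp
  then have "compact (unrealify ` realification ` carrier (U :: (complex^'n^'n) monoid))"
    by (rule compact_continuous_image[rotated]) (intro continuous_intros)
  moreover have "unrealify ` realification ` carrier (U :: (complex^'n^'n) monoid) = carrier U"
    by force
  ultimately show ?thesis
    by simp
qed

section \<open>Adjoints, determinants and the Cayley path in the unitary group\<close>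

lemma conj_transpose_mult: "conj_transpose (A ** B) = conj_transpose B ** conj_transpose A"
  by (simp add: conj_transpose_def matrix_matrix_mult_def vec_eq_iff mult.commute)

lemma conj_transpose_add: "conj_transpose (A + B) = conj_transpose A + conj_transpose B"
  and conj_transpose_diff: "conj_transpose (A - B) = conj_transpose A - conj_transpose B"
  and conj_transpose_scaleR: "conj_transpose (t *\<^sub>R A) = t *\<^sub>R conj_transpose A"
  and conj_transpose_conj_transpose [simp]: "conj_transpose (conj_transpose A) = A"
  by (simp_all add: conj_transpose_def vec_eq_iff)

lemma conj_transpose_mat [simp]: "conj_transpose (mat a) = mat (cnj a)"
  by (simp add: conj_transpose_def mat_def vec_eq_iff)

lemma det_conj_transpose: "det (conj_transpose A) = cnj (det A)"
proof -
  have "det (conj_transpose A) = det (\<chi> i j. cnj (A $ i $ j))"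
    by (subst det_transpose[symmetric]) (simp add: conj_transpose_def transpose_def)
  also have "\<dots> = cnj (det A)"
    by (simp add: det_def)
  finally show ?thesis .
qed

lemma norm_det_U:
  assumes "A \<in> carrier U"
  shows "norm (det A) = 1"
proof -
  have "cnj (det A) * det A = 1"
    using assms unfolding carrier_U by (metis det_I det_conj_transpose det_mul)
  then have "(norm (det A))\<^sup>2 = 1"
    by (metis complex_norm_square mult.commute of_real_eq_1_iff)
  then show ?thesis
    by (simp add: power2_eq_1_iff) (smt (verit) norm_ge_zero)
qed

lemma U_right_inverse: "A \<in> carrier U \<Longrightarrow> A ** conj_transpose A = mat 1"
  unfolding carrier_U by (rule mult_eq_mat_1_commute)

lemma mult_in_U: "A \<in> carrier U \<Longrightarrow> B \<in> carrier U \<Longrightarrow> A ** B \<in> carrier U"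
proof -
  assume "A \<in> carrier U" "B \<in> carrier U"
  moreover have "conj_transpose (A ** B) ** (A ** B) = conj_transpose B ** (conj_transpose A ** A) ** B"
    by (simp only: conj_transpose_mult matrix_mul_assoc)
  ultimately show ?thesis
    unfolding carrier_U by simp
qed

lemma group_U: "group U"
proof (rule groupI)
  fix A :: "complex^'n::finite^'n" assume A: "A \<in> carrier U"
  then have "conj_transpose A \<in> carrier U"
    using U_right_inverse by (simp add: carrier_U)
  then show "\<exists>B\<in>carrier U. B \<otimes>\<^bsub>U\<^esub> A = \<one>\<^bsub>U\<^esub>"
    using A by (auto simp: carrier_U)
qed (auto simp: mult_in_U matrix_mul_assoc, auto simp: carrier_U)

lemma mat_cis_in_U: "mat (cis a) \<in> carrier U"
  by (simp add: carrier_U mat_scalar_mult) (simp add: mat_def vec_eq_iff cis_cnj cis_mult)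

text \<open>For real \<open>t\<close> the products (adjoint of \<open>N\<close>) \<open>N\<close>
  and (adjoint of \<open>D\<close>) \<open>D\<close> agree: their difference consists of cross
  terms, which cancel because \<open>u\<close> is unitary. The path runs from \<open>mat 1\<close>
  at \<open>t = 0\<close> to \<open>u\<close> at \<open>t = 1\<close>.\<close>

lemma Cayley_in_U:
  fixes u :: "complex^'n::finite^'n" and t :: real
  defines "N \<equiv> (mat 1 + u) - t *\<^sub>R (mat 1 - u)" and "D \<equiv> (mat 1 + u) + t *\<^sub>R (mat 1 - u)"
  assumes u: "u \<in> carrier U" and D: "det D \<noteq> 0"
  shows "N ** matrix_inv D \<in> carrier U"
proof -
  have uu: "conj_transpose u ** u = mat 1"
    using u by (simp add: carrier_U)
  have "conj_transpose N ** N = conj_transpose D ** D"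
    unfolding N_def D_def conj_transpose_add conj_transpose_diff conj_transpose_scaleR
    by (simp add: matrix_add_ldistrib matrix_add_rdistrib matrix_sub_ldistrib matrix_sub_rdistrib
        scalar_matrix_assoc[symmetric] matrix_scalar_ac uu) (simp add: algebra_simps)
  moreover have "conj_transpose (N ** matrix_inv D) ** (N ** matrix_inv D)
      = conj_transpose (matrix_inv D) ** (conj_transpose N ** N) ** matrix_inv D"
    by (simp only: conj_transpose_mult matrix_mul_assoc)
  moreover have "conj_transpose (matrix_inv D) ** (conj_transpose D ** D) ** matrix_inv D
      = conj_transpose (D ** matrix_inv D) ** (D ** matrix_inv D)"
    by (simp only: conj_transpose_mult matrix_mul_assoc)
  ultimately show ?thesis
    by (simp add: carrier_U matrix_inv_mult[OF D])
qed

text \<open>The Cayley path from \<open>1\<close> to a unitary \<open>u\<close> near \<open>1\<close>, with the \<open>n\<close>-th root of its determinant split off.\<close>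

lemma unitary_near_1_factor:
  fixes W :: "(complex^'n::finite^'n) set"
  assumes W: "open W" "mat 1 \<in> W"
  shows "\<exists>W'. open W' \<and> mat 1 \<in> W' \<and> (\<forall>u\<in>carrier U \<inter> W'. \<exists>s r C C'. u = s ** r \<and>
       connected C \<and> mat 1 \<in> C \<and> s \<in> C \<and> C \<subseteq> SU \<inter> W \<and>
       connected C' \<and> mat 1 \<in> C' \<and> r \<in> C' \<and> C' \<subseteq> unit_scalars \<inter> W)"
proof -
  define D where "D z = (mat 1 + fst z) + snd z *\<^sub>R (mat 1 - fst z)" for z :: "(complex^'n^'n) \<times> real"
  define \<Phi> where "\<Phi> z = ((mat 1 + fst z) - snd z *\<^sub>R (mat 1 - fst z)) ** matrix_inv (D z)" for z :: "(complex^'n^'n) \<times> real"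
  \<comment> \<open>The principal argument of the determinant divided by \<open>n\<close>: the
    scalar \<open>cis \<theta>\<close> has the same determinant as the unitary
    \<open>\<Phi> z\<close>.\<close>
  define \<theta> where "\<theta> z = Im (Ln (det (\<Phi> z))) / real CARD('n)" for z
  define S where "S z = \<Phi> z ** mat (cis (- \<theta> z))" for z
  define R where "R z = (mat (cis (\<theta> z)) :: complex^'n^'n)" for z
  \<comment> \<open>Nested domains: on \<open>O1\<close> the Cayley quotient exists, on
    \<open>O2\<close> its determinant avoids the branch cut of \<open>Ln\<close>, and on
    \<open>O3\<close> both factors lie in \<open>W\<close>.\<close>
  define O1 where "O1 = {z. det (D z) \<noteq> 0}"
  define O2 where "O2 = {z \<in> O1. det (\<Phi> z) \<in> - \<real>\<^sub>\<le>\<^sub>0}"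
  define O3 where "O3 = {z \<in> O2. (S z, R z) \<in> W \<times> W}"
  have D_cont: "continuous_on UNIV D"
    unfolding D_def by (intro continuous_intros)
  then have "open O1"
    unfolding O1_def by (intro open_Collect_neq continuous_intros)
  have \<Phi>_cont: "continuous_on O1 \<Phi>"
    unfolding \<Phi>_def using continuous_on_subset[OF D_cont]
    by (intro continuous_intros) (auto simp: O1_def)
  have "open O2"
  proof -
    have "O2 = O1 \<inter> (\<lambda>z. det (\<Phi> z)) -` (- \<real>\<^sub>\<le>\<^sub>0)"
      by (auto simp: O2_def)
    then show ?thesis
      using continuous_open_preimage[OF continuous_on_det[OF \<Phi>_cont] \<open>open O1\<close>, of "- \<real>\<^sub>\<le>\<^sub>0"]
      by (simp add: open_Compl closed_nonpos_Reals_complex)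
  qed
  have \<theta>_cont: "continuous_on O2 \<theta>"
    unfolding \<theta>_def using continuous_on_subset[OF \<Phi>_cont]
    by (intro continuous_intros) (auto simp: O2_def)
  have mat_cont: "continuous_on O2 (\<lambda>z. mat (f z) :: complex^'n^'n)" if "continuous_on O2 f" for f
  proof -
    have "continuous_on O2 (\<lambda>z. if b then f z else 0)" for b
      using that by (cases b) auto
    then show ?thesis
      unfolding mat_def by (intro continuous_on_vec_lambda)
  qed
  have cis_cont: "continuous_on O2 (\<lambda>z. cis (f z))" if "continuous_on O2 f" for f
    using that unfolding cis_conv_exp by (intro continuous_intros)
  have S_cont: "continuous_on O2 S"
    unfolding S_def using continuous_on_subset[OF \<Phi>_cont, of O2] \<theta>_cont
    by (intro continuous_intros mat_cont cis_cont) (auto simp: O2_def)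
  have R_cont: "continuous_on O2 R"
    unfolding R_def by (intro mat_cont cis_cont \<theta>_cont)
  have "open O3"
  proof -
    have "O3 = O2 \<inter> (\<lambda>z. (S z, R z)) -` (W \<times> W)"
      by (auto simp: O3_def)
    then show ?thesis
      using continuous_open_preimage[OF continuous_on_Pair[OF S_cont R_cont] \<open>open O2\<close> open_Times[OF W(1) W(1)]]
      by simp
  qed
  have "(mat 1, t) \<in> O3" for t
  proof -
    have D1: "D (mat 1, t) = 2 *\<^sub>R mat 1"
      by (simp add: D_def scaleR_2)
    have "det (D (mat 1, t)) \<noteq> 0"
    proof -
      have "D (mat 1, t) ** ((1/2) *\<^sub>R mat 1) = mat 1"
        unfolding D1 by (simp add: matrix_scalar_ac scalar_matrix_assoc[symmetric])
      then have "det (D (mat 1, t)) * det ((1/2) *\<^sub>R mat 1 :: complex^'n^'n) = 1"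
        by (metis det_I det_mul)
      then show ?thesis by auto
    qed
    moreover from this have "\<Phi> (mat 1, t) = mat 1"
      using matrix_inv_mult(1)[of "D (mat 1, t)"] by (simp add: \<Phi>_def D1 scaleR_2)
    ultimately show ?thesis
      using W(2) by (simp add: O3_def O2_def O1_def S_def R_def \<theta>_def)
  qed
  \<comment> \<open>The whole segment over \<open>mat 1\<close> lies in the open set
    \<open>O3\<close>, so the tube lemma provides one \<open>W'\<close> for all \<open>t\<close>.
    The pair is swapped because the compact factor has to come first.\<close>
  then have *: "(\<lambda>t. (t, mat 1)) ` {0..1} \<subseteq> prod.swap -` O3 \<inter> ({0..1} \<times> UNIV)"
    by auto
  have "open (prod.swap -` O3 :: (real \<times> (complex^'n^'n)) set)"
    unfolding prod.swap_def by (intro open_vimage \<open>open O3\<close> continuous_intros)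
  then have "openin (top_of_set ({0..1} \<times> UNIV)) (prod.swap -` O3 \<inter> ({0..1::real} \<times> UNIV))"
    by (metis Int_commute openin_open_Int)
  from tube_lemma[OF compact_Icc _ * this]
  obtain W' where "openin (top_of_set UNIV) W'" "mat 1 \<in> W'" "{0..1} \<times> W' \<subseteq> prod.swap -` O3 \<inter> ({0..1} \<times> UNIV)"
    by auto
  then have W': "mat 1 \<in> W'" "open W'" "W' \<times> {0..1} \<subseteq> O3"
    by auto
  show ?thesis
  proof (intro exI[of _ W'] conjI W' ballI)
    fix u :: "complex^'n^'n" assume "u \<in> carrier U \<inter> W'"
    then have u: "u \<in> carrier U" "u \<in> W'"
      by auto
    have O3: "(u, t) \<in> O3" if "t \<in> {0..1}" for t
      using u W' that by auto
    then have O2: "(u, t) \<in> O2" if "t \<in> {0..1}" for t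
      using that by (simp add: O3_def)
    have sub: "continuous_on {0..1} (\<lambda>t. f (u, t))" if "continuous_on O2 f" for f :: "_ \<Rightarrow> complex^'n^'n"
      using O2 by (intro continuous_on_compose2[OF that] continuous_intros) auto
    have SU: "S (u, t) \<in> SU" if "t \<in> {0..1}" for t
    proof -
      have "det (D (u, t)) \<noteq> 0"
        using O2[OF that] by (simp add: O2_def O1_def)
      then have \<Phi>U: "\<Phi> (u, t) \<in> carrier U"
        using Cayley_in_U[OF u(1), of t] by (simp add: \<Phi>_def D_def)
      \<comment> \<open>The scalar in \<open>S\<close> contributes \<open>cis (- \<theta>)\<close>
        to the power \<open>n\<close>. As \<open>det (\<Phi> (u, t))\<close> has modulus 1, it is
        \<open>cis\<close> of its argument, and the two cancel.\<close>
      have "det (S (u, t)) = det (\<Phi> (u, t)) * cis (- Im (Ln (det (\<Phi> (u, t)))))"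
        by (simp add: S_def det_mul det_mat Complex.DeMoivre \<theta>_def)
      moreover have "det (\<Phi> (u, t)) = cis (Im (Ln (det (\<Phi> (u, t)))))"
        using norm_det_U[OF \<Phi>U]
        by (metis Arg_eq Arg_def cis_conv_exp mult_1 norm_zero of_real_1 zero_neq_one)
      ultimately have "det (S (u, t)) = cis (Im (Ln (det (\<Phi> (u, t))))) * cis (- Im (Ln (det (\<Phi> (u, t)))))"
        by metis
      then have "det (S (u, t)) = 1"
        by (simp add: cis_mult)
      then show ?thesis
        unfolding SU_def S_def using \<Phi>U mat_cis_in_U mult_in_U by blast
    qed
    have "\<Phi> (u, 0) = mat 1"
      using O2[of 0] matrix_inv_mult(1)[of "D (u, 0)"] by (simp add: O2_def O1_def \<Phi>_def D_def)
    then have 0: "S (u, 0) = mat 1" "R (u, 0) = mat 1"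
      by (simp_all add: S_def R_def \<theta>_def)
    have "\<Phi> (u, 1) = u"
    proof -
      have "D (u, 1) = 2 *\<^sub>R mat 1" "mat 1 + u - (mat 1 - u) = 2 *\<^sub>R u"
        by (simp_all add: D_def scaleR_2)
      moreover have "det (D (u, 1)) \<noteq> 0"
        using O2[of 1] by (simp add: O2_def O1_def)
      ultimately have "\<Phi> (u, 1) = u ** (D (u, 1) ** matrix_inv (D (u, 1)))"
        by (simp add: \<Phi>_def matrix_scalar_ac scalar_matrix_assoc[symmetric])
      then show ?thesis
        by (simp add: matrix_inv_mult \<open>det (D (u, 1)) \<noteq> 0\<close>)
    qed
    have "u = S (u, 1) ** R (u, 1)"
    proof -
      have "mat (cis (- \<theta> (u, 1))) ** mat (cis (\<theta> (u, 1))) = (mat 1 :: complex^'n^'n)"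
        by (simp add: mat_scalar_mult) (simp add: mat_def vec_eq_iff cis_mult)
      with \<open>\<Phi> (u, 1) = u\<close> show ?thesis
        by (simp add: S_def R_def matrix_mul_assoc[symmetric])
    qed
    moreover have "connected ((\<lambda>t. S (u, t)) ` {0..1})" "connected ((\<lambda>t. R (u, t)) ` {0..1})"
      by (intro connected_continuous_image sub S_cont R_cont connected_Icc)+
    moreover have "(\<lambda>t. S (u, t)) ` {0..1} \<subseteq> SU \<inter> W" "(\<lambda>t. R (u, t)) ` {0..1} \<subseteq> unit_scalars \<inter> W"
      using SU O3 by (auto simp: O3_def R_def unit_scalars_def)
    moreover have "mat 1 \<in> (\<lambda>t. S (u, t)) ` {0..1}" "mat 1 \<in> (\<lambda>t. R (u, t)) ` {0..1}"
      by (rule image_eqI[where x = 0]; simp add: 0)+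
    moreover have "S (u, 1) \<in> (\<lambda>t. S (u, t)) ` {0..1}" "R (u, 1) \<in> (\<lambda>t. R (u, t)) ` {0..1}"
      by (rule imageI; simp)+
    ultimately show "\<exists>s r C C'. u = s ** r \<and>
       connected C \<and> mat 1 \<in> C \<and> s \<in> C \<and> C \<subseteq> SU \<inter> W \<and>
       connected C' \<and> mat 1 \<in> C' \<and> r \<in> C' \<and> C' \<subseteq> unit_scalars \<inter> W"
      by blast
  qed
qed

lemma uminus_mat_1_in_U: "- mat 1 \<in> carrier U"
proof -
  have "conj_transpose (- mat 1) = (- mat 1 :: complex^'a::finite^'a)"
    by (simp add: conj_transpose_def mat_def vec_eq_iff)
  then show ?thesis
    by (simp add: carrier_U minus_matrix_mult)
qed

lemma subgroup_realification:
  assumes "subgroup T U"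
  shows "subgroup (realification ` T) Sp"
proof -
  have h: "group_hom U Sp realification"
    using realification_U
    by (intro group_hom.intro group_hom_axioms.intro group_U group_Sp) (auto simp: hom_def realification_mult)
  then interpret group_hom U Sp realification .
  show ?thesis
    by (rule subgroup_img_is_subgroup[OF assms])
qed

lemma subgroup_SU: "subgroup SU U"
proof -
  interpret group U by (rule group_U)
  show ?thesis
  proof (rule subgroupI)
    fix A :: "complex^'a::finite^'a" assume A: "A \<in> SU"
    then have AU: "A \<in> carrier U" and d: "det A = 1"
      by (auto simp: SU_def)
    have "inv\<^bsub>U\<^esub> A ** A = mat 1"
      using l_inv[OF AU] by simp
    then have "det (inv\<^bsub>U\<^esub> A) * det A = 1"
      by (metis det_I det_mul)
    then show "inv\<^bsub>U\<^esub> A \<in> SU"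
      using AU d by (simp add: SU_def)
  qed (auto simp: SU_def det_mul mult_in_U intro: exI[of _ "mat 1"] one_closed[simplified])
qed

lemma mat_cis_mult: "mat (cis a) ** mat (cis b) = (mat (cis (a + b)) :: complex^'a::finite^'a)"
  by (simp add: mat_scalar_mult) (simp add: mat_def vec_eq_iff cis_mult)

lemma subgroup_unit_scalars: "subgroup unit_scalars U"
proof -
  interpret group U by (rule group_U)
  show ?thesis
  proof (rule subgroupI)
    fix A :: "complex^'a::finite^'a" assume "A \<in> unit_scalars"
    then obtain a where a: "A = mat (cis a)"
      by (auto simp: unit_scalars_def)
    have "inv\<^bsub>U\<^esub> A = mat (cis (- a))"
      by (rule inv_equality) (simp_all add: a mat_cis_in_U mat_cis_mult)
    then show "inv\<^bsub>U\<^esub> A \<in> unit_scalars"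
      by (auto simp: unit_scalars_def)
  qed (auto simp: unit_scalars_def mat_cis_in_U mat_cis_mult)
qed

section \<open>Topological groups\<close>

locale top_group =
  fixes G :: "('g::topological_space) monoid" (structure)
  assumes topological_group: "topological_group G"
begin

sublocale group G
  using topological_group by (simp add: topological_group_def)

lemma continuous_on_mult:
  assumes "continuous_on S f" "continuous_on S g" "f ` S \<subseteq> carrier G" "g ` S \<subseteq> carrier G"
  shows "continuous_on S (\<lambda>x. f x \<otimes> g x)"
proof -
  have *: "continuous_on (carrier G \<times> carrier G) (\<lambda>z. fst z \<otimes> snd z)"
    using topological_group by (simp add: topological_group_def case_prod_unfold)
  show ?thesis
    using continuous_on_compose2[OF * continuous_on_Pair[OF assms(1,2)]] assms(3,4) by auto
qed

lemma continuous_on_inv: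
  assumes "continuous_on S f" "f ` S \<subseteq> carrier G"
  shows "continuous_on S (\<lambda>x. inv (f x))"
  using topological_group continuous_on_compose2[OF _ assms, of "\<lambda>x. inv x"]
  by (simp add: topological_group_def)

lemma openin_left_translates:
  assumes V: "openin (top_of_set (carrier G)) V" and A: "A \<subseteq> carrier G"
  shows "openin (top_of_set (carrier G)) (A <#> V)"
proof -
  have VG: "V \<subseteq> carrier G"
    using openin_imp_subset[OF V] .
  have "openin (top_of_set (carrier G)) (carrier G \<inter> (\<lambda>x. inv a \<otimes> x) -` V)" if "a \<in> A" for a
    by (rule continuous_openin_preimage[OF _ _ V]) (use that A in \<open>auto intro!: continuous_on_mult\<close>)
  then have "openin (top_of_set (carrier G)) (\<Union>a\<in>A. carrier G \<inter> (\<lambda>x. inv a \<otimes> x) -` V)"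
    by blast
  moreover have "A <#> V = (\<Union>a\<in>A. carrier G \<inter> (\<lambda>x. inv a \<otimes> x) -` V)"
  proof (intro equalityI subsetI)
    fix x assume "x \<in> A <#> V"
    then obtain a v where "a \<in> A" "v \<in> V" "x = a \<otimes> v"
      by (auto simp: set_mult_def)
    then show "x \<in> (\<Union>a\<in>A. carrier G \<inter> (\<lambda>x. inv a \<otimes> x) -` V)"
      using A VG by (auto simp: m_assoc[symmetric] subset_iff intro!: bexI[of _ a])
  next
    fix x assume "x \<in> (\<Union>a\<in>A. carrier G \<inter> (\<lambda>x. inv a \<otimes> x) -` V)"
    then obtain a where "a \<in> A" "x \<in> carrier G" "inv a \<otimes> x \<in> V"
      by auto
    moreover from this have "x = a \<otimes> (inv a \<otimes> x)"
      using A by (simp add: m_assoc[symmetric] subset_iff)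
    ultimately show "x \<in> A <#> V"
      unfolding set_mult_def by blast
  qed
  ultimately show ?thesis by simp
qed

lemma nbhd_one:
  assumes V: "openin (top_of_set (carrier G)) V" "\<one> \<in> V"
    and f: "continuous_on (carrier G \<times> carrier G) f" "f ` (carrier G \<times> carrier G) \<subseteq> carrier G"
      "f (\<one>, \<one>) = \<one>"
  obtains V' where "openin (top_of_set (carrier G)) V'" "\<one> \<in> V'" "V' \<subseteq> V"
    "\<And>x y. x \<in> V' \<Longrightarrow> y \<in> V' \<Longrightarrow> f (x, y) \<in> V"
proof -
  have "openin (top_of_set (carrier G \<times> carrier G)) ((carrier G \<times> carrier G) \<inter> f -` V)"
    by (rule continuous_openin_preimage[OF f(1) _ V(1)]) (use f(2) in auto)
  then have "openin (prod_topology (top_of_set (carrier G)) (top_of_set (carrier G))) ((carrier G \<times> carrier G) \<inter> f -` V)"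
    by (simp add: prod_topology_subtopology_eu)
  moreover have "(\<one>, \<one>) \<in> (carrier G \<times> carrier G) \<inter> f -` V"
    using f(3) V(2) by simp
  ultimately obtain A B where AB: "openin (top_of_set (carrier G)) A" "openin (top_of_set (carrier G)) B"
    "\<one> \<in> A" "\<one> \<in> B" "A \<times> B \<subseteq> (carrier G \<times> carrier G) \<inter> f -` V"
    unfolding openin_prod_topology_alt by metis
  show thesis
    by (rule that[of "A \<inter> B \<inter> V"]) (use AB V in \<open>auto intro!: openin_Int\<close>)
qed

definition identity_component :: "'g set \<Rightarrow> 'g set"
  where "identity_component S = connected_component_set S \<one>"

context
  fixes S assumes S: "subgroup S G"
begin

lemma identity_component_subset: "identity_component S \<subseteq> S"
  by (simp add: identity_component_def connected_component_subset)

lemma one_in_identity_component: "\<one> \<in> identity_component S"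
  by (simp add: identity_component_def connected_component_refl subgroup.one_closed[OF S])

lemma connected_identity_component: "connected (identity_component S)"
  by (simp add: identity_component_def)

lemma identity_component_carrier: "identity_component S \<subseteq> carrier G"
  using identity_component_subset subgroup.subset[OF S] by blast

lemma identity_component_maximal:
  assumes "connected T" "\<one> \<in> T" "T \<subseteq> S"
  shows "T \<subseteq> identity_component S"
  unfolding identity_component_def by (intro connected_component_maximal assms)

lemma identity_component_subgroup: "subgroup (identity_component S) G"
proof
  let ?C = "identity_component S"
  show "?C \<subseteq> carrier G" "\<one> \<in> ?C"
    by (rule identity_component_carrier one_in_identity_component)+
  have m: "x \<otimes> y \<in> S" if "x \<in> ?C" "y \<in> ?C" for x y
    using that identity_component_subset subgroup.m_closed[OF S] by blast
  have "(\<lambda>z. fst z \<otimes> snd z) ` (?C \<times> ?C) \<subseteq> ?C"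
  proof (rule identity_component_maximal)
    show "connected ((\<lambda>z. fst z \<otimes> snd z) ` (?C \<times> ?C))"
      by (intro connected_continuous_image continuous_on_mult connected_Times connected_identity_component
         continuous_intros) (use identity_component_carrier in auto)
    show "\<one> \<in> (\<lambda>z. fst z \<otimes> snd z) ` (?C \<times> ?C)"
      using one_in_identity_component by (intro image_eqI[of _ _ "(\<one>, \<one>)"]) auto
  qed (use m in auto)
  then show "x \<otimes> y \<in> ?C" if "x \<in> ?C" "y \<in> ?C" for x y
    using that by (auto simp: image_subset_iff)
  have "(\<lambda>z. inv z) ` ?C \<subseteq> ?C"
  proof (rule identity_component_maximal)
    show "connected ((\<lambda>z. inv z) ` ?C)"
      by (intro connected_continuous_image continuous_on_inv connected_identity_component
         continuous_intros) (use identity_component_carrier in auto)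
    show "\<one> \<in> (\<lambda>z. inv z) ` ?C"
      using one_in_identity_component by (intro image_eqI[of _ _ "\<one>"]) auto
  qed (use identity_component_subset subgroup.m_inv_closed[OF S] in auto)
  then show "inv x \<in> ?C" if "x \<in> ?C" for x
    using that by (auto simp: image_subset_iff)
qed

lemma identity_component_conj:
  assumes g: "g \<in> carrier G" and conj: "\<And>x. x \<in> S \<Longrightarrow> g \<otimes> x \<otimes> inv g \<in> S"
    and x: "x \<in> identity_component S"
  shows "g \<otimes> x \<otimes> inv g \<in> identity_component S"
proof -
  let ?C = "identity_component S"
  have "(\<lambda>z. g \<otimes> z \<otimes> inv g) ` ?C \<subseteq> ?C"
  proof (rule identity_component_maximal)
    show "connected ((\<lambda>z. g \<otimes> z \<otimes> inv g) ` ?C)"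
      by (intro connected_continuous_image continuous_on_mult connected_identity_component
         continuous_intros) (use identity_component_carrier g in auto)
    show "\<one> \<in> (\<lambda>z. g \<otimes> z \<otimes> inv g) ` ?C"
      using one_in_identity_component g by (intro image_eqI[of _ _ "\<one>"]) auto
  qed (use identity_component_subset conj in auto)
  then show ?thesis
    using x by blast
qed

end

end

section \<open>Covering groups of the symplectic group\<close>

lemma covering_space_open:
  assumes cov: "covering_space c p S" and V: "openin (top_of_set c) V"
  shows "openin (top_of_set S) (p ` V)"
proof (subst openin_subopen, intro ballI)
  fix y assume "y \<in> p ` V"
  then obtain x where x: "x \<in> V" "y = p x" by blast
  then have "x \<in> c"
    using openin_imp_subset[OF V] by blast
  then obtain T u q where T: "x \<in> T" "openin (top_of_set c) T" "openin (top_of_set S) u" "homeomorphism T u p q"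
    using covering_space_local_homeomorphism[OF cov] by metis
  have "openin (top_of_set T) (T \<inter> V)"
    using T(2) V by (metis openin_Int openin_subset_trans inf_le1 openin_imp_subset)
  then have "openin (top_of_set u) (p ` (T \<inter> V))"
    using homeomorphism_imp_open_map[OF T(4)] by blast
  then have "openin (top_of_set S) (p ` (T \<inter> V))"
    using T(3) openin_trans by blast
  then show "\<exists>T. openin (top_of_set S) T \<and> y \<in> T \<and> T \<subseteq> p ` V"
    using x T(1) by (intro exI[of _ "p ` (T \<inter> V)"]) auto
qed

locale symplectic_cover = top_group G for G :: "('g::topological_space) monoid" (structure) +
  fixes \<pi> :: "'g \<Rightarrow> real^('n::finite + 'n)^('n + 'n)"
  assumes path_connected: "path_connected (carrier G)"
    and pi_hom: "\<pi> \<in> hom G Sp"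
    and pi_cover: "covering_space (carrier G) \<pi> (carrier Sp)"
begin

lemma pi_group_hom: "group_hom G Sp \<pi>"
  by (intro group_hom.intro group_hom_axioms.intro is_group group_Sp pi_hom)

lemma pi_closed [simp]: "x \<in> carrier G \<Longrightarrow> \<pi> x \<in> carrier Sp"
  using pi_hom by (auto simp: hom_def)

lemma pi_mult [simp]: "x \<in> carrier G \<Longrightarrow> y \<in> carrier G \<Longrightarrow> \<pi> (x \<otimes> y) = \<pi> x ** \<pi> y"
  using group_hom.hom_mult[OF pi_group_hom] by simp

lemma pi_one [simp]: "\<pi> \<one> = mat 1"
  using group_hom.hom_one[OF pi_group_hom] by simp

lemma pi_inv_mult [simp]:
  assumes "x \<in> carrier G"
  shows "\<pi> (inv x) ** \<pi> x = mat 1" "\<pi> x ** \<pi> (inv x) = mat 1"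
  using assms by (simp_all flip: pi_mult)

lemma pi_surj: "\<pi> ` carrier G = carrier Sp"
  using covering_space_imp_surjective[OF pi_cover] .

lemma pi_cont: "continuous_on (carrier G) \<pi>"
  using covering_space_imp_continuous[OF pi_cover] .

lemma pi_eqD:
  assumes "x \<in> carrier G" "y \<in> carrier G" "\<pi> x = \<pi> y"
  shows "\<pi> (inv y \<otimes> x) = mat 1" "\<pi> (x \<otimes> inv y) = mat 1"
  using assms by simp_all

lemma subgroup_preimage:
  assumes "subgroup T Sp"
  shows "subgroup {x \<in> carrier G. \<pi> x \<in> T} G"
proof -
  interpret pi: group_hom G Sp \<pi> by (rule pi_group_hom)
  show ?thesis
    using subgroup.m_closed[OF assms] subgroup.m_inv_closed[OF assms] subgroup.one_closed[OF assms]
    by unfold_locales (auto simp del: pi_mult simp flip: mult_Sp one_Sp)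
qed

section \<open>The preimage of \<open>U(n)\<close> and the subgroups covering \<open>SU(n)\<close>
  and the unit scalars\<close>

abbreviation K where "K \<equiv> {x \<in> carrier G. \<pi> x \<in> realification ` carrier U}"
abbreviation H where "H \<equiv> cover_SU G \<pi>"
abbreviation R where "R \<equiv> cover_R G \<pi>"

lemma K_iff: "x \<in> K \<longleftrightarrow> x \<in> carrier G \<and> gram (\<pi> x) = mat 1"
  unfolding realification_U by auto

lemma subgroup_K: "subgroup K G"
  by (intro subgroup_preimage subgroup_realification group.subgroup_self group_U)

lemma H_component: "H = identity_component {x \<in> carrier G. \<pi> x \<in> realification ` SU}"
  and R_component: "R = identity_component {x \<in> carrier G. \<pi> x \<in> realification ` unit_scalars}"
  by (simp_all add: cover_SU_def cover_R_def identity_component_def)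

lemma subgroup_preimages:
  "subgroup {x \<in> carrier G. \<pi> x \<in> realification ` SU} G"
  "subgroup {x \<in> carrier G. \<pi> x \<in> realification ` unit_scalars} G"
  by (intro subgroup_preimage subgroup_realification subgroup_SU subgroup_unit_scalars)+

lemma subgroup_H: "subgroup H G" and subgroup_R: "subgroup R G"
  unfolding H_component R_component by (intro identity_component_subgroup subgroup_preimages)+

lemma H_subset: "H \<subseteq> {x \<in> carrier G. \<pi> x \<in> realification ` SU}"
  unfolding H_component by (intro identity_component_subset subgroup_preimages)

lemma R_subset: "R \<subseteq> {x \<in> carrier G. \<pi> x \<in> realification ` unit_scalars}"
  unfolding R_component by (intro identity_component_subset subgroup_preimages)

lemma H_subset_K: "H \<subseteq> K" and R_subset_K: "R \<subseteq> K"
  using H_subset R_subset by (auto simp: SU_def unit_scalars_def mat_cis_in_U)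

lemma H_closed: "h \<in> H \<Longrightarrow> h \<in> carrier G" and R_closed: "r \<in> R \<Longrightarrow> r \<in> carrier G"
  using H_subset R_subset by auto

text \<open>The determinant is invariant under unitary conjugation, so conjugation by
  \<open>k\<close> preserves the preimage of \<open>SU\<close>; being continuous and fixing
  \<open>\<one>\<close>, it also preserves the identity component.\<close>

lemma H_conj:
  assumes k: "k \<in> K" and h: "h \<in> H"
  shows "k \<otimes> h \<otimes> inv k \<in> H"
proof -
  obtain u where u: "u \<in> carrier U" "\<pi> k = realification u"
    using k by auto
  have inv: "inv k \<in> K"
    using subgroup.m_inv_closed[OF subgroup_K k] .
  then obtain u' where u': "u' \<in> carrier U" "\<pi> (inv k) = realification u'"
    by auto
  have "realification (u ** u') = realification (mat 1)"
    using k pi_inv_mult(2)[of k] unfolding u(2) u'(2) realification_mult realification_mat_1 by blast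
  then have 1: "u ** u' = mat 1"
    by (simp only: realification_inject)
  then have d: "det u * det u' = 1"
    by (metis det_I det_mul)
  have "k \<otimes> x \<otimes> inv k \<in> {x \<in> carrier G. \<pi> x \<in> realification ` SU}"
    if x: "x \<in> {x \<in> carrier G. \<pi> x \<in> realification ` SU}" for x
  proof -
    obtain s where s: "s \<in> SU" "\<pi> x = realification s"
      using x by auto
    have "\<pi> (k \<otimes> x \<otimes> inv k) = realification (u ** s ** u')"
      using k x by (simp add: u u' s realification_mult)
    moreover have "u ** s ** u' \<in> SU"
      using s u u' d by (simp add: SU_def det_mul mult_in_U)
    ultimately show ?thesis
      using k x by blast
  qed
  then show ?thesis
    using k h unfolding H_component by (intro identity_component_conj subgroup_preimages) auto
qed

lemma sheet:
  obtains V T \<sigma> where "openin (top_of_set (carrier G)) V" "\<one> \<in> V" "openin (top_of_set (carrier Sp)) T" "mat 1 \<in> T"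
    "homeomorphism V T \<pi> \<sigma>"
  using covering_space_local_homeomorphism[OF pi_cover one_closed] by (metis pi_one)

text \<open>\<open>\<pi>\<close> is injective on the sheet \<open>V\<close>, so for \<open>x\<close>
  in the kernel the translate of \<open>V\<close> by \<open>x\<close> meets the kernel only in
  \<open>x\<close>. Thus \<open>C\<close> is discrete as well as connected. The lemma is applied to
  sets of commutators.\<close>

lemma connected_kernel_trivial:
  assumes C: "connected C" "\<one> \<in> C" "C \<subseteq> carrier G" and ker: "\<And>x. x \<in> C \<Longrightarrow> \<pi> x = mat 1"
  shows "C = {\<one>}"
proof -
  obtain V T \<sigma> where V: "openin (top_of_set (carrier G)) V" "\<one> \<in> V" and hom: "homeomorphism V T \<pi> \<sigma>"
    by (rule sheet)
  have sing: "openin (top_of_set C) {x}" if x: "x \<in> C" for x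
  proof -
    have "openin (top_of_set (carrier G)) ({x} <#> V)"
      using C x by (intro openin_left_translates V) auto
    then have "openin (top_of_set C) (C \<inter> ({x} <#> V))"
      using C(3) by (metis inf.absorb_iff2 openin_subtopology_Int2 subtopology_subtopology)
    moreover have "C \<inter> ({x} <#> V) = {x}"
    proof -
      have "y = x" if y: "y \<in> C" "y = x \<otimes> v" "v \<in> V" for y v
      proof -
        have v: "v \<in> carrier G"
          using y(3) openin_imp_subset[OF V(1)] by blast
        then have "\<pi> v = \<pi> \<one>"
          using ker[OF x] ker[OF y(1)] x C(3) y(2) by auto
        then have "v = \<one>"
          using hom y(3) V(2) unfolding homeomorphism_def by metis
        then show ?thesis
          using y(2) x C(3) by auto
      qed
      moreover have "x = x \<otimes> \<one>"
        using x C(3) by auto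
      ultimately show ?thesis
        using x V(2) unfolding set_mult_def by blast
    qed
    ultimately show ?thesis by simp
  qed
  have "openin (top_of_set C) (C - {\<one>})"
  proof -
    have "openin (top_of_set C) (\<Union>x\<in>C - {\<one>}. {x})"
      using sing by blast
    then show ?thesis by simp
  qed
  then have "C - {\<one>} = {}"
    using C(1) sing[OF C(2)] C(2) unfolding connected_openin by blast
  then show ?thesis
    using C(2) by blast
qed

lemma R_central:
  assumes k: "k \<in> K" and r: "r \<in> R"
  shows "k \<otimes> r = r \<otimes> k"
proof -
  let ?f = "\<lambda>x. k \<otimes> x \<otimes> inv k \<otimes> inv x"
  have "?f ` R = {\<one>}"
  proof (rule connected_kernel_trivial)
    have "connected R"
      unfolding R_component by (intro connected_identity_component subgroup_preimages)
    then show "connected (?f ` R)"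
      using k R_closed
      by (intro connected_continuous_image continuous_on_mult continuous_on_inv continuous_intros) auto
    show "\<one> \<in> ?f ` R"
      using subgroup.one_closed[OF subgroup_R] k by (intro image_eqI[of _ _ \<one>]) auto
    show "?f ` R \<subseteq> carrier G"
      using k R_closed by auto
    fix y assume "y \<in> ?f ` R"
    then obtain x where x: "x \<in> R" "y = ?f x" by blast
    obtain a where a: "\<pi> x = realification (mat (cis a))"
      using x(1) R_subset by (auto simp: unit_scalars_def)
    obtain u where u: "\<pi> k = realification u"
      using k by auto
    have "\<pi> (k \<otimes> x) = \<pi> (x \<otimes> k)"
      using k x R_closed by (simp add: a u mat_commute flip: realification_mult)
    moreover have "?f x = (k \<otimes> x) \<otimes> inv (x \<otimes> k)"
      using k x R_closed by (simp add: inv_mult_group m_assoc)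
    ultimately show "\<pi> y = mat 1"
      using pi_eqD(2)[of "k \<otimes> x" "x \<otimes> k"] k x R_closed by (metis (no_types, lifting) m_closed mem_Collect_eq)
  qed
  then have "?f r = \<one>"
    using r by blast
  then have "(k \<otimes> r) \<otimes> inv (r \<otimes> k) = \<one>"
    using k r R_closed by (simp add: inv_mult_group m_assoc)
  then show ?thesis
    using k r R_closed by (metis (mono_tags, lifting) inv_closed inv_equality inv_inv m_closed mem_Collect_eq)
qed

text \<open>One inclusion is \<open>Sp_central_imp\<close> together with surjectivity of
  \<open>\<pi>\<close>. For the other, if \<open>\<pi> z\<close> is \<open>mat 1\<close> or its
  negative, the commutators of \<open>z\<close> form a connected image of \<open>carrier G\<close>
  inside the kernel, so they are trivial.\<close>

lemma center_eq: "center G = {z \<in> carrier G. \<pi> z = mat 1 \<or> \<pi> z = - mat 1}"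
proof (intro equalityI subsetI)
  fix z assume z: "z \<in> center G"
  then have zG: "z \<in> carrier G" and comm: "\<And>x. x \<in> carrier G \<Longrightarrow> z \<otimes> x = x \<otimes> z"
    unfolding center_def by blast+
  have "\<pi> z ** g = g ** \<pi> z" if "g \<in> carrier Sp" for g
  proof -
    have "g \<in> \<pi> ` carrier G"
      using that by (simp only: pi_surj)
    then obtain x where x: "g = \<pi> x" "x \<in> carrier G"
      by (rule imageE)
    have "\<pi> (z \<otimes> x) = \<pi> (x \<otimes> z)"
      by (simp only: comm[OF x(2)])
    then show ?thesis
      using x zG by simp
  qed
  then show "z \<in> {z \<in> carrier G. \<pi> z = mat 1 \<or> \<pi> z = - mat 1}"
    using Sp_central_imp[of "\<pi> z"] zG by simp
next
  fix z assume z: "z \<in> {z \<in> carrier G. \<pi> z = mat 1 \<or> \<pi> z = - mat 1}"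
  then have zG: "z \<in> carrier G" by simp
  let ?f = "\<lambda>x. z \<otimes> x \<otimes> inv z \<otimes> inv x"
  have *: "?f x = (z \<otimes> x) \<otimes> inv (x \<otimes> z)" if "x \<in> carrier G" for x
    using zG that by (simp add: inv_mult_group m_assoc)
  have "?f ` carrier G = {\<one>}"
  proof (rule connected_kernel_trivial)
    show "connected (?f ` carrier G)"
      using zG path_connected_imp_connected[OF path_connected]
      by (intro connected_continuous_image continuous_on_mult continuous_on_inv continuous_intros) auto
    show "\<one> \<in> ?f ` carrier G"
      using zG by (intro image_eqI[of _ _ \<one>]) auto
    show "?f ` carrier G \<subseteq> carrier G"
      using zG by auto
    fix y assume "y \<in> ?f ` carrier G"
    then obtain x where x: "x \<in> carrier G" "y = ?f x" by blast
    have "\<pi> (z \<otimes> x) = \<pi> (x \<otimes> z)"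
      using z x by (auto simp: minus_matrix_mult matrix_mult_minus)
    then show "\<pi> y = mat 1"
      using pi_eqD(2)[of "z \<otimes> x" "x \<otimes> z"] zG x * by (metis m_closed)
  qed
  then have "?f x = \<one>" if "x \<in> carrier G" for x
    using that by blast
  then have "z \<otimes> x = x \<otimes> z" if "x \<in> carrier G" for x
    using zG that * by (metis inv_closed inv_equality inv_inv m_closed)
  then show "z \<in> center G"
    using zG unfolding center_def by blast
qed

lemma center_subset_K: "center G \<subseteq> K"
proof -
  have "realification (mat 1) \<in> realification ` carrier (U :: (complex^'n^'n) monoid)"
    "realification (- mat 1) \<in> realification ` carrier (U :: (complex^'n^'n) monoid)"
    by (rule imageI, simp add: carrier_U) (rule imageI[OF uminus_mat_1_in_U])
  then show ?thesis
    unfolding center_eq by (auto simp: realification_uminus)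
qed

end

context symplectic_cover
begin

section \<open>The identity of \<open>K\<close> with the product \<open>H <#> R\<close>\<close>

lemma set_mult_memI: "a \<in> A \<Longrightarrow> b \<in> B \<Longrightarrow> a \<otimes> b \<in> A <#> B"
  unfolding set_mult_def by blast

lemma HR_subgroup: "subgroup (H <#> R) G"
proof (rule subgroupI)
  show "H <#> R \<subseteq> carrier G"
    using H_closed R_closed by (auto simp: set_mult_def)
  have "\<one> \<otimes> \<one> \<in> H <#> R"
    by (intro set_mult_memI subgroup.one_closed subgroup_H subgroup_R)
  then show "H <#> R \<noteq> {}"
    by blast
next
  fix x assume "x \<in> H <#> R"
  then obtain h r where x: "h \<in> H" "r \<in> R" "x = h \<otimes> r"
    by (auto simp: set_mult_def)
  have "inv x = inv r \<otimes> inv h"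
    using x H_closed R_closed by (simp add: inv_mult_group)
  also have "\<dots> = inv h \<otimes> inv r"
    using R_central[OF subsetD[OF H_subset_K subgroup.m_inv_closed[OF subgroup_H x(1)]]
        subgroup.m_inv_closed[OF subgroup_R x(2)]]
    by (rule sym)
  finally show "inv x \<in> H <#> R"
    using set_mult_memI[OF subgroup.m_inv_closed[OF subgroup_H x(1)] subgroup.m_inv_closed[OF subgroup_R x(2)]]
    by simp
next
  fix x y assume "x \<in> H <#> R" "y \<in> H <#> R"
  then obtain h r h' r' where x: "h \<in> H" "r \<in> R" "x = h \<otimes> r" "h' \<in> H" "r' \<in> R" "y = h' \<otimes> r'"
    by (auto simp: set_mult_def)
  have "x \<otimes> y = h \<otimes> (r \<otimes> h') \<otimes> r'"
    using x H_closed R_closed by (simp add: m_assoc)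
  also have "r \<otimes> h' = h' \<otimes> r"
    using R_central[OF subsetD[OF H_subset_K x(4)] x(2)] by (rule sym)
  finally have "x \<otimes> y = (h \<otimes> h') \<otimes> (r \<otimes> r')"
    using x H_closed R_closed by (simp add: m_assoc)
  then show "x \<otimes> y \<in> H <#> R"
    using set_mult_memI[OF subgroup.m_closed[OF subgroup_H x(1,4)] subgroup.m_closed[OF subgroup_R x(2,5)]]
    by simp
qed

lemma HR_subset_K: "H <#> R \<subseteq> K"
  using subgroup.m_closed[OF subgroup_K] H_subset_K R_subset_K
  unfolding set_mult_def by (auto simp del: mem_Collect_eq dest!: subsetD)

lemma small_sheet:
  assumes V: "openin (top_of_set (carrier G)) V" "\<one> \<in> V" and hom: "homeomorphism V T \<pi> \<sigma>"
    and V': "openin (top_of_set (carrier G)) V'" "\<one> \<in> V'" "V' \<subseteq> V"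
  shows "homeomorphism V' (\<pi> ` V') \<pi> \<sigma>" "openin (top_of_set (carrier Sp)) (\<pi> ` V')" "mat 1 \<in> \<pi> ` V'"
proof -
  show "homeomorphism V' (\<pi> ` V') \<pi> \<sigma>"
    by (rule homeomorphism_of_subsets[OF hom V'(3)]) (use hom V'(3) in \<open>auto simp: homeomorphism_def\<close>)
  show "openin (top_of_set (carrier Sp)) (\<pi> ` V')"
    by (rule covering_space_open[OF pi_cover V'(1)])
  show "mat 1 \<in> \<pi> ` V'"
    using V'(2) by (intro image_eqI[of _ _ \<one>]) auto
qed

text \<open>The section \<open>\<sigma>\<close> carries the connected set \<open>C\<close> to a
  connected set through \<open>\<one>\<close>, which therefore stays in the identity component. For
  \<open>SU\<close> and \<open>unit_scalars\<close> this places lifts in \<open>H\<close> and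
  \<open>R\<close>.\<close>

lemma connected_section_image:
  assumes hom: "homeomorphism V (\<pi> ` V) \<pi> \<sigma>" and V: "V \<subseteq> carrier G" "\<one> \<in> V"
    and C: "connected C" "mat 1 \<in> C" "realification ` C \<subseteq> \<pi> ` V" "C \<subseteq> S"
    and S: "subgroup {x \<in> carrier G. \<pi> x \<in> realification ` S} G"
    and s: "s \<in> C"
  shows "\<sigma> (realification s) \<in> identity_component {x \<in> carrier G. \<pi> x \<in> realification ` S}"
proof -
  have \<sigma>: "\<pi> (\<sigma> g) = g" "\<sigma> g \<in> V" if "g \<in> \<pi> ` V" for g
    using hom that by (auto simp: homeomorphism_def)
  have "(\<lambda>A. \<sigma> (realification A)) ` C \<subseteq> identity_component {x \<in> carrier G. \<pi> x \<in> realification ` S}"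
  proof (rule identity_component_maximal[OF S])
    have "continuous_on (\<pi> ` V) \<sigma>"
      using hom by (simp add: homeomorphism_def)
    then have "continuous_on C (\<lambda>A. \<sigma> (realification A))"
      by (rule continuous_on_compose2) (use C(3) in \<open>auto intro!: continuous_intros\<close>)
    then show "connected ((\<lambda>A. \<sigma> (realification A)) ` C)"
      using C(1) by (rule connected_continuous_image)
    have "\<sigma> (realification (mat 1)) = \<one>"
      using hom V(2) unfolding homeomorphism_def by (metis pi_one realification_mat_1)
    then show "\<one> \<in> (\<lambda>A. \<sigma> (realification A)) ` C"
      using C(2) by (metis imageI)
    show "(\<lambda>A. \<sigma> (realification A)) ` C \<subseteq> {x \<in> carrier G. \<pi> x \<in> realification ` S}"
    proof clarify
      fix A assume A: "A \<in> C"
      then have "realification A \<in> \<pi> ` V"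
        using C(3) by blast
      with A C(4) \<sigma> V(1) show "\<sigma> (realification A) \<in> carrier G \<and> \<pi> (\<sigma> (realification A)) \<in> realification ` S"
        by auto
    qed
  qed
  then show ?thesis
    using s by blast
qed

text \<open>The two factors of a unitary matrix near \<open>mat 1\<close> lift along their short
  paths to \<open>H\<close> and \<open>R\<close>. The set \<open>V'\<close> is so small that the
  product of the lifts remains in the sheet \<open>V\<close>, where \<open>\<pi>\<close> is
  injective; so this product is the given point and not merely a point with the same image.\<close>

lemma HR_nbhd:
  obtains V0 where "openin (top_of_set (carrier G)) V0" "\<one> \<in> V0" "V0 \<inter> K \<subseteq> H <#> R"
proof -
  obtain V T \<sigma> where V: "openin (top_of_set (carrier G)) V" "\<one> \<in> V" and hom: "homeomorphism V T \<pi> \<sigma>"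
    by (rule sheet)
  have "continuous_on (carrier G \<times> carrier G) (\<lambda>z. fst z \<otimes> snd z)"
    by (intro continuous_on_mult continuous_intros) auto
  then obtain V' where V': "openin (top_of_set (carrier G)) V'" "\<one> \<in> V'" "V' \<subseteq> V"
    and mult: "\<And>x y. x \<in> V' \<Longrightarrow> y \<in> V' \<Longrightarrow> x \<otimes> y \<in> V"
    by (rule nbhd_one[OF V, of "\<lambda>z. fst z \<otimes> snd z"]) auto
  note hom' = small_sheet[OF V hom V']
  have V'G: "V' \<subseteq> carrier G"
    using openin_imp_subset[OF V'(1)] .
  obtain T' where T': "open T'" "\<pi> ` V' = carrier Sp \<inter> T'"
    using hom'(2) unfolding openin_open by blast
  define W where "W = realification -` T'"
  have "open W"
    unfolding W_def by (intro open_vimage T'(1) continuous_intros)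
  moreover have "mat 1 \<in> W"
    using hom'(3) T'(2) by (auto simp: W_def)
  ultimately obtain W' where W': "open W'" "mat 1 \<in> W'" and factor:
    "\<forall>u\<in>carrier U \<inter> W'. \<exists>s r C C'. u = s ** r \<and>
       connected C \<and> mat 1 \<in> C \<and> s \<in> C \<and> C \<subseteq> SU \<inter> W \<and>
       connected C' \<and> mat 1 \<in> C' \<and> r \<in> C' \<and> C' \<subseteq> unit_scalars \<inter> W"
    using unitary_near_1_factor by meson
  show thesis
  proof
    let ?V0 = "V \<inter> (carrier G \<inter> (\<lambda>x. unrealify (\<pi> x)) -` W')"
    have "openin (top_of_set (carrier G)) (carrier G \<inter> (\<lambda>x. unrealify (\<pi> x)) -` W')"
      by (intro continuous_openin_preimage_gen continuous_intros pi_cont W'(1))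
    then show "openin (top_of_set (carrier G)) ?V0"
      using V(1) by (rule openin_Int[rotated])
    have "unrealify (mat 1) = (mat 1 :: complex^'n^'n)"
      by (metis realification_mat_1 unrealify_realification)
    then show "\<one> \<in> ?V0"
      using V(2) W'(2) by simp
    show "?V0 \<inter> K \<subseteq> H <#> R"
    proof
      fix x assume x: "x \<in> ?V0 \<inter> K"
      then obtain u where u: "u \<in> carrier U" "\<pi> x = realification u" "u \<in> W'"
        by auto
      obtain s r C C' where f: "u = s ** r" "connected C" "mat 1 \<in> C" "s \<in> C" "C \<subseteq> SU \<inter> W"
       "connected C'" "mat 1 \<in> C'" "r \<in> C'" "C' \<subseteq> unit_scalars \<inter> W"
        using bspec[OF factor IntI[OF u(1,3)]] by blast
      have CU: "SU \<subseteq> carrier (U :: (complex^'n^'n) monoid)" "unit_scalars \<subseteq> carrier (U :: (complex^'n^'n) monoid)"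
        using subgroup.subset[OF subgroup_SU] subgroup.subset[OF subgroup_unit_scalars] by auto
      have "realification ` carrier U \<subseteq> carrier (Sp :: (real^('n + 'n)^('n + 'n)) monoid)"
        unfolding realification_U by auto
      then have sub: "realification ` C \<subseteq> \<pi> ` V'" "realification ` C' \<subseteq> \<pi> ` V'"
        using f(5,9) CU unfolding T'(2) W_def by blast+
      have "\<sigma> (realification s) \<in> H"
        unfolding H_component
        by (rule connected_section_image[OF hom'(1) V'G V'(2) f(2,3) sub(1) _ subgroup_preimages(1) f(4)])
          (use f(5) in auto)
      moreover have "\<sigma> (realification r) \<in> R"
        unfolding R_component
        by (rule connected_section_image[OF hom'(1) V'G V'(2) f(6,7) sub(2) _ subgroup_preimages(2) f(8)])
          (use f(9) in auto)
      moreover have "\<sigma> (realification s) \<otimes> \<sigma> (realification r) = x"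
      proof -
        have \<sigma>: "\<pi> (\<sigma> g) = g" "\<sigma> g \<in> V'" if "g \<in> \<pi> ` V'" for g
          using hom'(1) that by (auto simp: homeomorphism_def)
        have in_V': "\<sigma> (realification s) \<in> V'" "\<sigma> (realification r) \<in> V'"
          using \<sigma>(2) sub f(4,8) by auto
        have "\<pi> (\<sigma> (realification s) \<otimes> \<sigma> (realification r)) = realification s ** realification r"
        proof -
          have "\<pi> (\<sigma> (realification s)) = realification s" "\<pi> (\<sigma> (realification r)) = realification r"
            using sub f(4,8) by (auto intro!: \<sigma>(1))
          then show ?thesis
            using pi_mult[OF subsetD[OF V'G in_V'(1)] subsetD[OF V'G in_V'(2)]] by simp
        qed
        then have "\<pi> (\<sigma> (realification s) \<otimes> \<sigma> (realification r)) = \<pi> x"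
          by (simp add: u(2) f(1) realification_mult)
        moreover have "\<sigma> (realification s) \<otimes> \<sigma> (realification r) \<in> V" "x \<in> V"
          using mult[OF in_V'] x by auto
        ultimately show ?thesis
          using hom unfolding homeomorphism_def by metis
      qed
      ultimately show "x \<in> H <#> R"
        using set_mult_memI by metis
    qed
  qed
qed

text \<open>The translates of the open set \<open>\<pi>(V)\<close> by \<open>\<pi>(K)\<close> cover
  \<open>U(n)\<close>, so they contain every symplectic matrix of sufficiently small defect. It
  remains to correct the lift by a kernel element.\<close>

lemma near_K:
  assumes V: "openin (top_of_set (carrier G)) V" "\<one> \<in> V"
  shows "\<exists>e>0. \<forall>x\<in>carrier G. norm (gram (\<pi> x) - mat 1) < e \<longrightarrow> x \<in> K <#> V"
proof -
  have VG: "V \<subseteq> carrier G"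
    using openin_imp_subset[OF V(1)] .
  have "openin (top_of_set (carrier Sp)) (\<pi> ` V)"
    by (rule covering_space_open[OF pi_cover V(1)])
  then obtain T' where T': "open T'" "\<pi> ` V = carrier Sp \<inter> T'"
    unfolding openin_open by blast
  define W where "W = (\<Union>k\<in>K. (\<lambda>g. \<pi> (inv k) ** g) -` T')"
  have open_W: "open W"
    unfolding W_def by (intro open_UN ballI open_vimage T'(1) continuous_intros)
  have sub_W: "{g \<in> carrier Sp. gram g = mat 1} \<subseteq> W"
  proof
    fix g :: "real^('n + 'n)^('n + 'n)"
    assume g: "g \<in> {g \<in> carrier Sp. gram g = mat 1}"
    then have "g \<in> \<pi> ` carrier G"
      by (simp add: pi_surj)
    then obtain k where k: "g = \<pi> k" "k \<in> carrier G"
      by (rule imageE)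
    moreover have "k \<in> K"
      using g k unfolding realification_U by simp
    moreover have "mat 1 \<in> T'"
      using T'(2) V(2) pi_one by (metis IntD2 imageI)
    ultimately show "g \<in> W"
      unfolding W_def by (intro UN_I[of k]) auto
  qed
  obtain e where e: "e > 0" "\<forall>g\<in>carrier Sp. norm (gram g - mat 1) < e \<longrightarrow> g \<in> W"
    using small_defect_near_orthogonal[OF open_W sub_W] by auto
  have "x \<in> K <#> V" if x: "x \<in> carrier G" "norm (gram (\<pi> x) - mat 1) < e" for x
  proof -
    have "\<pi> x \<in> W"
      using e(2) x by simp
    then obtain k where k: "k \<in> K" "\<pi> (inv k) ** \<pi> x \<in> T'"
      unfolding W_def by auto
    have kG: "k \<in> carrier G"
      using k by simp
    then have kx: "inv k \<otimes> x \<in> carrier G"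
      using x by simp
    have "\<pi> (inv k \<otimes> x) \<in> T'"
      using k(2) x kG by simp
    then have "\<pi> (inv k \<otimes> x) \<in> \<pi> ` V"
      using pi_closed[OF kx] by (simp only: T'(2) Int_iff)
    then obtain v where v: "v \<in> V" "\<pi> (inv k \<otimes> x) = \<pi> v"
      by (rule imageE)
    have vG: "v \<in> carrier G"
      using v(1) VG by (rule rev_subsetD)
    \<comment> \<open>The points \<open>inv k \<otimes> x\<close> and \<open>v\<close> differ by a
      kernel element. Kernel elements are central and lie in \<open>K\<close>, so this one is
      absorbed into \<open>k\<close>.\<close>
    have "\<pi> (inv k \<otimes> x \<otimes> inv v) = mat 1"
      using pi_eqD(2)[OF kx vG v(2)] .
    then have "inv k \<otimes> x \<otimes> inv v \<in> center G"
      unfolding center_eq using x vG kG by simp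
    then have kK: "k \<otimes> (inv k \<otimes> x \<otimes> inv v) \<in> K"
      by (rule subgroup.m_closed[OF subgroup_K k(1) subsetD[OF center_subset_K]])
    have eq: "k \<otimes> (inv k \<otimes> x \<otimes> inv v) \<otimes> v = x"
    proof -
      have "k \<otimes> (inv k \<otimes> x \<otimes> inv v) \<otimes> v = (k \<otimes> inv k) \<otimes> x \<otimes> (inv v \<otimes> v)"
        using x vG kG by (simp only: m_assoc inv_closed m_closed)
      then show ?thesis
        using x vG kG by simp
    qed
    show ?thesis
      using set_mult_memI[OF kK v(1)] by (simp only: eq)
  qed
  with e(1) show ?thesis by blast
qed

text \<open>The contraction of \<open>Sp\<close> onto its orthogonal part lifts to \<open>G\<close>, because each step multiplies by an element
  close to \<open>1\<close>. It carries a path from \<open>1\<close> to \<open>k \<in> K\<close> into \<open>K <#> V\<close> for a small \<open>V\<close>, where the coset of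
  \<open>H <#> R\<close> is locally constant.\<close>

lemma lifted_contraction:
  "\<exists>c F. 1/2 \<le> c \<and> c < 1 \<and> continuous_on (carrier G) F \<and> F ` carrier G \<subseteq> carrier G \<and>
    (\<forall>x\<in>carrier G. \<pi> (F x) = retract_step c (\<pi> x)) \<and> (\<forall>x\<in>K. F x = x)"
proof -
  obtain V T \<sigma> where V: "openin (top_of_set (carrier G)) V" "\<one> \<in> V"
    and T: "openin (top_of_set (carrier Sp)) T" "mat 1 \<in> T" and hom: "homeomorphism V T \<pi> \<sigma>"
    by (rule sheet)
  have VG: "V \<subseteq> carrier G"
    using openin_imp_subset[OF V(1)] .
  have \<sigma>: "\<pi> (\<sigma> g) = g" "\<sigma> g \<in> V" "\<sigma> g \<in> carrier G" if "g \<in> T" for g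
    using hom that VG by (auto simp: homeomorphism_def)
  have \<sigma>_1: "\<sigma> (mat 1) = \<one>"
    using hom V(2) unfolding homeomorphism_def by (metis pi_one)
  obtain d where d: "d > 0" "\<And>g. g \<in> carrier Sp \<Longrightarrow> dist g (mat 1) < d \<Longrightarrow> g \<in> T"
    using T unfolding openin_euclidean_subtopology_iff by blast
  define m where "m = real (CARD('n + 'n) * CARD('n + 'n))"
  \<comment> \<open>With this choice the bound \<open>m * (2 * (1 - c))\<close> of
    \<open>norm_retract_factor\<close> is at most \<open>d / 2\<close>, so every factor lies in
    \<open>T\<close>; the cap \<open>1/2\<close> keeps \<open>c \<ge> 1/2\<close>.\<close>
  define c where "c = 1 - min (1/2) (d / (4 * m))"
  have m: "m > 0"
    by (simp add: m_def)
  then have c: "1/2 \<le> c" "c < 1"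
    using d(1) by (auto simp: c_def)
  have "m * (2 * (1 - c)) \<le> m * (2 * (d / (4 * m)))"
    using m by (intro mult_left_mono) (auto simp: c_def)
  also have "\<dots> < d"
    using m d(1) by simp
  finally have "m * (2 * (1 - c)) < d" .
  then have fT: "retract_factor c g \<in> T" if "g \<in> carrier Sp" for g
    using norm_retract_factor[OF c that] d(2)[OF retract_factor_in_Sp[OF c that]] by (simp add: dist_norm m_def)
  define F where "F x = x \<otimes> \<sigma> (retract_factor c (\<pi> x))" for x
  show ?thesis
  proof (intro exI[of _ c] exI[of _ F] conjI c ballI)
    have "continuous_on T \<sigma>"
      using hom by (simp add: homeomorphism_def)
    moreover have "continuous_on (carrier G) (\<lambda>x. retract_factor c (\<pi> x))"
      by (rule continuous_on_compose2[OF continuous_on_retract_factor[OF c] pi_cont]) auto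
    ultimately have "continuous_on (carrier G) (\<lambda>x. \<sigma> (retract_factor c (\<pi> x)))"
      by (rule continuous_on_compose2) (use fT in auto)
    then show "continuous_on (carrier G) F"
      unfolding F_def using \<sigma>(3) fT by (intro continuous_on_mult continuous_intros) auto
    show "F ` carrier G \<subseteq> carrier G"
      using \<sigma>(3) fT by (auto simp: F_def)
    show "\<pi> (F x) = retract_step c (\<pi> x)" if "x \<in> carrier G" for x
      using that \<sigma> fT by (simp add: F_def retract_step_def)
    show "F x = x" if "x \<in> K" for x
    proof -
      have x: "x \<in> carrier G" "gram (\<pi> x) = mat 1"
        using that K_iff by auto
      have "\<pi> x ** retract_factor c (\<pi> x) = \<pi> x"
        using retract_step_unitary[OF c x(2)] by (simp add: retract_step_def)
      then have "\<pi> (inv x) ** \<pi> x ** retract_factor c (\<pi> x) = \<pi> (inv x) ** \<pi> x"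
        by (simp only: matrix_mul_assoc[symmetric])
      then have "retract_factor c (\<pi> x) = mat 1"
        using x(1) by simp
      then show ?thesis
        using x(1) by (simp add: F_def \<sigma>_1)
    qed
  qed
qed

lemma K_subset_HR: "K \<subseteq> H <#> R"
proof
  fix k assume k: "k \<in> K"
  obtain V0 where V0: "openin (top_of_set (carrier G)) V0" "\<one> \<in> V0" "V0 \<inter> K \<subseteq> H <#> R"
    by (rule HR_nbhd)
  \<comment> \<open>Quotients of elements of \<open>V\<close> must stay in \<open>V0\<close>, so
    that two decompositions of one point over \<open>K\<close> have base points in the same coset of
    \<open>H <#> R\<close>.\<close>
  have "continuous_on (carrier G \<times> carrier G) (\<lambda>z. fst z \<otimes> inv (snd z))"
    by (intro continuous_on_mult continuous_on_inv continuous_intros) auto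
  then obtain V where V: "openin (top_of_set (carrier G)) V" "\<one> \<in> V" "V \<subseteq> V0"
    and div: "\<And>x y. x \<in> V \<Longrightarrow> y \<in> V \<Longrightarrow> x \<otimes> inv y \<in> V0"
    by (rule nbhd_one[OF V0(1,2), of "\<lambda>z. fst z \<otimes> inv (snd z)"]) auto
  have VG: "V \<subseteq> carrier G"
    using openin_imp_subset[OF V(1)] .
  obtain e where e: "e > 0" "\<And>x. x \<in> carrier G \<Longrightarrow> norm (gram (\<pi> x) - mat 1) < e \<Longrightarrow> x \<in> K <#> V"
    using near_K[OF V(1,2)] by blast
  obtain c F where c: "1/2 \<le> c" "c < 1" and F_cont: "continuous_on (carrier G) F"
    and F: "F ` carrier G \<subseteq> carrier G" "\<forall>x\<in>carrier G. \<pi> (F x) = retract_step c (\<pi> x)"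
      "\<forall>x\<in>K. F x = x"
    using lifted_contraction by auto
  have iter: "(F ^^ N) x \<in> carrier G \<and> \<pi> ((F ^^ N) x) = (retract_step c ^^ N) (\<pi> x)"
    if "x \<in> carrier G" for N x
    by (induction N) (use that F in auto)
  have iter_cont: "continuous_on (carrier G) (F ^^ N)" for N
  proof (induction N)
    case (Suc N)
    have "continuous_on (carrier G) (\<lambda>x. F ((F ^^ N) x))"
      by (rule continuous_on_compose2[OF F_cont Suc]) (use iter in auto)
    then show ?case by (simp add: o_def)
  qed (simp add: id_def)
  have iter_K: "(F ^^ N) x = x" if "x \<in> K" for N x
    by (induction N) (use that F(3) in auto)
  have one: "\<one> \<in> K"
    by (rule subgroup.one_closed[OF subgroup_K])
  obtain p where p: "path p" "path_image p \<subseteq> carrier G" "pathstart p = \<one>" "pathfinish p = k"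
    using path_connected k one unfolding path_connected_def by blast
  then have p_cont: "continuous_on {0..1} p" and p_in: "\<And>t. t \<in> {0..1} \<Longrightarrow> p t \<in> carrier G"
    by (auto simp: path_def path_image_def)
  define d where "d N t = norm (gram (\<pi> ((F ^^ N) (p t))) - mat 1)" for N t
  have comp_cont: "continuous_on {0..1} (\<lambda>t. (F ^^ N) (p t))" for N
    by (rule continuous_on_compose2[OF iter_cont p_cont]) (use p_in in auto)
  have d_cont: "continuous_on {0..1} (d N)" for N
    unfolding d_def using iter p_in
    by (intro continuous_intros continuous_on_compose2[OF pi_cont comp_cont]) auto
  have d_dec: "d (Suc N) t \<le> d N t" if "t \<in> {0..1}" for N t
  proof -
    have y: "(F ^^ N) (p t) \<in> carrier G"
      using iter[OF p_in[OF that]] by blast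
    then have "\<pi> ((F ^^ Suc N) (p t)) = retract_step c (\<pi> ((F ^^ N) (p t)))"
      using F(2) by simp
    then show ?thesis
      unfolding d_def using defect_retract_step_le[OF c pi_closed[OF y]] by simp
  qed
  \<comment> \<open>The number of steps needed depends on \<open>t\<close>. As the defect never
    increases, these open sets grow with \<open>N\<close>, and compactness of the interval yields
    one \<open>N\<close> for the whole path.\<close>
  define S where "S N = {0..1} \<inter> d N -` {..<e}" for N
  have S_mono: "S M \<subseteq> S N" if "M \<le> N" for M N
  proof -
    have "S N \<subseteq> S (Suc N)" for N
      unfolding S_def using le_less_trans[OF d_dec] by auto
    then show ?thesis
      by (rule lift_Suc_mono_le[OF _ that])
  qed
  have S_open: "openin (top_of_set {0..1}) (S N)" for N
    unfolding S_def by (intro continuous_openin_preimage_gen d_cont open_lessThan)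
  have S_cover: "{0..1} \<subseteq> \<Union> (range S)"
  proof
    fix t :: real assume t: "t \<in> {0..1}"
    obtain N where "norm (gram ((retract_step c ^^ N) (\<pi> (p t))) - mat 1) < e"
      using retract_iterates_defect[OF c pi_closed[OF p_in[OF t]] e(1)] by blast
    then have "t \<in> S N"
      using t iter[OF p_in[OF t]] by (simp add: S_def d_def)
    then show "t \<in> \<Union> (range S)"
      by blast
  qed
  have "\<forall>B\<in>range S. openin (top_of_set {0..1}) B"
    using S_open by blast
  then obtain D where D: "D \<subseteq> range S" "finite D" "{0..1} \<subseteq> \<Union> D"
    using compact_Icc[of 0 "1::real", unfolded compact_eq_openin_cover, rule_format, of "range S"] S_cover
    by blast
  then obtain I where I: "finite I" "D = S ` I"
    by (meson finite_subset_image)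
  have "S i \<subseteq> S (Max I)" if "i \<in> I" for i
    using S_mono I(1) that by simp
  then have all: "{0..1} \<subseteq> S (Max I)"
    using D(3) I(2) by blast
  define q where "q t = (F ^^ Max I) (p t)" for t
  have q_cont: "continuous_on {0..1} q"
    unfolding q_def by (rule comp_cont)
  have q_in: "q t \<in> carrier G" "q t \<in> K <#> V" if "t \<in> {0..1}" for t
  proof -
    show *: "q t \<in> carrier G"
      using iter p_in that by (simp add: q_def)
    have "d (Max I) t < e"
      using all that by (auto simp: S_def)
    then show "q t \<in> K <#> V"
      using e(2)[OF *] by (simp add: d_def q_def)
  qed
  have q01: "q 0 = \<one>" "q 1 = k"
    using p(3,4) iter_K one k by (auto simp: q_def pathstart_def pathfinish_def)
  note HR = HR_subgroup
  \<comment> \<open>The times at which the contracted path is near \<open>H <#> R\<close>, and in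
    \<open>B\<close> those at which it is near the rest of \<open>K\<close>. Both are open and they
    cover the interval; they are disjoint by the choice of \<open>V\<close>, so connectedness leaves
    only \<open>A\<close>.\<close>
  define A where "A = {0..1} \<inter> q -` ((H <#> R) <#> V)"
  define B where "B = {0..1} \<inter> q -` ((K - (H <#> R)) <#> V)"
  have op: "openin (top_of_set {0..1}) ({0..1} \<inter> q -` (Y <#> V))" if "Y \<subseteq> carrier G" for Y
    by (rule continuous_openin_preimage[OF q_cont _ openin_left_translates[OF V(1) that]]) (use q_in in auto)
  have "openin (top_of_set {0..1}) A"
    unfolding A_def by (rule op[OF subgroup.subset[OF HR]])
  moreover have "openin (top_of_set {0..1}) B"
    unfolding B_def by (rule op[OF order_trans[OF Diff_subset subgroup.subset[OF subgroup_K]]])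
  moreover have "{0..1} \<subseteq> A \<union> B"
  proof
    fix t :: real assume t: "t \<in> {0..1}"
    obtain b v where "b \<in> K" "v \<in> V" "q t = b \<otimes> v"
      using q_in(2)[OF t] unfolding set_mult_def by blast
    then show "t \<in> A \<union> B"
      using t set_mult_memI[of b _ v V] by (cases "b \<in> H <#> R") (simp_all add: A_def B_def)
  qed
  moreover have "A \<inter> B = {}"
  proof (rule ccontr)
    assume "A \<inter> B \<noteq> {}"
    then obtain t where "t \<in> A" "t \<in> B"
      by blast
    then have "q t \<in> (H <#> R) <#> V" "q t \<in> (K - (H <#> R)) <#> V"
      unfolding A_def B_def by blast+
    then obtain a v b w where t: "q t = a \<otimes> v" "a \<in> H <#> R" "v \<in> V" "q t = b \<otimes> w" "b \<in> K" "b \<notin> H <#> R" "w \<in> V"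
      unfolding set_mult_def[of _ _ V] by blast
    have car: "a \<in> carrier G" "b \<in> carrier G" "v \<in> carrier G" "w \<in> carrier G" "a \<in> K"
      using t VG subgroup.subset[OF HR] HR_subset_K by auto
    have eq: "inv a \<otimes> b = v \<otimes> inv w"
    proof -
      have "b = (a \<otimes> v) \<otimes> inv w"
        using t(1,4) car by (simp only: inv_solve_right m_closed)
      then have "b = a \<otimes> (v \<otimes> inv w)"
        using car by (simp only: m_assoc inv_closed)
      then have "v \<otimes> inv w = inv a \<otimes> b"
        using car by (simp only: inv_solve_left inv_closed m_closed)
      then show ?thesis ..
    qed
    have "inv a \<otimes> b \<in> K"
      by (rule subgroup.m_closed[OF subgroup_K subgroup.m_inv_closed[OF subgroup_K car(5)] t(5)])
    moreover have "inv a \<otimes> b \<in> V0"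
      unfolding eq by (rule div[OF t(3,7)])
    ultimately have "inv a \<otimes> b \<in> H <#> R"
      using V0(3) by blast
    then have "a \<otimes> (inv a \<otimes> b) \<in> H <#> R"
      by (rule subgroup.m_closed[OF HR t(2)])
    moreover have "a \<otimes> (inv a \<otimes> b) = b"
      using car by (simp add: m_assoc[symmetric])
    ultimately show False
      using t by simp
  qed
  moreover have "0 \<in> A"
  proof -
    have "\<one> \<otimes> \<one> \<in> (H <#> R) <#> V"
      by (intro set_mult_memI subgroup.one_closed[OF HR] V(2))
    then show ?thesis
      by (simp add: A_def q01)
  qed
  ultimately have "B = {}"
    using connected_Icc[of 0 "1::real"] unfolding connected_openin by blast
  then have "1 \<in> A"
    using \<open>{0..1} \<subseteq> A \<union> B\<close> by auto
  then have "k \<in> (H <#> R) <#> V"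
    by (simp add: A_def q01)
  then obtain h v where hv: "h \<in> H <#> R" "v \<in> V" "k = h \<otimes> v"
    unfolding set_mult_def[of _ _ V] by blast
  have car: "h \<in> carrier G" "v \<in> carrier G" "h \<in> K"
    using hv VG subgroup.subset[OF HR] HR_subset_K by auto
  \<comment> \<open>Being close to \<open>H <#> R\<close> is not yet membership; but
    \<open>k \<in> K\<close> forces \<open>v \<in> K\<close>, and \<open>V0\<close> meets
    \<open>K\<close> only inside \<open>H <#> R\<close>.\<close>
  have "v = inv h \<otimes> k"
    using hv car by (simp add: m_assoc[symmetric])
  then have "v \<in> K"
    using subgroup.m_closed[OF subgroup_K subgroup.m_inv_closed[OF subgroup_K car(3)] k] by simp
  then have "v \<in> H <#> R"
    using V0(3) V(3) hv(2) by blast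
  then show "k \<in> H <#> R"
    unfolding hv(3) by (rule subgroup.m_closed[OF HR hv(1)])
qed

lemma K_eq_HR: "K = H <#> R"
  using K_subset_HR HR_subset_K by blast

end

section \<open>Smooth functions\<close>

lemma Ck_on_cong:
  assumes "open W" "\<And>x. x \<in> W \<Longrightarrow> f x = g x" "Ck_on k W f"
  shows "Ck_on k W g"
  using assms(2,3)
proof (induction k arbitrary: f g)
  case 0
  then show ?case
    using continuous_on_cong[of W W f g] by simp
next
  case (Suc k)
  have f: "f differentiable at x" if "x \<in> W" for x
    using Suc.prems(2) that \<open>open W\<close> differentiable_on_eq_differentiable_at by auto
  have "g differentiable at x" if x: "x \<in> W" for x
  proof -
    obtain D where "(f has_derivative D) (at x)"
      using f[OF x] unfolding differentiable_def by blast
    then have "(g has_derivative D) (at x)"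
      by (rule has_derivative_transform_within_open[OF _ \<open>open W\<close> x Suc.prems(1)])
    then show ?thesis
      unfolding differentiable_def by blast
  qed
  moreover have "frechet_derivative f (at x) = frechet_derivative g (at x)" if "x \<in> W" for x
    using frechet_derivative_transform_within_open[OF f[OF that] \<open>open W\<close> that Suc.prems(1)] .
  then have "Ck_on k W (\<lambda>x. frechet_derivative g (at x) v)" for v
    using Suc.prems(2) by (intro Suc.IH[of "\<lambda>x. frechet_derivative f (at x) v" "\<lambda>x. frechet_derivative g (at x) v"]) simp_all
  ultimately show ?case
    by (simp add: differentiable_on_eq_differentiable_at[OF \<open>open W\<close>])
qed

text \<open>For linear \<open>L\<close> the derivative of the composite in direction
  \<open>v\<close> is the derivative of \<open>f\<close> in the fixed direction \<open>L v\<close>,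
  composed with \<open>L\<close>. It has the same shape, so the induction closes without product
  rules.\<close>

lemma Ck_on_compose_linear:
  fixes L :: "'a::euclidean_space \<Rightarrow> 'a"
  assumes L: "linear L" and W: "open W" and f: "Ck_on k W f"
  shows "Ck_on k (L -` W) (\<lambda>x. f (L x))"
  using f
proof (induction k arbitrary: f)
  case 0
  have "continuous_on (L -` W) L"
    using L linear_continuous_on linear_conv_bounded_linear by blast
  with 0 show ?case
    by (auto intro: continuous_on_compose2)
next
  case (Suc k)
  have LW: "open (L -` W)"
    using W L by (intro open_vimage linear_continuous_on) (auto simp: linear_conv_bounded_linear)
  have der: "((\<lambda>x. f (L x)) has_derivative (\<lambda>v. frechet_derivative f (at (L x)) (L v))) (at x)"
    if "x \<in> L -` W" for x
  proof -
    have "f differentiable at (L x)"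
      using Suc.prems that W differentiable_on_eq_differentiable_at by auto
    then have "(f has_derivative frechet_derivative f (at (L x))) (at (L x))"
      by (simp add: frechet_derivative_works)
    moreover have "(L has_derivative L) (at x)"
      using L linear_imp_has_derivative by blast
    ultimately show ?thesis
      using has_derivative_compose by blast
  qed
  then have "(\<lambda>x. f (L x)) differentiable at x" if "x \<in> L -` W" for x
    using that differentiable_def by blast
  then have "(\<lambda>x. f (L x)) differentiable_on L -` W"
    by (simp add: differentiable_on_eq_differentiable_at[OF LW])
  moreover have "Ck_on k (L -` W) (\<lambda>x. frechet_derivative (\<lambda>x. f (L x)) (at x) v)" for v
  proof (rule Ck_on_cong[OF LW])
    show "Ck_on k (L -` W) (\<lambda>x. frechet_derivative f (at (L x)) (L v))"
      by (rule Suc.IH[of "\<lambda>y. frechet_derivative f (at y) (L v)"]) (use Suc.prems in simp)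
    show "frechet_derivative f (at (L x)) (L v) = frechet_derivative (\<lambda>x. f (L x)) (at x) v" if "x \<in> L -` W" for x
      by (rule fun_cong[OF frechet_derivative_at[OF der[OF that]]])
  qed
  ultimately show ?case by simp
qed

lemma smooth_on_compose_linear:
  fixes L :: "'a::euclidean_space \<Rightarrow> 'a"
  assumes L: "linear L" and f: "smooth_on W f"
  shows "smooth_on (L -` W) (\<lambda>x. f (L x))"
  unfolding smooth_on_def
proof (intro conjI allI)
  show "open (L -` W)"
    using f L by (intro open_vimage linear_continuous_on) (auto simp: linear_conv_bounded_linear smooth_on_def)
  show "Ck_on k (L -` W) (\<lambda>x. f (L x))" for k
    using f by (intro Ck_on_compose_linear[OF L]) (auto simp: smooth_on_def)
qed

context symplectic_cover
begin

text \<open>Under \<open>\<pi>\<close> a two-sided translation becomes the restriction of the linear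
  map \<open>M \<mapsto> \<pi> a ** M ** \<pi> b\<close>, so local smooth extensions to matrices
  pull back to such extensions.\<close>

lemma smooth_on_cover_translate:
  assumes a: "a \<in> carrier G" and b: "b \<in> carrier G" and F: "smooth_on_cover G \<pi> F"
  shows "smooth_on_cover G \<pi> (\<lambda>x. F (a \<otimes> x \<otimes> b))"
  unfolding smooth_on_cover_def
proof
  fix x assume x: "x \<in> carrier G"
  define L where "L M = \<pi> a ** M ** \<pi> b" for M
  have L: "linear L"
    by (rule linearI) (simp_all add: L_def matrix_add_ldistrib matrix_add_rdistrib matrix_scalar_ac scalar_matrix_assoc)
  have "a \<otimes> x \<otimes> b \<in> carrier G"
    using a b x by simp
  from bspec[OF F[unfolded smooth_on_cover_def] this]
  obtain V W f where V: "openin (top_of_set (carrier G)) V" "a \<otimes> x \<otimes> b \<in> V" "\<pi> ` V \<subseteq> W"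
    "smooth_on W f" "\<forall>y\<in>V. F y = f (\<pi> y)"
    by (elim exE conjE)
  let ?V = "carrier G \<inter> (\<lambda>x. a \<otimes> x \<otimes> b) -` V"
  have "continuous_on (carrier G) (\<lambda>x. a \<otimes> x \<otimes> b)"
    using a b by (intro continuous_on_mult continuous_intros) auto
  then have "openin (top_of_set (carrier G)) ?V"
    by (rule continuous_openin_preimage[OF _ _ V(1)]) (use a b in auto)
  moreover have "x \<in> ?V"
    using x V(2) by simp
  moreover have LV: "L (\<pi> y) = \<pi> (a \<otimes> y \<otimes> b)" if "y \<in> ?V" for y
    using that a b by (simp add: L_def)
  then have "\<pi> ` ?V \<subseteq> L -` W"
    using V(3) by auto
  moreover have "smooth_on (L -` W) (\<lambda>M. f (L M))"
    using V(4) L by (rule smooth_on_compose_linear[rotated])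
  moreover have "\<forall>y\<in>?V. F (a \<otimes> y \<otimes> b) = f (L (\<pi> y))"
    using LV V(5) by auto
  ultimately show "\<exists>V W f. openin (top_of_set (carrier G)) V \<and> x \<in> V \<and> \<pi> ` V \<subseteq> W \<and>
       smooth_on W f \<and> (\<forall>y \<in> V. F (a \<otimes> y \<otimes> b) = f (\<pi> y))"
    by (intro exI[of _ ?V] exI[of _ "L -` W"] exI[of _ "\<lambda>M. f (L M)"] conjI)
qed

end

section \<open>The extended group and its action\<close>

context symplectic_cover
begin

abbreviation HR where "HR \<equiv> G\<lparr>carrier := K\<rparr>"
abbreviation Q where "Q \<equiv> HR_mod_H G \<pi>"
abbreviation E where "E \<equiv> extended_group G \<pi>"
abbreviation N where "N \<equiv> antidiagonal_center G \<pi>"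
abbreviation XX where "XX \<equiv> homogeneous_space G \<pi>"
abbreviation \<phi> where "\<phi> \<equiv> extended_action G \<pi>"

definition cl where "cl k = k <# H"
text \<open>The second entry is allowed to range over all of \<open>K\<close>, not just over
  \<open>R\<close>, since the elements of a stabilizer carry \<open>inv k\<close> with
  \<open>k \<in> K\<close> there.\<close>

definition cls where "cls g k = N #>\<^bsub>G \<times>\<times> Q\<^esub> (g, cl k)"

lemma K_closed: "k \<in> K \<Longrightarrow> k \<in> carrier G" by simp
lemma K_mult: "k \<in> K \<Longrightarrow> k' \<in> K \<Longrightarrow> k \<otimes> k' \<in> K" by (rule subgroup.m_closed[OF subgroup_K])
lemma K_inv: "k \<in> K \<Longrightarrow> inv k \<in> K" by (rule subgroup.m_inv_closed[OF subgroup_K])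
lemma K_one: "\<one> \<in> K" by (rule subgroup.one_closed[OF subgroup_K])
lemma H_in_K: "h \<in> H \<Longrightarrow> h \<in> K" by (rule subsetD[OF H_subset_K])
lemma R_in_K: "r \<in> R \<Longrightarrow> r \<in> K" by (rule subsetD[OF R_subset_K])
lemma H_sub_carrier: "H \<subseteq> carrier G" by (rule subgroup.subset[OF subgroup_H])

lemma center_closed: "z \<in> center G \<Longrightarrow> z \<in> carrier G"
  unfolding center_def by blast
lemma center_comm: "z \<in> center G \<Longrightarrow> x \<in> carrier G \<Longrightarrow> z \<otimes> x = x \<otimes> z"
  unfolding center_def by blast
lemma center_in_K: "z \<in> center G \<Longrightarrow> z \<in> K"
  by (rule subsetD[OF center_subset_K])

lemma subgroup_center: "subgroup (center G) G"
proof (rule subgroupI)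
  fix z assume z: "z \<in> center G"
  have "inv z \<otimes> x = x \<otimes> inv z" if x: "x \<in> carrier G" for x
  proof -
    have "z \<otimes> (x \<otimes> inv z) = x"
      using z x center_closed[OF z] by (simp add: m_assoc[symmetric] center_comm) (simp add: m_assoc)
    then show ?thesis
      using x center_closed[OF z] by (metis inv_closed inv_solve_left m_closed)
  qed
  then show "inv z \<in> center G"
    unfolding center_def using center_closed[OF z] by blast
next
  fix z w assume z: "z \<in> center G" "w \<in> center G"
  have "z \<otimes> w \<otimes> x = x \<otimes> (z \<otimes> w)" if x: "x \<in> carrier G" for x
    using x center_closed[OF z(1)] center_closed[OF z(2)] center_comm[OF z(1) x] center_comm[OF z(2) x]
    by (metis m_assoc)
  then show "z \<otimes> w \<in> center G"
    unfolding center_def using center_closed z by blast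
qed (auto simp: center_def)

section \<open>The factor group of \<open>K\<close> by \<open>H\<close>\<close>

lemma carrier_cover_HR: "cover_HR G \<pi> = HR"
  by (simp only: cover_HR_def K_eq_HR)

lemma group_HR: "group HR"
  by (rule subgroup.subgroup_is_group[OF subgroup_K is_group])

lemma HR_inv: "k \<in> K \<Longrightarrow> inv\<^bsub>HR\<^esub> k = inv k"
  by (rule m_inv_consistent[OF subgroup_K]) 

lemma normal_H: "H \<lhd> HR"
proof -
  have "subgroup H HR"
    using subgroup_incl[OF subgroup_H subgroup_K H_subset_K] .
  moreover have "k \<otimes> h \<otimes> inv\<^bsub>HR\<^esub> k \<in> H" if "k \<in> K" "h \<in> H" for k h
    using H_conj[OF that] HR_inv[OF that(1)] by simp
  ultimately show ?thesis
    using group.normal_inv_iff[OF group_HR] by simp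
qed

lemma r_coset_H: "k \<in> K \<Longrightarrow> H #>\<^bsub>HR\<^esub> k = cl k"
  using normal.coset_eq[OF normal_H] unfolding cl_def l_coset_consistent r_coset_consistent
  by simp

lemma carrier_Q: "carrier Q = cl ` K"
  unfolding HR_mod_H_def carrier_cover_HR carrier_FactGroup using r_coset_H by simp

lemma Q_eq: "Q = HR Mod H"
  by (simp only: HR_mod_H_def carrier_cover_HR)

lemma group_Q: "group Q"
  unfolding Q_eq by (rule normal.factorgroup_is_group[OF normal_H])

lemma mult_Q: "k \<in> K \<Longrightarrow> k' \<in> K \<Longrightarrow> cl k \<otimes>\<^bsub>Q\<^esub> cl k' = cl (k \<otimes> k')"
proof -
  assume k: "k \<in> K" "k' \<in> K"
  have m: "k \<otimes>\<^bsub>HR\<^esub> k' = k \<otimes> k'"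
    by simp
  have "cl k \<otimes>\<^bsub>Q\<^esub> cl k' = (H #>\<^bsub>HR\<^esub> k) <#>\<^bsub>HR\<^esub> (H #>\<^bsub>HR\<^esub> k')"
    by (simp only: Q_eq mult_FactGroup r_coset_H[OF k(1)] r_coset_H[OF k(2)])
  also have "\<dots> = H #>\<^bsub>HR\<^esub> (k \<otimes>\<^bsub>HR\<^esub> k')"
    by (rule normal.rcos_sum[OF normal_H]) (use k in simp_all)
  also have "\<dots> = cl (k \<otimes> k')"
    unfolding m by (rule r_coset_H[OF K_mult[OF k]])
  finally show ?thesis .
qed

lemma cl_one: "cl \<one> = H"
  unfolding cl_def using lcos_mult_one[OF H_sub_carrier] .

lemma one_Q: "\<one>\<^bsub>Q\<^esub> = cl \<one>"
  by (simp add: Q_eq cl_one)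

lemma inv_Q: "k \<in> K \<Longrightarrow> inv\<^bsub>Q\<^esub> (cl k) = cl (inv k)"
proof (rule group.inv_equality[OF group_Q])
  assume k: "k \<in> K"
  show "cl (inv k) \<otimes>\<^bsub>Q\<^esub> cl k = \<one>\<^bsub>Q\<^esub>"
    unfolding mult_Q[OF K_inv[OF k] k] one_Q l_inv[OF K_closed[OF k]] ..
  show "cl k \<in> carrier Q" "cl (inv k) \<in> carrier Q"
    unfolding carrier_Q by (intro imageI k K_inv)+
qed

lemma cl_eqI: "x \<in> carrier G \<Longrightarrow> h \<in> H \<Longrightarrow> cl (x \<otimes> h) = cl x"
proof -
  assume x: "x \<in> carrier G" and h: "h \<in> H"
  have "x \<otimes> h \<in> x <# H"
    using h by (auto simp: l_coset_def)
  then show ?thesis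
    unfolding cl_def using l_repr_independence[OF _ x subgroup_H] by metis
qed

lemma cl_eqD:
  assumes "x \<in> carrier G" "y \<in> carrier G" "cl x = cl y"
  shows "\<exists>h\<in>H. y = x \<otimes> h"
proof -
  have "y \<in> x <# H"
    using lcos_self[OF assms(2) subgroup_H] assms(3) by (simp add: cl_def)
  then show ?thesis
    by (auto simp: l_coset_def)
qed

lemma cl_translate: "y \<in> carrier G \<Longrightarrow> x \<in> carrier G \<Longrightarrow> y <# cl x = cl (y \<otimes> x)"
  unfolding cl_def by (rule lcos_m_assoc[OF H_sub_carrier])

lemma cl_representative:
  assumes "k \<in> K"
  obtains r where "r \<in> R" "cl k = cl r"
proof -
  obtain h r where hr: "h \<in> H" "r \<in> R" "k = h \<otimes> r"
    using assms K_eq_HR unfolding set_mult_def by blast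
  then have "k = r \<otimes> h"
    using R_central[OF H_in_K[OF hr(1)] hr(2)] by simp
  then show thesis
    using that[OF hr(2)] cl_eqI[OF R_closed[OF hr(2)] hr(1)] by simp
qed

text \<open>Both cosets have representatives in \<open>R\<close>, and these commute, although
  \<open>k\<close> and \<open>k'\<close> themselves need not.\<close>

lemma Q_comm:
  assumes "k \<in> K" "k' \<in> K"
  shows "cl (k \<otimes> k') = cl (k' \<otimes> k)"
proof -
  obtain r where r: "r \<in> R" "cl k = cl r"
    by (rule cl_representative[OF assms(1)])
  obtain r' where r': "r' \<in> R" "cl k' = cl r'"
    by (rule cl_representative[OF assms(2)])
  have "cl k \<otimes>\<^bsub>Q\<^esub> cl k' = cl k' \<otimes>\<^bsub>Q\<^esub> cl k"
    unfolding r(2) r'(2) mult_Q[OF R_in_K[OF r(1)] R_in_K[OF r'(1)]] mult_Q[OF R_in_K[OF r'(1)] R_in_K[OF r(1)]]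
    by (simp only: R_central[OF R_in_K[OF r(1)] r'(1)])
  then show ?thesis
    by (simp only: mult_Q[OF assms] mult_Q[OF assms(2,1)])
qed

section \<open>The amalgamated product and its classes\<close>

lemma group_P: "group (G \<times>\<times> Q)"
  by (rule DirProd_group[OF is_group group_Q])

lemma N_eq: "N = {(z, cl (inv z)) | z. z \<in> center G}"
proof -
  have "inv\<^bsub>Q\<^esub> (z <# H) = cl (inv z)" if "z \<in> center G" for z
    using inv_Q[OF center_in_K[OF that]] by (simp add: cl_def)
  then show ?thesis
    unfolding antidiagonal_center_def by auto
qed

lemma carrier_P: "carrier (G \<times>\<times> Q) = {(g, cl k) | g k. g \<in> carrier G \<and> k \<in> K}"
  unfolding carrier_DirProd carrier_Q by (auto simp del: mem_Collect_eq)

lemma P_closed: "g \<in> carrier G \<Longrightarrow> k \<in> K \<Longrightarrow> (g, cl k) \<in> carrier (G \<times>\<times> Q)"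
  unfolding carrier_P by blast

lemma P_mult: "k \<in> K \<Longrightarrow> k' \<in> K \<Longrightarrow> (g, cl k) \<otimes>\<^bsub>G \<times>\<times> Q\<^esub> (g', cl k') = (g \<otimes> g', cl (k \<otimes> k'))"
  by (simp only: mult_DirProd mult_Q)

lemma N_central:
  assumes "z \<in> center G" "g \<in> carrier G" "k \<in> K"
  shows "(z, cl (inv z)) \<otimes>\<^bsub>G \<times>\<times> Q\<^esub> (g, cl k) = (z \<otimes> g, cl (inv z \<otimes> k))"
    "(g, cl k) \<otimes>\<^bsub>G \<times>\<times> Q\<^esub> (z, cl (inv z)) = (z \<otimes> g, cl (inv z \<otimes> k))"
proof -
  have z: "inv z \<in> K"
    by (rule K_inv[OF center_in_K[OF assms(1)]])
  show "(z, cl (inv z)) \<otimes>\<^bsub>G \<times>\<times> Q\<^esub> (g, cl k) = (z \<otimes> g, cl (inv z \<otimes> k))"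
    by (rule P_mult[OF z assms(3)])
  show "(g, cl k) \<otimes>\<^bsub>G \<times>\<times> Q\<^esub> (z, cl (inv z)) = (z \<otimes> g, cl (inv z \<otimes> k))"
    by (simp only: P_mult[OF assms(3) z] Q_comm[OF assms(3) z] center_comm[OF assms(1,2)])
qed

lemma P_inv: "g \<in> carrier G \<Longrightarrow> k \<in> K \<Longrightarrow> inv\<^bsub>G \<times>\<times> Q\<^esub> (g, cl k) = (inv g, cl (inv k))"
proof -
  assume g: "g \<in> carrier G" and k: "k \<in> K"
  have "cl k \<in> carrier Q"
    unfolding carrier_Q by (rule imageI[OF k])
  then show ?thesis
    by (simp only: inv_DirProd[OF is_group group_Q g] inv_Q[OF k])
qed

lemma subgroup_N: "subgroup N (G \<times>\<times> Q)"
proof (rule group.subgroupI[OF group_P])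
  show "N \<subseteq> carrier (G \<times>\<times> Q)"
  proof
    fix n assume "n \<in> N"
    then obtain z where z: "z \<in> center G" "n = (z, cl (inv z))"
      unfolding N_eq by blast
    show "n \<in> carrier (G \<times>\<times> Q)"
      unfolding z(2) by (rule P_closed[OF center_closed[OF z(1)] K_inv[OF center_in_K[OF z(1)]]])
  qed
  show "N \<noteq> {}"
    unfolding N_eq using subgroup.one_closed[OF subgroup_center] by blast
next
  fix a assume "a \<in> N"
  then obtain z where z: "z \<in> center G" "a = (z, cl (inv z))"
    unfolding N_eq by blast
  have "inv\<^bsub>G \<times>\<times> Q\<^esub> a = (inv z, cl (inv (inv z)))"
    unfolding z(2) by (rule P_inv[OF center_closed[OF z(1)] K_inv[OF center_in_K[OF z(1)]]])
  then show "inv\<^bsub>G \<times>\<times> Q\<^esub> a \<in> N"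
    unfolding N_eq using subgroup.m_inv_closed[OF subgroup_center z(1)] by blast
next
  fix a b assume "a \<in> N" "b \<in> N"
  then obtain z w where z: "z \<in> center G" "a = (z, cl (inv z))" "w \<in> center G" "b = (w, cl (inv w))"
    unfolding N_eq by blast
  have "a \<otimes>\<^bsub>G \<times>\<times> Q\<^esub> b = (z \<otimes> w, cl (inv z \<otimes> inv w))"
    unfolding z(2,4) by (rule P_mult[OF K_inv[OF center_in_K[OF z(1)]] K_inv[OF center_in_K[OF z(3)]]])
  also have "inv z \<otimes> inv w = inv (z \<otimes> w)"
    using center_closed[OF z(1)] center_closed[OF z(3)] center_comm[OF z(1) center_closed[OF z(3)]]
    by (simp add: inv_mult_group[symmetric])
  finally show "a \<otimes>\<^bsub>G \<times>\<times> Q\<^esub> b \<in> N"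
    unfolding N_eq using subgroup.m_closed[OF subgroup_center z(1,3)] by blast
qed

lemma normal_N: "N \<lhd> (G \<times>\<times> Q)"
proof (rule group.normalI[OF group_P subgroup_N], rule ballI)
  fix p assume "p \<in> carrier (G \<times>\<times> Q)"
  then obtain g k where p: "p = (g, cl k)" "g \<in> carrier G" "k \<in> K"
    unfolding carrier_P by blast
  have "n \<otimes>\<^bsub>G \<times>\<times> Q\<^esub> p = p \<otimes>\<^bsub>G \<times>\<times> Q\<^esub> n" if n: "n \<in> N" for n
  proof -
    obtain z where z: "z \<in> center G" "n = (z, cl (inv z))"
      using n unfolding N_eq by blast
    show ?thesis
      unfolding p(1) z(2) N_central[OF z(1) p(2,3)] ..
  qed
  then show "N #>\<^bsub>G \<times>\<times> Q\<^esub> p = p <#\<^bsub>G \<times>\<times> Q\<^esub> N"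
    unfolding r_coset_def l_coset_def by (rule SUP_cong[OF refl arg_cong[where f = "\<lambda>x. {x}"]])
qed

lemma group_E: "group E"
  unfolding extended_group_def by (rule normal.factorgroup_is_group[OF normal_N])

lemma carrier_E: "carrier E = {cls g k | g k. g \<in> carrier G \<and> k \<in> K}"
  unfolding extended_group_def carrier_FactGroup carrier_P cls_def by blast

lemma cls_closed: "g \<in> carrier G \<Longrightarrow> k \<in> K \<Longrightarrow> cls g k \<in> carrier E"
  unfolding carrier_E by blast

lemma mult_E:
  assumes "g \<in> carrier G" "k \<in> K" "g' \<in> carrier G" "k' \<in> K"
  shows "cls g k \<otimes>\<^bsub>E\<^esub> cls g' k' = cls (g \<otimes> g') (k \<otimes> k')"
  unfolding extended_group_def mult_FactGroup cls_def
  using normal.rcos_sum[OF normal_N P_closed[OF assms(1,2)] P_closed[OF assms(3,4)]]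
  by (simp only: P_mult[OF assms(2,4)])

text \<open>The defining relation of the amalgamation: a central factor of the first entry is undone
  by its inverse in the second.\<close>

lemma cls_center:
  assumes z: "z \<in> center G" and g: "g \<in> carrier G" and k: "k \<in> K"
  shows "cls (z \<otimes> g) (inv z \<otimes> k) = cls g k"
proof -
  have n: "(z, cl (inv z)) \<in> N"
    unfolding N_eq using z by blast
  have sub: "N \<subseteq> carrier (G \<times>\<times> Q)"
    by (rule subgroup.subset[OF subgroup_N])
  have "cls (z \<otimes> g) (inv z \<otimes> k) = N #>\<^bsub>G \<times>\<times> Q\<^esub> ((z, cl (inv z)) \<otimes>\<^bsub>G \<times>\<times> Q\<^esub> (g, cl k))"
    unfolding cls_def N_central(1)[OF assms] ..
  also have "\<dots> = N #>\<^bsub>G \<times>\<times> Q\<^esub> (z, cl (inv z)) #>\<^bsub>G \<times>\<times> Q\<^esub> (g, cl k)"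
    by (rule group.coset_mult_assoc[OF group_P sub subsetD[OF sub n] P_closed[OF g k], symmetric])
  also have "N #>\<^bsub>G \<times>\<times> Q\<^esub> (z, cl (inv z)) = N"
    by (rule group.coset_join2[OF group_P subsetD[OF sub n] subgroup_N n])
  finally show ?thesis
    unfolding cls_def .
qed

lemma cls_eqD:
  assumes "g \<in> carrier G" "k \<in> K" "g' \<in> carrier G" "k' \<in> K" "cls g k = cls g' k'"
  shows "\<exists>z\<in>center G. g' = z \<otimes> g \<and> cl k' = cl (inv z \<otimes> k)"
proof -
  have "(g', cl k') \<in> cls g' k'"
    unfolding cls_def by (rule group.rcos_self[OF group_P P_closed[OF assms(3,4)] subgroup_N])
  then have "(g', cl k') \<in> cls g k"
    by (simp only: assms(5))
  then obtain z where "z \<in> center G" "(g', cl k') = (z, cl (inv z)) \<otimes>\<^bsub>G \<times>\<times> Q\<^esub> (g, cl k)"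
    unfolding cls_def r_coset_def N_eq by blast
  then show ?thesis
    using N_central(1)[OF _ assms(1,2)] by auto
qed

lemma cls_cong: "cl k = cl k' \<Longrightarrow> cls g k = cls g k'"
  unfolding cls_def by simp

section \<open>The action on the homogeneous space\<close>

lemma XX_eq: "XX = cl ` carrier G"
  unfolding homogeneous_space_def LCOSETS_def cl_def by blast

lemma cl_mult_right:
  assumes "y \<in> carrier G" "k \<in> carrier G" "k' \<in> carrier G" "cl k = cl k'"
  shows "cl (y \<otimes> k) = cl (y \<otimes> k')"
  using assms cl_translate by metis

text \<open>Two ambiguities vanish for different reasons. The central \<open>z\<close> passes
  through \<open>x\<close> and meets its inverse in front of \<open>k\<close>; the
  \<open>h \<in> H\<close> passes to the right of \<open>k\<close> as a conjugate, which is again in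
  \<open>H\<close> because \<open>K\<close> normalizes \<open>H\<close>.\<close>

lemma action_well_defined:
  assumes "g \<in> carrier G" "k \<in> K" "x \<in> carrier G" "g' \<in> carrier G" "k' \<in> K" "x' \<in> carrier G"
    and "cls g k = cls g' k'" "cl x = cl x'"
  shows "cl (g \<otimes> x \<otimes> k) = cl (g' \<otimes> x' \<otimes> k')"
proof -
  obtain z where z: "z \<in> center G" "g' = z \<otimes> g" "cl k' = cl (inv z \<otimes> k)"
    using cls_eqD[OF assms(1,2,4,5,7)] by blast
  obtain h where h: "h \<in> H" "x' = x \<otimes> h"
    using cl_eqD[OF assms(3,6,8)] by blast
  note zc = center_closed[OF z(1)] and kc = K_closed[OF assms(2)] and hc = H_closed[OF h(1)]
  have "cl (g' \<otimes> x' \<otimes> k') = cl (g' \<otimes> x' \<otimes> (inv z \<otimes> k))"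
    using assms zc kc z(3) by (intro cl_mult_right) auto
  also have "g' \<otimes> x' \<otimes> (inv z \<otimes> k) = g \<otimes> x \<otimes> h \<otimes> k"
  proof -
    have "g' \<otimes> x' = (g \<otimes> x \<otimes> h) \<otimes> z"
      unfolding z(2) h(2) using assms(1,3) zc hc center_comm[OF z(1), of "g \<otimes> x \<otimes> h"] by (simp add: m_assoc)
    then show ?thesis
      using assms(1,3) zc hc kc by (simp add: m_assoc) (simp add: m_assoc[symmetric])
  qed
  also have "\<dots> = (g \<otimes> x \<otimes> k) \<otimes> (inv k \<otimes> h \<otimes> inv (inv k))"
    using assms(1,3) hc kc by (simp add: m_assoc) (simp add: m_assoc[symmetric])
  also have "cl \<dots> = cl (g \<otimes> x \<otimes> k)"
    using assms(1,3) kc H_conj[OF K_inv[OF assms(2)] h(1)] by (intro cl_eqI) auto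
  finally show ?thesis ..
qed

text \<open>The description in \<open>extended_action\<close> only admits representatives
  \<open>r \<in> R\<close>. One exists by \<open>cl_representative\<close>, and
  \<open>action_well_defined\<close> makes the value unique and equal to the one computed from
  \<open>k\<close>.\<close>

lemma action_eq:
  assumes "g \<in> carrier G" "k \<in> K" "x \<in> carrier G"
  shows "\<phi> (cls g k) (cl x) = cl (g \<otimes> x \<otimes> k)"
proof -
  obtain r where r: "r \<in> R" "cl k = cl r"
    by (rule cl_representative[OF assms(2)])
  have ec: "extended_class G \<pi> g r = cls g r" for g r
    by (simp add: extended_class_def cls_def cl_def)
  have "\<phi> (cls g k) (cl x) = (THE d. \<exists>g' \<in> carrier G. \<exists>r \<in> R. \<exists>x' \<in> carrier G.
         cls g k = cls g' r \<and> cl x = cl x' \<and> d = cl (g' \<otimes> x' \<otimes> r))"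
    unfolding extended_action_def ec
    using cls_closed[OF assms(1,2)] assms(3) by (simp add: XX_eq cl_def)
  also have "\<dots> = cl (g \<otimes> x \<otimes> k)"
  proof (rule the_equality)
    have "cl (g \<otimes> x \<otimes> k) = cl (g \<otimes> x \<otimes> r)"
      using assms r R_closed by (intro cl_mult_right) auto
    then show "\<exists>g' \<in> carrier G. \<exists>r \<in> R. \<exists>x' \<in> carrier G.
         cls g k = cls g' r \<and> cl x = cl x' \<and> cl (g \<otimes> x \<otimes> k) = cl (g' \<otimes> x' \<otimes> r)"
      using assms r(1) cls_cong[OF r(2)] by blast
  next
    fix d assume "\<exists>g' \<in> carrier G. \<exists>r \<in> R. \<exists>x' \<in> carrier G.
         cls g k = cls g' r \<and> cl x = cl x' \<and> d = cl (g' \<otimes> x' \<otimes> r)"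
    then obtain g' r x' where *: "g' \<in> carrier G" "r \<in> R" "x' \<in> carrier G"
         "cls g k = cls g' r" "cl x = cl x'" "d = cl (g' \<otimes> x' \<otimes> r)"
      by blast
    show "d = cl (g \<otimes> x \<otimes> k)"
      unfolding *(6) by (rule action_well_defined[OF assms *(1) R_in_K[OF *(2)] *(3,4,5), symmetric])
  qed
  finally show ?thesis .
qed

lemma action_extensional: "e \<in> carrier E \<Longrightarrow> \<phi> e \<in> extensional XX"
  unfolding extended_action_def by simp

lemma action_closed: "e \<in> carrier E \<Longrightarrow> c \<in> XX \<Longrightarrow> \<phi> e c \<in> XX"
proof -
  assume "e \<in> carrier E" "c \<in> XX"
  then obtain g k x where e: "e = cls g k" "g \<in> carrier G" "k \<in> K" and x: "c = cl x" "x \<in> carrier G"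
    unfolding carrier_E XX_eq by blast
  show ?thesis
    unfolding e(1) x(1) action_eq[OF e(2,3) x(2)] XX_eq
    by (intro imageI m_closed e(2) x(2) K_closed[OF e(3)])
qed

lemma action_mult:
  assumes "e \<in> carrier E" "e' \<in> carrier E" "c \<in> XX"
  shows "\<phi> (e \<otimes>\<^bsub>E\<^esub> e') c = \<phi> e (\<phi> e' c)"
proof -
  obtain g k where e: "e = cls g k" "g \<in> carrier G" "k \<in> K"
    using assms(1) unfolding carrier_E by blast
  obtain g' k' where e': "e' = cls g' k'" "g' \<in> carrier G" "k' \<in> K"
    using assms(2) unfolding carrier_E by blast
  obtain x where x: "c = cl x" "x \<in> carrier G"
    using assms(3) unfolding XX_eq by blast
  note kc = K_closed[OF e(3)] K_closed[OF e'(3)]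
  have "\<phi> (e \<otimes>\<^bsub>E\<^esub> e') c = cl ((g \<otimes> g') \<otimes> x \<otimes> (k \<otimes> k'))"
    unfolding e(1) e'(1) x(1) mult_E[OF e(2,3) e'(2,3)]
    by (rule action_eq[OF m_closed[OF e(2) e'(2)] K_mult[OF e(3) e'(3)] x(2)])
  \<comment> \<open>Right multiplications compose in the opposite order; commutativity of the factor
    group repairs this.\<close>
  also have "\<dots> = cl ((g \<otimes> g') \<otimes> x \<otimes> (k' \<otimes> k))"
    using e(2) e'(2) x(2) kc Q_comm[OF e(3) e'(3)] by (intro cl_mult_right) auto
  also have "(g \<otimes> g') \<otimes> x \<otimes> (k' \<otimes> k) = g \<otimes> (g' \<otimes> x \<otimes> k') \<otimes> k"
    using e(2) e'(2) x(2) kc by (simp add: m_assoc)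
  also have "cl \<dots> = \<phi> e (\<phi> e' c)"
    unfolding e(1) e'(1) x(1) using action_eq e(2,3) e'(2,3) x(2) kc(2) by simp
  finally show ?thesis .
qed

lemma one_E: "\<one>\<^bsub>E\<^esub> = cls \<one> \<one>"
proof -
  have "cls \<one> \<one> = N #>\<^bsub>G \<times>\<times> Q\<^esub> \<one>\<^bsub>G \<times>\<times> Q\<^esub>"
    by (simp add: cls_def one_Q)
  also have "\<dots> = N"
    by (rule group.coset_mult_one[OF group_P subgroup.subset[OF subgroup_N]])
  finally show ?thesis
    by (simp add: extended_group_def)
qed

lemma action_one: "c \<in> XX \<Longrightarrow> \<phi> \<one>\<^bsub>E\<^esub> c = c"
proof -
  assume "c \<in> XX"
  then obtain x where x: "c = cl x" "x \<in> carrier G"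
    unfolding XX_eq by blast
  show ?thesis
    unfolding one_E x(1) action_eq[OF one_closed K_one x(2)] using x(2) by simp
qed

lemma action_inv:
  assumes "e \<in> carrier E" "c \<in> XX"
  shows "\<phi> (inv\<^bsub>E\<^esub> e) (\<phi> e c) = c" "\<phi> e (\<phi> (inv\<^bsub>E\<^esub> e) c) = c"
  using action_mult[OF group.inv_closed[OF group_E assms(1)] assms]
    action_mult[OF assms(1) group.inv_closed[OF group_E assms(1)] assms(2)]
    group.l_inv[OF group_E assms(1)] group.r_inv[OF group_E assms(1)] action_one[OF assms(2)]
  by simp_all

lemma action_Bij: "e \<in> carrier E \<Longrightarrow> \<phi> e \<in> Bij XX"
proof -
  assume e: "e \<in> carrier E"
  have "bij_betw (\<phi> e) XX XX"
    by (rule bij_betw_byWitness[where f' = "\<phi> (inv\<^bsub>E\<^esub> e)"])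
      (use action_inv[OF e] action_closed[OF e] action_closed[OF group.inv_closed[OF group_E e]] in auto)
  then show ?thesis
    using action_extensional[OF e] by (simp add: Bij_def)
qed

lemma inv_into_action:
  assumes "e \<in> carrier E" "c \<in> XX"
  shows "inv_into XX (\<phi> e) c = \<phi> (inv\<^bsub>E\<^esub> e) c"
proof (rule inv_into_f_eq)
  show "inj_on (\<phi> e) XX"
    using action_Bij[OF assms(1)] by (simp add: Bij_def bij_betw_def)
qed (use action_inv[OF assms] action_closed[OF group.inv_closed[OF group_E assms(1)] assms(2)] in auto)

lemma action_hom_BijGroup: "\<phi> \<in> hom E (BijGroup XX)"
proof (rule homI)
  show "\<phi> e \<in> carrier (BijGroup XX)" if "e \<in> carrier E" for e
    using action_Bij[OF that] by (simp add: BijGroup_def)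
  fix e e' assume e: "e \<in> carrier E" "e' \<in> carrier E"
  have "\<phi> (e \<otimes>\<^bsub>E\<^esub> e') = compose XX (\<phi> e) (\<phi> e')"
  proof (rule extensionalityI[where A = XX])
    show "\<phi> (e \<otimes>\<^bsub>E\<^esub> e') \<in> extensional XX"
      using action_extensional monoid.m_closed[OF group.is_monoid[OF group_E]] e by blast
  qed (use action_mult[OF e] in \<open>auto simp: compose_def\<close>)
  then show "\<phi> (e \<otimes>\<^bsub>E\<^esub> e') = \<phi> e \<otimes>\<^bsub>BijGroup XX\<^esub> \<phi> e'"
    using action_Bij e by (simp add: BijGroup_def)
qed

lemma action_transitive: "transitive_action E XX \<phi>"
proof -
  have "group_action E XX \<phi>"
    unfolding group_action_def
    by (intro group_hom.intro group_hom_axioms.intro group_E group_BijGroup action_hom_BijGroup)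
  moreover have "\<exists>e\<in>carrier E. \<phi> e c = c'" if "c \<in> XX" "c' \<in> XX" for c c'
  proof -
    obtain x y where xy: "c = cl x" "x \<in> carrier G" "c' = cl y" "y \<in> carrier G"
      using \<open>c \<in> XX\<close> \<open>c' \<in> XX\<close> unfolding XX_eq by blast
    have "\<phi> (cls (y \<otimes> inv x) \<one>) c = c'"
      unfolding xy(1,3) using action_eq[OF _ K_one xy(2), of "y \<otimes> inv x"] xy(2,4) by (simp add: m_assoc)
    then show ?thesis
      using cls_closed[OF _ K_one, of "y \<otimes> inv x"] xy(2,4) by auto
  qed
  ultimately show ?thesis
    unfolding transitive_action_def transitive_action_axioms_def by blast
qed

end

section \<open>Diffeomorphisms and stabilizers\<close>

context symplectic_cover
begin

lemma smooth_on_cover_cong: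
  assumes "\<And>x. x \<in> carrier G \<Longrightarrow> F x = F' x" "smooth_on_cover G \<pi> F"
  shows "smooth_on_cover G \<pi> F'"
  unfolding smooth_on_cover_def
proof
  fix x assume "x \<in> carrier G"
  from bspec[OF assms(2)[unfolded smooth_on_cover_def] this]
  obtain V W f where V: "openin (top_of_set (carrier G)) V" "x \<in> V" "\<pi> ` V \<subseteq> W"
    "smooth_on W f" "\<forall>y\<in>V. F y = f (\<pi> y)"
    by (elim exE conjE)
  have "\<forall>y\<in>V. F' y = f (\<pi> y)"
    using V(5) assms(1) openin_imp_subset[OF V(1)] by (metis subsetD)
  with V(1-4) show "\<exists>V W f. openin (top_of_set (carrier G)) V \<and> x \<in> V \<and> \<pi> ` V \<subseteq> W \<and>
       smooth_on W f \<and> (\<forall>y \<in> V. F' y = f (\<pi> y))"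
    by (intro exI[of _ V] exI[of _ W] exI[of _ f] conjI)
qed

lemma cl_in_XX: "x \<in> carrier G \<Longrightarrow> cl x \<in> XX"
  unfolding XX_eq by (rule imageI)

text \<open>Agreement of \<open>f\<close> with the action is asked on \<open>XX\<close> only, so
  that the lemma also covers \<open>inv_into XX (\<phi> e)\<close>, which is identified with the
  action of the inverse there.\<close>

lemma action_pullback_smooth:
  assumes "e \<in> carrier E" and F: "smooth_on_quotient G \<pi> F"
    and f: "\<And>c. c \<in> XX \<Longrightarrow> f c = \<phi> e c"
  shows "smooth_on_quotient G \<pi> (F \<circ> f)"
proof -
  obtain g k where e: "e = cls g k" "g \<in> carrier G" "k \<in> K"
    using assms(1) unfolding carrier_E by blast
  have "smooth_on_cover G \<pi> (\<lambda>x. F (cl x))"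
    using F by (simp add: smooth_on_quotient_def cl_def)
  then have "smooth_on_cover G \<pi> (\<lambda>x. F (cl (g \<otimes> x \<otimes> k)))"
    by (rule smooth_on_cover_translate[OF e(2) K_closed[OF e(3)]])
  then have "smooth_on_cover G \<pi> (\<lambda>x. (F \<circ> f) (cl x))"
  proof (rule smooth_on_cover_cong[rotated])
    fix x assume x: "x \<in> carrier G"
    show "F (cl (g \<otimes> x \<otimes> k)) = (F \<circ> f) (cl x)"
      by (simp only: o_apply f[OF cl_in_XX[OF x]] e(1) action_eq[OF e(2,3) x])
  qed
  then show ?thesis
    by (simp add: smooth_on_quotient_def cl_def)
qed

lemma action_diffeomorphism:
  assumes e: "e \<in> carrier E"
  shows "\<phi> e \<in> diffeomorphisms G \<pi>"
proof -
  have "smooth_on_quotient G \<pi> (F \<circ> \<phi> e)" "smooth_on_quotient G \<pi> (F \<circ> inv_into XX (\<phi> e))"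
    if F: "smooth_on_quotient G \<pi> F" for F
    by (rule action_pullback_smooth[OF e F], rule refl)
      (rule action_pullback_smooth[OF group.inv_closed[OF group_E e] F], rule inv_into_action[OF e])
  then show ?thesis
    unfolding diffeomorphisms_def using action_Bij[OF e] by blast
qed

lemma action_hom_Diff: "\<phi> \<in> hom E (Diff G \<pi>)"
proof (rule homI)
  show "\<phi> e \<in> carrier (Diff G \<pi>)" if "e \<in> carrier E" for e
    using action_diffeomorphism[OF that] by (simp add: Diff_def)
  show "\<phi> (e \<otimes>\<^bsub>E\<^esub> e') = \<phi> e \<otimes>\<^bsub>Diff G \<pi>\<^esub> \<phi> e'" if "e \<in> carrier E" "e' \<in> carrier E" for e e'
    using hom_mult[OF action_hom_BijGroup that] by (simp add: Diff_def)
qed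

section \<open>The parametrization of stabilizers by \<open>K\<close>\<close>

definition \<Psi> where "\<Psi> x k = cls (x \<otimes> k \<otimes> inv x) (inv k)"

abbreviation UU where "UU \<equiv> (U :: (complex^'n^'n) monoid)"
abbreviation N2 where "N2 \<equiv> {mat 1, - mat 1 :: complex^'n^'n}"

text \<open>The projection of \<open>K\<close> to \<open>U(n)\<close> modulo sign. It has the same
  fibres as \<open>\<Psi> x\<close>, namely equality of \<open>\<pi> k\<close> up to sign, so
  stabilizer and quotient group are compared as two images of \<open>K\<close>.\<close>

definition \<rho> where "\<rho> k = N2 #>\<^bsub>UU\<^esub> unrealify (\<pi> k)"

lemma unrealify_K:
  assumes "k \<in> K"
  shows "unrealify (\<pi> k) \<in> carrier UU" "realification (unrealify (\<pi> k)) = \<pi> k"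
  using assms by auto

lemma K_of_U: "u \<in> carrier UU \<Longrightarrow> \<exists>k\<in>K. unrealify (\<pi> k) = u"
proof -
  assume u: "u \<in> carrier UU"
  then have "realification u \<in> realification ` carrier UU"
    by (rule imageI)
  then have "realification u \<in> \<pi> ` carrier G"
    unfolding realification_U pi_surj by blast
  then obtain k where k: "realification u = \<pi> k" "k \<in> carrier G"
    by (rule imageE)
  have "k \<in> K"
    using k u by (auto simp flip: k(1))
  moreover have "unrealify (\<pi> k) = u"
    by (simp flip: k(1))
  ultimately show ?thesis by blast
qed

lemma subgroup_N2: "subgroup N2 UU"
proof (rule group.subgroupI[OF group_U])
  show "N2 \<subseteq> carrier UU"
    using uminus_mat_1_in_U by (auto simp: carrier_U)
  have *: "(- mat 1) ** (- mat 1) = (mat 1 :: complex^'n^'n)"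
    by (simp add: minus_matrix_mult)
  show "inv\<^bsub>UU\<^esub> a \<in> N2" if a: "a \<in> N2" for a
  proof -
    have "a \<in> carrier UU"
      using a \<open>N2 \<subseteq> carrier UU\<close> by blast
    then have "inv\<^bsub>UU\<^esub> a = a"
      using a * by (intro group.inv_equality[OF group_U]) auto
    then show ?thesis
      using a by simp
  qed
  show "a \<otimes>\<^bsub>UU\<^esub> b \<in> N2" if "a \<in> N2" "b \<in> N2" for a b
    using that * by (auto simp: minus_matrix_mult)
qed simp

lemma r_coset_N2: "N2 #>\<^bsub>UU\<^esub> u = {u, - u}"
  by (auto simp: r_coset_def minus_matrix_mult)

lemma normal_N2: "N2 \<lhd> UU"
proof (rule group.normalI[OF group_U subgroup_N2], rule ballI)
  fix u assume "u \<in> carrier UU"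
  show "N2 #>\<^bsub>UU\<^esub> u = u <#\<^bsub>UU\<^esub> N2"
    by (auto simp: r_coset_def l_coset_def minus_matrix_mult matrix_mult_minus)
qed

lemma \<rho>_eq_iff:
  assumes "k \<in> K" "k' \<in> K"
  shows "\<rho> k = \<rho> k' \<longleftrightarrow> \<pi> k = \<pi> k' \<or> \<pi> k = - \<pi> k'"
proof -
  have "\<rho> k = \<rho> k' \<longleftrightarrow> unrealify (\<pi> k) = unrealify (\<pi> k') \<or> unrealify (\<pi> k) = - unrealify (\<pi> k')"
    unfolding \<rho>_def r_coset_N2 by (auto simp: doubleton_eq_iff)
  also have "\<dots> \<longleftrightarrow> realification (unrealify (\<pi> k)) = realification (unrealify (\<pi> k')) \<or>
      realification (unrealify (\<pi> k)) = - realification (unrealify (\<pi> k'))"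
    by (simp only: realification_inject flip: realification_uminus)
  finally show ?thesis
    by (simp only: unrealify_K(2)[OF assms(1)] unrealify_K(2)[OF assms(2)])
qed

lemma \<rho>_mult: "k \<in> K \<Longrightarrow> k' \<in> K \<Longrightarrow> \<rho> (k \<otimes> k') = \<rho> k \<otimes>\<^bsub>UU Mod N2\<^esub> \<rho> k'"
proof -
  assume k: "k \<in> K" "k' \<in> K"
  have "realification (unrealify (\<pi> (k \<otimes> k'))) = realification (unrealify (\<pi> k) ** unrealify (\<pi> k'))"
    unfolding unrealify_K(2)[OF K_mult[OF k]] realification_mult unrealify_K(2)[OF k(1)] unrealify_K(2)[OF k(2)]
    by (rule pi_mult[OF K_closed[OF k(1)] K_closed[OF k(2)]])
  then have "unrealify (\<pi> (k \<otimes> k')) = unrealify (\<pi> k) ** unrealify (\<pi> k')"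
    by (simp only: realification_inject)
  then show ?thesis
    using normal.rcos_sum[OF normal_N2 unrealify_K(1)[OF k(1)] unrealify_K(1)[OF k(2)]]
    by (simp only: \<rho>_def mult_FactGroup mult_U)
qed

lemma carrier_U_Mod: "carrier (UU Mod N2) = \<rho> ` K"
proof -
  have "carrier UU = (\<lambda>k. unrealify (\<pi> k)) ` K"
    using K_of_U unrealify_K(1) by blast
  then have "(\<lambda>u. N2 #>\<^bsub>UU\<^esub> u) ` carrier UU = (\<lambda>u. N2 #>\<^bsub>UU\<^esub> u) ` (\<lambda>k. unrealify (\<pi> k)) ` K"
    by (rule arg_cong)
  also have "\<dots> = \<rho> ` K"
    unfolding \<rho>_def[abs_def] by (rule image_image)
  finally show ?thesis
    unfolding carrier_FactGroup .
qed

context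
  fixes x assumes x: "x \<in> carrier G"
begin

lemma conj_closed: "k \<in> K \<Longrightarrow> x \<otimes> k \<otimes> inv x \<in> carrier G"
  by (intro m_closed x inv_closed K_closed)

lemma \<Psi>_closed: "k \<in> K \<Longrightarrow> \<Psi> x k \<in> carrier E"
  unfolding \<Psi>_def by (rule cls_closed[OF conj_closed K_inv])

lemma \<Psi>_mult:
  assumes "k \<in> K" "k' \<in> K"
  shows "\<Psi> x (k \<otimes> k') = \<Psi> x k \<otimes>\<^bsub>E\<^esub> \<Psi> x k'"
proof -
  note kc = K_closed[OF assms(1)] K_closed[OF assms(2)]
  have "\<Psi> x k \<otimes>\<^bsub>E\<^esub> \<Psi> x k' = cls ((x \<otimes> k \<otimes> inv x) \<otimes> (x \<otimes> k' \<otimes> inv x)) (inv k \<otimes> inv k')"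
    unfolding \<Psi>_def by (rule mult_E[OF conj_closed[OF assms(1)] K_inv[OF assms(1)] conj_closed[OF assms(2)] K_inv[OF assms(2)]])
  also have "\<dots> = cls ((x \<otimes> k \<otimes> inv x) \<otimes> (x \<otimes> k' \<otimes> inv x)) (inv k' \<otimes> inv k)"
    by (rule cls_cong[OF Q_comm[OF K_inv[OF assms(1)] K_inv[OF assms(2)]]])
  also have "(x \<otimes> k \<otimes> inv x) \<otimes> (x \<otimes> k' \<otimes> inv x) = x \<otimes> (k \<otimes> k') \<otimes> inv x"
    using x kc by (simp add: m_assoc) (simp add: m_assoc[symmetric])
  also have "inv k' \<otimes> inv k = inv (k \<otimes> k')"
    by (rule inv_mult_group[OF kc, symmetric])
  finally show ?thesis
    by (simp only: \<Psi>_def)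
qed

text \<open>Here \<open>k'\<close> is \<open>k\<close> times a central \<open>z\<close>. It appears
  as \<open>z\<close> in the first entry and, after a swap by \<open>Q_comm\<close>, as
  \<open>inv z\<close> in the second, so \<open>cls_center\<close> removes it.\<close>

lemma \<Psi>_eq:
  assumes k: "k \<in> K" "k' \<in> K" and pi: "\<pi> k = \<pi> k' \<or> \<pi> k = - \<pi> k'"
  shows "\<Psi> x k = \<Psi> x k'"
proof -
  note kc = K_closed[OF k(1)] K_closed[OF k(2)]
  let ?z = "k' \<otimes> inv k"
  have "\<pi> ?z = \<pi> k' ** \<pi> (inv k)"
    by (rule pi_mult[OF kc(2) inv_closed[OF kc(1)]])
  moreover have "\<pi> k ** \<pi> (inv k) = mat 1"
    by (rule pi_inv_mult(2)[OF kc(1)])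
  ultimately have "\<pi> ?z = mat 1 \<or> \<pi> ?z = - mat 1"
    using pi by (auto simp: minus_matrix_mult) (metis add.inverse_inverse)
  then have z: "?z \<in> center G"
    unfolding center_eq using kc by blast
  have k': "k' = ?z \<otimes> k"
    using kc by (simp add: m_assoc)
  have "x \<otimes> k' \<otimes> inv x = ?z \<otimes> (x \<otimes> k \<otimes> inv x)"
  proof -
    have "x \<otimes> k' = x \<otimes> (?z \<otimes> k)"
      by (rule arg_cong[OF k'])
    then have "x \<otimes> k' \<otimes> inv x = (x \<otimes> ?z) \<otimes> k \<otimes> inv x"
      using x kc by (simp only: m_assoc[OF x center_closed[OF z] kc(1)])
    also have "x \<otimes> ?z = ?z \<otimes> x"
      by (rule center_comm[OF z x, symmetric])
    finally show ?thesis
      using x kc by (simp add: m_assoc)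
  qed
  moreover have "cl (inv k') = cl (inv ?z \<otimes> inv k)"
  proof -
    have "inv k' = inv (?z \<otimes> k)"
      by (rule arg_cong[OF k'])
    also have "\<dots> = inv k \<otimes> inv ?z"
      by (rule inv_mult_group[OF center_closed[OF z] kc(1)])
    finally have "cl (inv k') = cl (inv k \<otimes> inv ?z)"
      by (rule arg_cong)
    also have "\<dots> = cl (inv ?z \<otimes> inv k)"
      by (rule Q_comm[OF K_inv[OF k(1)] K_inv[OF center_in_K[OF z]]])
    finally show ?thesis .
  qed
  ultimately have "\<Psi> x k' = cls (?z \<otimes> (x \<otimes> k \<otimes> inv x)) (inv ?z \<otimes> inv k)"
    by (simp only: \<Psi>_def cls_def)
  also have "\<dots> = \<Psi> x k"
    unfolding \<Psi>_def by (rule cls_center[OF z conj_closed[OF k(1)] K_inv[OF k(1)]])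
  finally show ?thesis ..
qed

lemma stabilizer_eq: "stabilizer E \<phi> (cl x) = \<Psi> x ` K"
proof (intro equalityI subsetI)
  fix e assume "e \<in> stabilizer E \<phi> (cl x)"
  then have eE: "e \<in> carrier E" and fix_x: "\<phi> e (cl x) = cl x"
    by (auto simp: stabilizer_def)
  obtain g k where e: "e = cls g k" "g \<in> carrier G" "k \<in> K"
    using eE unfolding carrier_E by blast
  note kc = K_closed[OF e(3)]
  have "cl x = cl (g \<otimes> x \<otimes> k)"
    using fix_x unfolding e(1) action_eq[OF e(2,3) x] by (rule sym)
  then obtain h where h: "h \<in> H" "g \<otimes> x \<otimes> k = x \<otimes> h"
    using cl_eqD[OF x m_closed[OF m_closed[OF e(2) x] kc]] by blast
  note hc = H_closed[OF h(1)]
  \<comment> \<open>Solving \<open>g \<otimes> x \<otimes> k = x \<otimes> h\<close> for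
    \<open>g\<close> gives conjugation of this element by \<open>x\<close>. Its inverse
    \<open>k \<otimes> inv h\<close> lies in the coset of \<open>k\<close>, so the unknown
    \<open>h\<close> does no harm.\<close>
  let ?k = "h \<otimes> inv k"
  have K: "?k \<in> K"
    by (rule K_mult[OF H_in_K[OF h(1)] K_inv[OF e(3)]])
  have "g \<otimes> x = x \<otimes> h \<otimes> inv k"
    using h(2) e(2) x kc hc by (metis inv_solve_right m_closed)
  then have "g = x \<otimes> h \<otimes> inv k \<otimes> inv x"
    using e(2) x kc hc by (metis inv_solve_right m_closed inv_closed)
  then have 1: "g = x \<otimes> ?k \<otimes> inv x"
    using x kc hc by (simp add: m_assoc)
  have "inv ?k = k \<otimes> inv h"
    using kc hc by (simp add: inv_mult_group)
  then have "cl (inv ?k) = cl k"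
    using cl_eqI[OF kc subgroup.m_inv_closed[OF subgroup_H h(1)]] by simp
  then have "e = \<Psi> x ?k"
    unfolding e(1) \<Psi>_def 1[symmetric] by (rule cls_cong[OF sym])
  then show "e \<in> \<Psi> x ` K"
    using K by (rule image_eqI)
next
  fix e assume "e \<in> \<Psi> x ` K"
  then obtain k where k: "e = \<Psi> x k" "k \<in> K"
    by (rule imageE)
  note kc = K_closed[OF k(2)]
  have "\<phi> e (cl x) = cl ((x \<otimes> k \<otimes> inv x) \<otimes> x \<otimes> inv k)"
    unfolding k(1) \<Psi>_def by (rule action_eq[OF conj_closed[OF k(2)] K_inv[OF k(2)] x])
  also have "(x \<otimes> k \<otimes> inv x) \<otimes> x \<otimes> inv k = x"
    using x kc by (simp add: m_assoc)
  finally show "e \<in> stabilizer E \<phi> (cl x)"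
    using \<Psi>_closed[OF k(2)] by (simp add: stabilizer_def k(1))
qed

end

end

section \<open>The topology of the stabilizers\<close>

text \<open>Simple connectedness is phrased by free homotopy of loops. Applied to the constant loops
  at \<open>a\<close> and \<open>b\<close>, it gives a homotopy whose track at parameter 0 is a path
  from \<open>a\<close> to \<open>b\<close>.\<close>

lemma simply_connected_path_connected:
  fixes S :: "('a::topological_space) set"
  assumes "simply_connected S"
  shows "path_connected S"
  unfolding path_connected_def
proof (intro ballI)
  fix a b assume ab: "a \<in> S" "b \<in> S"
  have c: "path (\<lambda>t. c)" "pathfinish (\<lambda>t. c) = pathstart (\<lambda>t. c)" "path_image (\<lambda>t. c) \<subseteq> S" if "c \<in> S" for c
    using that by (auto simp: path_def pathstart_def pathfinish_def path_image_def)
  have "homotopic_loops S (\<lambda>t. a) (\<lambda>t. b)"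
    using assms c[OF ab(1)] c[OF ab(2)] unfolding simply_connected_def by blast
  then obtain h where h: "continuous_on ({0..1::real} \<times> {0..1::real}) h" "h \<in> {0..1} \<times> {0..1} \<rightarrow> S"
    "\<forall>t\<in>{0..1}. h (0, t) = a" "\<forall>t\<in>{0..1}. h (1, t) = b"
    unfolding homotopic_loops by blast
  have "continuous_on {0..1} (\<lambda>s. h (s, 0))"
    by (rule continuous_on_compose2[OF h(1)]) (auto intro!: continuous_intros)
  then have "path (\<lambda>s. h (s, 0))"
    by (simp add: path_def)
  moreover have "path_image (\<lambda>s. h (s, 0)) \<subseteq> S"
    using h(2) by (auto simp: path_image_def)
  moreover have "pathstart (\<lambda>s. h (s, 0)) = a" "pathfinish (\<lambda>s. h (s, 0)) = b"
    using h(3,4) by (auto simp: pathstart_def pathfinish_def)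
  ultimately show "\<exists>g. path g \<and> path_image g \<subseteq> S \<and> pathstart g = a \<and> pathfinish g = b"
    by blast
qed

text \<open>The array of all products of two entries, that is, \<open>M\<close> tensored with
  itself: a continuous function with values in a Hausdorff space that forgets exactly the sign of
  \<open>M\<close>.\<close>

definition tensor_square :: "real^'m^'m \<Rightarrow> (real^'m^'m)^'m^'m"
  where "tensor_square M = (\<chi> i j. M $ i $ j *\<^sub>R M)"

lemma tensor_square_eq_iff: "tensor_square M = tensor_square M' \<longleftrightarrow> M = M' \<or> M = - M'"
proof
  assume "tensor_square M = tensor_square M'"
  then have eq: "M $ i $ j *\<^sub>R M = M' $ i $ j *\<^sub>R M'" for i j
    by (simp add: tensor_square_def vec_eq_iff)
  show "M = M' \<or> M = - M'"
  proof (cases "M = 0")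
    case True
    have "M' $ i $ j * M' $ i $ j = 0" for i j
      using arg_cong[OF eq[of i j], of "\<lambda>A. A $ i $ j"] True by simp
    then show ?thesis
      using True by (simp add: vec_eq_iff)
  next
    case False
    then obtain i j where ij: "M $ i $ j \<noteq> 0"
      by (auto simp: vec_eq_iff)
    have "M $ i $ j * M $ i $ j = M' $ i $ j * M' $ i $ j"
      using arg_cong[OF eq[of i j], of "\<lambda>A. A $ i $ j"] by simp
    then have "M' $ i $ j = M $ i $ j \<or> M' $ i $ j = - M $ i $ j"
      using square_eq_iff by metis
    then have "M $ i $ j *\<^sub>R M = M $ i $ j *\<^sub>R M' \<or> M $ i $ j *\<^sub>R M = M $ i $ j *\<^sub>R (- M')"
      using eq[of i j] by auto
    then show ?thesis
      using ij by (metis scaleR_cancel_left)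
  qed
qed (auto simp: tensor_square_def)

lemma continuous_on_tensor_square:
  assumes "continuous_on S f"
  shows "continuous_on S (\<lambda>x. tensor_square (f x))"
  unfolding tensor_square_def by (intro continuous_intros assms)

context symplectic_cover
begin

abbreviation TQ where "TQ \<equiv> HR_mod_H_topology G \<pi>"
abbreviation TP where "TP \<equiv> prod_topology (top_of_set (carrier G)) TQ"
abbreviation TE where "TE \<equiv> extended_group_topology G \<pi>"
abbreviation TU where "TU \<equiv> quotient_group_topology UU (top_of_set (carrier UU)) N2"

lemma carrier_HR: "carrier HR = K"
  by simp

lemma cl_quotient_map: "quotient_map (top_of_set K) TQ cl"
proof -
  have "quotient_map (top_of_set K) TQ (\<lambda>k. H #>\<^bsub>HR\<^esub> k)"
    using quotient_map_quotient_topology[of "top_of_set K" "\<lambda>k. H #>\<^bsub>HR\<^esub> k"]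
    by (simp only: HR_mod_H_topology_def quotient_group_topology_def carrier_cover_HR carrier_HR)
  then show ?thesis
    by (rule quotient_map_eq) (simp only: topspace_euclidean_subtopology r_coset_H)
qed

lemma topspace_TP: "topspace TP = carrier (G \<times>\<times> Q)"
proof -
  have "topspace TQ = carrier Q"
    using quotient_imp_surjective_map[OF cl_quotient_map]
    by (simp only: topspace_euclidean_subtopology carrier_Q)
  then show ?thesis
    by (simp only: topspace_prod_topology topspace_euclidean_subtopology carrier_DirProd)
qed

lemma cls_quotient_map: "quotient_map TP TE (\<lambda>p. N #>\<^bsub>G \<times>\<times> Q\<^esub> p)"
  unfolding extended_group_topology_def quotient_group_topology_def
  by (rule quotient_map_quotient_topology)

lemma topspace_TE: "topspace TE = carrier E"
  using quotient_imp_surjective_map[OF cls_quotient_map]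
  by (simp only: topspace_TP extended_group_def carrier_FactGroup)

text \<open>A covering map is open, and its restriction to a full preimage is open onto the subset
  below; \<open>K\<close> is the full preimage of \<open>U(n)\<close>.\<close>

lemma unrealify_pi_quotient_map: "quotient_map (top_of_set K) (top_of_set (carrier UU)) (\<lambda>k. unrealify (\<pi> k))"
proof (rule continuous_open_imp_quotient_map)
  have cont: "continuous_on K (\<lambda>k. unrealify (\<pi> k))"
    by (intro continuous_on_unrealify continuous_on_subset[OF pi_cont]) (rule Collect_restrict)
  have im: "(\<lambda>k. unrealify (\<pi> k)) ` K = carrier UU"
    using K_of_U unrealify_K(1) by blast
  show "continuous_map (top_of_set K) (top_of_set (carrier UU)) (\<lambda>k. unrealify (\<pi> k))"
    unfolding continuous_map_subtopology_eu using cont unrealify_K(1) by blast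
  show "(\<lambda>k. unrealify (\<pi> k)) ` topspace (top_of_set K) = topspace (top_of_set (carrier UU))"
    unfolding topspace_euclidean_subtopology by (rule im)
  show "open_map (top_of_set K) (top_of_set (carrier UU)) (\<lambda>k. unrealify (\<pi> k))"
    unfolding open_map_def
  proof (intro allI impI)
    fix V assume V: "openin (top_of_set K) V"
    have KG: "K \<subseteq> carrier G"
      by (rule Collect_restrict)
    obtain S where S: "open S" "V = K \<inter> S"
      using V unfolding openin_open by blast
    have "openin (top_of_set (carrier G)) (carrier G \<inter> S)"
      using S(1) by (rule openin_open_Int)
    then have "openin (top_of_set (carrier Sp)) (\<pi> ` (carrier G \<inter> S))"
      by (rule covering_space_open[OF pi_cover])
    then obtain S' where S': "open S'" "\<pi> ` (carrier G \<inter> S) = carrier Sp \<inter> S'"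
      unfolding openin_open by blast
    have "(\<lambda>k. unrealify (\<pi> k)) ` V = carrier UU \<inter> realification -` S'"
    proof (intro equalityI subsetI)
      fix u assume "u \<in> (\<lambda>k. unrealify (\<pi> k)) ` V"
      then obtain k where k: "k \<in> V" "u = unrealify (\<pi> k)"
        by blast
      then have kK: "k \<in> K" and kS: "k \<in> S"
        using S(2) by blast+
      have "\<pi> k \<in> carrier Sp \<inter> S'"
        unfolding S'(2)[symmetric] using kS K_closed[OF kK] by blast
      then show "u \<in> carrier UU \<inter> realification -` S'"
        using k(2) unrealify_K[OF kK] by simp
    next
      fix u assume u: "u \<in> carrier UU \<inter> realification -` S'"
      then have "realification u \<in> realification ` carrier UU"
        by blast
      then have "realification u \<in> \<pi> ` (carrier G \<inter> S)"
        unfolding S'(2) using u by (simp add: realification_U)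
      then obtain k where k: "realification u = \<pi> k" "k \<in> carrier G" "k \<in> S"
        by blast
      then have "k \<in> V"
        using u unfolding S(2) by (simp flip: k(1))
      moreover have "u = unrealify (\<pi> k)"
        by (simp flip: k(1))
      ultimately show "u \<in> (\<lambda>k. unrealify (\<pi> k)) ` V"
        by blast
    qed
    moreover have "open (realification -` S' :: (complex^'n^'n) set)"
      by (intro open_vimage S'(1) continuous_on_realification continuous_on_id)
    ultimately show "openin (top_of_set (carrier UU)) ((\<lambda>k. unrealify (\<pi> k)) ` V)"
      by (simp add: openin_open_Int)
  qed
qed

lemma \<rho>_quotient_map: "quotient_map (top_of_set K) TU \<rho>"
proof -
  have "quotient_map (top_of_set (carrier UU)) TU (\<lambda>u. N2 #>\<^bsub>UU\<^esub> u)"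
    unfolding quotient_group_topology_def by (rule quotient_map_quotient_topology)
  from quotient_map_compose[OF unrealify_pi_quotient_map this] show ?thesis
    by (simp only: o_def \<rho>_def[abs_def])
qed

lemma topspace_TU: "topspace TU = carrier (UU Mod N2)"
  using quotient_imp_surjective_map[OF \<rho>_quotient_map]
  by (simp only: topspace_euclidean_subtopology carrier_U_Mod)

lemma compact_TU: "compact_space TU"
proof -
  have "quotient_map (top_of_set (carrier UU)) TU (\<lambda>u. N2 #>\<^bsub>UU\<^esub> u)"
    unfolding quotient_group_topology_def by (rule quotient_map_quotient_topology)
  then have c: "continuous_map (top_of_set (carrier UU)) TU (\<lambda>u. N2 #>\<^bsub>UU\<^esub> u)"
    and s: "(\<lambda>u. N2 #>\<^bsub>UU\<^esub> u) ` carrier UU = topspace TU"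
    by (simp_all add: quotient_imp_continuous_map quotient_map_def)
  have "compactin (top_of_set (carrier UU)) (carrier UU)"
    using compact_U by (simp add: compactin_subtopology)
  then have "compactin TU ((\<lambda>u. N2 #>\<^bsub>UU\<^esub> u) ` carrier UU)"
    by (rule image_compactin[OF _ c])
  then show ?thesis
    by (simp only: s compact_space_def)
qed

context
  fixes x assumes x: "x \<in> carrier G"
begin

lemma \<Psi>_continuous: "continuous_map (top_of_set K) TE (\<Psi> x)"
proof -
  have KG: "K \<subseteq> carrier G"
    by (rule Collect_restrict)
  have "continuous_on K (\<lambda>k. x \<otimes> k \<otimes> inv x)"
    by (intro continuous_on_mult continuous_on_const continuous_on_id) (use x KG in auto)
  then have 1: "continuous_map (top_of_set K) (top_of_set (carrier G)) (\<lambda>k. x \<otimes> k \<otimes> inv x)"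
    unfolding continuous_map_subtopology_eu using conj_closed[OF x] by blast
  have "continuous_on K (\<lambda>k. inv k)"
    by (intro continuous_on_inv continuous_on_id) (use KG in auto)
  then have "continuous_map (top_of_set K) (top_of_set K) (\<lambda>k. inv k)"
    unfolding continuous_map_subtopology_eu using K_inv by blast
  then have "continuous_map (top_of_set K) TQ (cl \<circ> (\<lambda>k. inv k))"
    by (rule continuous_map_compose[OF _ quotient_imp_continuous_map[OF cl_quotient_map]])
  then have "continuous_map (top_of_set K) TP (\<lambda>k. (x \<otimes> k \<otimes> inv x, (cl \<circ> (\<lambda>k. inv k)) k))"
    by (rule continuous_map_pairedI[OF 1])
  from continuous_map_compose[OF this quotient_imp_continuous_map[OF cls_quotient_map]]
  show ?thesis
    by (simp only: o_def \<Psi>_def[abs_def] cls_def)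
qed

text \<open>The sign-invariant function \<open>(g, rH) \<mapsto> tensor_square (\<pi> (x\<inverse> g x))\<close> descends to the extended group and
  separates the points of the stabilizer of \<open>xH\<close>.\<close>

lemma Hausdorff_stabilizer: "Hausdorff_space (subtopology TE (stabilizer E \<phi> (cl x)))"
proof -
  define f where "f p = tensor_square (\<pi> (inv x \<otimes> fst p \<otimes> x))" for p :: "'g \<times> 'g set"
  have "continuous_on (carrier G) (\<lambda>g. inv x \<otimes> g \<otimes> x)"
    by (intro continuous_on_mult continuous_on_const continuous_on_id) (use x in auto)
  then have "continuous_on (carrier G) (\<lambda>g. \<pi> (inv x \<otimes> g \<otimes> x))"
    by (rule continuous_on_compose2[OF pi_cont]) (use x in auto)
  then have "continuous_map (top_of_set (carrier G)) euclidean (\<lambda>g. tensor_square (\<pi> (inv x \<otimes> g \<otimes> x)))"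
    unfolding continuous_map_iff_continuous by (rule continuous_on_tensor_square)
  from continuous_map_compose[OF continuous_map_fst this]
  have f_cont: "continuous_map TP euclidean f"
    by (simp only: o_def f_def[abs_def])
  have wd: "f p = f q" if pq: "p \<in> topspace TP" "q \<in> topspace TP"
    and eq: "N #>\<^bsub>G \<times>\<times> Q\<^esub> p = N #>\<^bsub>G \<times>\<times> Q\<^esub> q" for p q
  proof -
    obtain g k g' k' where p: "p = (g, cl k)" "g \<in> carrier G" "k \<in> K" and q: "q = (g', cl k')" "g' \<in> carrier G" "k' \<in> K"
      using pq unfolding topspace_TP carrier_P by blast
    have "cls g k = cls g' k'"
      using eq by (simp only: p(1) q(1) cls_def)
    then obtain z where z: "z \<in> center G" "g' = z \<otimes> g"
      using cls_eqD[OF p(2,3) q(2,3)] by blast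
    note zc = center_closed[OF z(1)]
    have "inv x \<otimes> g' \<otimes> x = (inv x \<otimes> z) \<otimes> g \<otimes> x"
      using z(2) zc x p(2) by (simp add: m_assoc)
    also have "inv x \<otimes> z = z \<otimes> inv x"
      by (rule center_comm[OF z(1) inv_closed[OF x], symmetric])
    finally have "inv x \<otimes> g' \<otimes> x = z \<otimes> (inv x \<otimes> g \<otimes> x)"
      using zc x p(2) by (simp add: m_assoc)
    then have "\<pi> (inv x \<otimes> g' \<otimes> x) = \<pi> z ** \<pi> (inv x \<otimes> g \<otimes> x)"
      using pi_mult[OF zc m_closed[OF m_closed[OF inv_closed[OF x] p(2)] x]] by (simp only:)
    moreover have "\<pi> z = mat 1 \<or> \<pi> z = - mat 1"
      using z(1) unfolding center_eq by blast
    ultimately have "\<pi> (inv x \<otimes> g \<otimes> x) = \<pi> (inv x \<otimes> g' \<otimes> x) \<or> \<pi> (inv x \<otimes> g \<otimes> x) = - \<pi> (inv x \<otimes> g' \<otimes> x)"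
      by (elim disjE) (simp_all only: matrix_mul_lid minus_matrix_mult minus_minus simp_thms)
    then show ?thesis
      unfolding f_def p(1) q(1) fst_conv tensor_square_eq_iff .
  qed
  have "\<exists>F. continuous_map TE euclidean F \<and> (\<forall>p\<in>topspace TP. F (N #>\<^bsub>G \<times>\<times> Q\<^esub> p) = f p)"
    by (rule quotient_map_lift_exists[OF cls_quotient_map f_cont wd]) blast+
  then obtain F where F: "continuous_map TE euclidean F"
    "\<forall>p\<in>topspace TP. F (N #>\<^bsub>G \<times>\<times> Q\<^esub> p) = f p"
    by (elim exE conjE)
  show ?thesis
  proof (rule Hausdorff_space_injective_preimage)
    show "continuous_map (subtopology TE (stabilizer E \<phi> (cl x))) euclidean F"
      by (rule continuous_map_from_subtopology[OF F(1)])
    have F\<Psi>: "F (\<Psi> x k) = tensor_square (\<pi> k)" if k: "k \<in> K" for k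
    proof -
      have "F (\<Psi> x k) = f (x \<otimes> k \<otimes> inv x, cl (inv k))"
        unfolding \<Psi>_def cls_def
        by (rule bspec[OF F(2)]) (simp only: topspace_TP P_closed[OF conj_closed[OF x k] K_inv[OF k]])
      also have "\<dots> = tensor_square (\<pi> (inv x \<otimes> (x \<otimes> k \<otimes> inv x) \<otimes> x))"
        by (simp only: f_def fst_conv)
      also have "inv x \<otimes> (x \<otimes> k \<otimes> inv x) \<otimes> x = (inv x \<otimes> x) \<otimes> k \<otimes> (inv x \<otimes> x)"
        using x K_closed[OF k] by (simp only: m_assoc m_closed inv_closed)
      also have "\<dots> = k"
        using x K_closed[OF k] by simp
      finally show ?thesis .
    qed
    have "inj_on F (\<Psi> x ` K)"
    proof (rule inj_onI)
      fix a b assume "a \<in> \<Psi> x ` K" "b \<in> \<Psi> x ` K" "F a = F b"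
      then obtain k l where k: "k \<in> K" "a = \<Psi> x k" "l \<in> K" "b = \<Psi> x l"
        by (elim imageE)
      have "tensor_square (\<pi> k) = tensor_square (\<pi> l)"
        using \<open>F a = F b\<close> unfolding k(2,4) F\<Psi>[OF k(1)] F\<Psi>[OF k(3)] .
      then show "a = b"
        unfolding k(2,4) tensor_square_eq_iff by (rule \<Psi>_eq[OF x k(1,3)])
    qed
    then show "inj_on F (topspace (subtopology TE (stabilizer E \<phi> (cl x))))"
      unfolding stabilizer_eq[OF x] by (rule inj_on_subset) (simp only: topspace_subtopology Int_lower2)
  qed simp
qed

text \<open>\<open>\<Psi> x\<close> is constant on the fibres of the quotient map
  \<open>\<rho>\<close>, so it descends to a continuous \<open>j\<close>. The formula for
  \<open>j (\<rho> k)\<close> is exported because multiplicativity is later checked through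
  it.\<close>

lemma stabilizer_homeomorphism:
  obtains j where "homeomorphic_map TU (subtopology TE (stabilizer E \<phi> (cl x))) j"
    "\<forall>k\<in>K. j (\<rho> k) = \<Psi> x k"
proof -
  have wd: "\<Psi> x k = \<Psi> x k'" if "k \<in> topspace (top_of_set K)" "k' \<in> topspace (top_of_set K)" "\<rho> k = \<rho> k'" for k k'
    using \<rho>_eq_iff[of k k'] \<Psi>_eq[OF x, of k k'] that unfolding topspace_euclidean_subtopology by blast
  have "\<exists>j. continuous_map TU TE j \<and> (\<forall>k\<in>topspace (top_of_set K). j (\<rho> k) = \<Psi> x k)"
    by (rule quotient_map_lift_exists[OF \<rho>_quotient_map \<Psi>_continuous wd]) blast+
  then obtain j where j: "continuous_map TU TE j" "\<forall>k\<in>K. j (\<rho> k) = \<Psi> x k"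
    unfolding topspace_euclidean_subtopology by (elim exE conjE)
  let ?S = "stabilizer E \<phi> (cl x)"
  have S: "?S = \<Psi> x ` K"
    by (rule stabilizer_eq[OF x])
  have TU: "topspace TU = \<rho> ` K"
    by (simp only: topspace_TU carrier_U_Mod)
  have im: "j ` topspace TU = ?S"
    unfolding TU S image_image by (rule image_cong[OF refl bspec[OF j(2)]])
  have sub: "?S \<subseteq> topspace TE"
    unfolding topspace_TE stabilizer_def by blast
  have "homeomorphic_map TU (subtopology TE ?S) j"
  proof (rule continuous_imp_homeomorphic_map[OF _ compact_TU Hausdorff_stabilizer])
    show "continuous_map TU (subtopology TE ?S) j"
      unfolding continuous_map_in_subtopology using j(1) im by blast
    show "j ` topspace TU = topspace (subtopology TE ?S)"
      unfolding im topspace_subtopology using sub by blast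
    show "inj_on j (topspace TU)"
      unfolding TU
    proof (rule inj_onI)
      fix a b assume "a \<in> \<rho> ` K" "b \<in> \<rho> ` K" "j a = j b"
      then obtain k l where k: "k \<in> K" "a = \<rho> k" "l \<in> K" "b = \<rho> l"
        by (elim imageE)
      have eq: "\<Psi> x k = \<Psi> x l"
        using \<open>j a = j b\<close> unfolding k(2,4) bspec[OF j(2) k(1)] bspec[OF j(2) k(3)] .
      \<comment> \<open>Equal classes have first entries that differ by a central \<open>z\<close>.
        As \<open>z\<close> commutes with \<open>x\<close>, the conjugation can be undone, leaving
        \<open>l = z \<otimes> k\<close>.\<close>
      obtain z where z: "z \<in> center G" "x \<otimes> l \<otimes> inv x = z \<otimes> (x \<otimes> k \<otimes> inv x)"
        using cls_eqD[OF conj_closed[OF x k(1)] K_inv[OF k(1)] conj_closed[OF x k(3)] K_inv[OF k(3)] eq[unfolded \<Psi>_def]]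
        by blast
      note c = K_closed[OF k(1)] K_closed[OF k(3)] center_closed[OF z(1)]
      have "z \<otimes> (x \<otimes> k \<otimes> inv x) = (z \<otimes> x) \<otimes> k \<otimes> inv x"
        using x c by (simp add: m_assoc)
      also have "z \<otimes> x = x \<otimes> z"
        by (rule center_comm[OF z(1) x])
      finally have "x \<otimes> l \<otimes> inv x = x \<otimes> (z \<otimes> k) \<otimes> inv x"
        unfolding z(2) using x c by (simp add: m_assoc)
      then have "l = z \<otimes> k"
        using x c by simp
      then have "\<pi> l = \<pi> z ** \<pi> k"
        using c by simp
      moreover have "\<pi> z = mat 1 \<or> \<pi> z = - mat 1"
        using z(1) unfolding center_eq by blast
      ultimately have "\<pi> l = \<pi> k \<or> \<pi> l = - \<pi> k"
        by (elim disjE) (simp_all only: matrix_mul_lid minus_matrix_mult simp_thms)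
      then have "\<rho> l = \<rho> k"
        using \<rho>_eq_iff[OF k(3,1)] by blast
      then show "a = b"
        unfolding k(2,4) by (rule sym)
    qed
  qed
  then show thesis
    using j(2) by (rule that)
qed

text \<open>The isomorphism is the inverse of \<open>j\<close>. It sends \<open>\<Psi> x k\<close>
  to \<open>\<rho> k\<close>, and both are multiplicative in \<open>k\<close>, so no formula for it
  on general classes is required.\<close>

lemma stabilizer_isomorphism:
  "\<exists>f. topological_isomorphism (E\<lparr>carrier := stabilizer E \<phi> (cl x)\<rparr>)
     (subtopology TE (stabilizer E \<phi> (cl x))) (UU Mod N2) TU f"
proof -
  let ?S = "stabilizer E \<phi> (cl x)"
  obtain j where j: "homeomorphic_map TU (subtopology TE ?S) j" "\<forall>k\<in>K. j (\<rho> k) = \<Psi> x k"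
    by (rule stabilizer_homeomorphism)
  obtain f where f: "homeomorphic_maps TU (subtopology TE ?S) j f"
    using j(1) unfolding homeomorphic_map_maps by blast
  have f\<Psi>: "f (\<Psi> x k) = \<rho> k" if "k \<in> K" for k
  proof -
    have "\<rho> k \<in> topspace TU"
      unfolding topspace_TU carrier_U_Mod by (rule imageI[OF that])
    then have "f (j (\<rho> k)) = \<rho> k"
      using f unfolding homeomorphic_maps_map by blast
    then show ?thesis
      using bspec[OF j(2) that] by simp
  qed
  have hf: "homeomorphic_map (subtopology TE ?S) TU f"
    using f unfolding homeomorphic_maps_map by blast
  have top: "topspace (subtopology TE ?S) = ?S"
    unfolding topspace_subtopology topspace_TE stabilizer_def by blast
  have carrier_S: "carrier (E\<lparr>carrier := ?S\<rparr>) = ?S"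
    by simp
  have "f \<in> iso (E\<lparr>carrier := ?S\<rparr>) (UU Mod N2)"
  proof (rule isoI)
    have bij: "bij_betw f ?S (carrier (UU Mod N2))"
      using hf unfolding homeomorphic_eq_everything_map bij_betw_def top topspace_TU by blast
    then show "bij_betw f (carrier (E\<lparr>carrier := ?S\<rparr>)) (carrier (UU Mod N2))"
      by simp
    show "f \<in> hom (E\<lparr>carrier := ?S\<rparr>) (UU Mod N2)"
    proof (rule homI)
      fix a assume "a \<in> carrier (E\<lparr>carrier := ?S\<rparr>)"
      then show "f a \<in> carrier (UU Mod N2)"
        using bij by (simp add: bij_betw_apply)
    next
      fix a b assume "a \<in> carrier (E\<lparr>carrier := ?S\<rparr>)" "b \<in> carrier (E\<lparr>carrier := ?S\<rparr>)"
      then have "a \<in> \<Psi> x ` K" "b \<in> \<Psi> x ` K"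
        unfolding carrier_S by (simp_all only: stabilizer_eq[OF x])
      then obtain k l where k: "k \<in> K" "a = \<Psi> x k" "l \<in> K" "b = \<Psi> x l"
        by (elim imageE)
      have "f (a \<otimes>\<^bsub>E\<^esub> b) = \<rho> (k \<otimes> l)"
        unfolding k(2,4) \<Psi>_mult[OF x k(1,3), symmetric] by (rule f\<Psi>[OF K_mult[OF k(1,3)]])
      also have "\<dots> = \<rho> k \<otimes>\<^bsub>UU Mod N2\<^esub> \<rho> l"
        by (rule \<rho>_mult[OF k(1,3)])
      also have "\<dots> = f a \<otimes>\<^bsub>UU Mod N2\<^esub> f b"
        unfolding k(2,4) f\<Psi>[OF k(1)] f\<Psi>[OF k(3)] ..
      finally show "f (a \<otimes>\<^bsub>E\<lparr>carrier := ?S\<rparr>\<^esub> b) = f a \<otimes>\<^bsub>UU Mod N2\<^esub> f b"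
        by simp
    qed
  qed
  then show ?thesis
    unfolding topological_isomorphism_def using hf by blast
qed

lemma stabilizer_compact: "compactin TE (stabilizer E \<phi> (cl x))"
proof -
  let ?S = "stabilizer E \<phi> (cl x)"
  obtain j where j: "homeomorphic_map TU (subtopology TE ?S) j"
    by (rule stabilizer_homeomorphism)
  then have c: "continuous_map TU (subtopology TE ?S) j" and im: "j ` topspace TU = topspace (subtopology TE ?S)"
    unfolding homeomorphic_eq_everything_map by blast+
  have "compactin (subtopology TE ?S) (topspace (subtopology TE ?S))"
    unfolding im[symmetric] by (rule image_compactin[OF compact_TU[unfolded compact_space_def] c])
  moreover have "topspace (subtopology TE ?S) = ?S"
    unfolding topspace_subtopology topspace_TE stabilizer_def by blast
  ultimately show ?thesis
    by (simp only: compactin_subtopology)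
qed

end

end

theorem proposition1p5:
  fixes G :: "('g::topological_space) monoid"
    and \<pi> :: "'g \<Rightarrow> real^('n::finite + 'n)^('n + 'n)"
  assumes "CARD('n) \<ge> 2"
    and "universal_covering_Sp G \<pi>"
  shows "let H = cover_SU G \<pi>; R = cover_R G \<pi>; XX = homogeneous_space G \<pi>;
             E = extended_group G \<pi>; TE = extended_group_topology G \<pi>;
             \<phi> = extended_action G \<pi>
         in
           (\<forall>g \<in> carrier G. \<forall>r \<in> R. \<forall>x \<in> carrier G.
              \<phi> (extended_class G \<pi> g r) (x <#\<^bsub>G\<^esub> H) = (g \<otimes>\<^bsub>G\<^esub> x \<otimes>\<^bsub>G\<^esub> r) <#\<^bsub>G\<^esub> H) \<and>
           \<phi> \<in> hom E (Diff G \<pi>) \<and>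
           transitive_action E XX \<phi> \<and>
           (\<forall>c \<in> XX.
              compactin TE (stabilizer E \<phi> c) \<and>
              (\<exists>f. topological_isomorphism
                     (E\<lparr>carrier := stabilizer E \<phi> c\<rparr>)
                     (subtopology TE (stabilizer E \<phi> c))
                     ((U :: (complex^'n^'n) monoid) Mod {mat 1, - mat 1})
                     (quotient_group_topology U (top_of_set (carrier U)) {mat 1, - mat 1})
                     f))"
proof -
  have cover: "topological_group G" "simply_connected (carrier G)" "\<pi> \<in> hom G Sp"
    "covering_space (carrier G) \<pi> (carrier Sp)"
    using assms(2) by (simp_all add: universal_covering_Sp_def)
  interpret symplectic_cover G \<pi>
    using cover simply_connected_path_connected by unfold_locales
  have "\<phi> (extended_class G \<pi> g r) (x <#\<^bsub>G\<^esub> H) = (g \<otimes>\<^bsub>G\<^esub> x \<otimes>\<^bsub>G\<^esub> r) <#\<^bsub>G\<^esub> H"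
    if "g \<in> carrier G" "r \<in> R" "x \<in> carrier G" for g r x
    using action_eq[OF that(1) R_in_K[OF that(2)] that(3)]
    by (simp only: cls_def cl_def extended_class_def)
  moreover have "compactin TE (stabilizer E \<phi> c) \<and>
      (\<exists>f. topological_isomorphism (E\<lparr>carrier := stabilizer E \<phi> c\<rparr>)
        (subtopology TE (stabilizer E \<phi> c)) (UU Mod N2) TU f)" if c: "c \<in> XX" for c
  proof -
    obtain x where x: "x \<in> carrier G" "c = cl x"
      using c unfolding XX_eq by blast
    show ?thesis
      unfolding x(2) using stabilizer_compact[OF x(1)] stabilizer_isomorphism[OF x(1)] by blast
  qed
  ultimately show ?thesis
    unfolding Let_def using action_hom_Diff action_transitive by blast
qed

end
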